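(* Let $d\in\mathbb N$. There is a Hilbert space $\mathcal H$, a family $\mathscr C_d$ of commuting self-adjoint contractions on $\mathcal H$, and an isometry $V:\mathbb R^d\to\mathcal H$ such that for each symmetric $d\times d$ contraction matrix $X$ there exists a $T\in\mathscr C_d$ such that $$\frac{1}{\vartheta(d)}X=V^*TV.$$ Moreover, $\vartheta(d)$ is the smallest such constant in the sense that if $\vartheta'\in\mathbb R$ satisfies $1\le\vartheta'<\vartheta(d)$, then there is $g\in\mathbb N$ and a $g$-tuple $X$ of $d\times d$ symmetric contractions such that $\frac{1}{\vartheta'}X$ does not dilate to a $g$-tuple of commuting self-adjoint contractions on a Hilbert space.
   Context: $\mathbb N=\{1,2,3,\dots\}$; $\mathbb S_n$ denotes the set of real symmetric $n\times n$ matrices. A self-adjoint operator (or symmetric matrix) $Y$ is a contraction if $\|Y\|\le 1$ in operator norm, equivalently $I\pm Y\succeq 0$. A tuple $X=(X_1,\dots,X_g)$ of symmetric $d\times d$ matrices dilates to a tuple $T=(T_1,\dots,T_g)$ of bounded operators on a Hilbert space $\mathcal H$ if there is an isometry $V:\mathbb R^d\to\mathcal H$ such that $X_j=V^*T_jV$ for all $j$. The constant $\vartheta(d)$ is defined by $$\frac1{\vartheta(d)}=\min_{\substack{a\in\mathbb R^d\\ |a_1|+\dots+|a_d|=d}}\int_{S^{d-1}}\Big|\sum_{i=1}^d a_i\xi_i^2\Big|\,d\xi=\min_{\substack{B\in\mathbb S_d\\ \operatorname{tr}|B|=d}}\int_{S^{d-1}}|\xi^*B\xi|\,d\xi,$$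 where the unit sphere $S^{d-1}\subseteq\mathbb R^d$ carries the rotation invariant probability measure. *)

theory Defs
  imports "HOL-Probability.Probability"
begin

section \<open>The Hilbert space of square-summable real sequences\<close>

text \<open>Hilbert spaces are types of class \<^class>\<open>real_inner\<close> and \<^class>\<open>complete_space\<close>.
  As HOL has no existential quantification over types, the existence of a Hilbert space is
  asserted by means of the type \<open>ell2\<close>.\<close>

definition sq_summable :: "(nat \<Rightarrow> real) \<Rightarrow> bool" where
  "sq_summable f \<longleftrightarrow> summable (\<lambda>i. (f i)\<^sup>2)"

lemma sq_summable_mult:
  assumes "sq_summable f" "sq_summable g"
  shows "summable (\<lambda>i. f i * g i)"
proof (rule summable_comparison_test')
  show "summable (\<lambda>i. (f i)\<^sup>2 + (g i)\<^sup>2)"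
    using assms unfolding sq_summable_def by (rule summable_add)
  fix i
  have "2 * (\<bar>f i\<bar> * \<bar>g i\<bar>) \<le> (f i)\<^sup>2 + (g i)\<^sup>2"
    using sum_squares_bound[of "\<bar>f i\<bar>" "\<bar>g i\<bar>"] by simp
  moreover have "0 \<le> \<bar>f i\<bar> * \<bar>g i\<bar>" by simp
  ultimately show "norm (f i * g i) \<le> (f i)\<^sup>2 + (g i)\<^sup>2"
    unfolding real_norm_def abs_mult by linarith
qed

lemma sq_summable_add:
  assumes "sq_summable f" "sq_summable g"
  shows "sq_summable (\<lambda>i. f i + g i)"
proof -
  have "summable (\<lambda>i. (f i)\<^sup>2 + (g i)\<^sup>2 + 2 * (f i * g i))"
    using assms sq_summable_mult[OF assms] unfolding sq_summable_def
    by (intro summable_add summable_mult)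
  then show ?thesis
    unfolding sq_summable_def by (simp add: power2_sum mult.assoc)
qed

lemma sq_summable_scale:
  assumes "sq_summable f"
  shows "sq_summable (\<lambda>i. c * f i)"
  using assms unfolding sq_summable_def power_mult_distrib by (rule summable_mult)

typedef ell2 = "{f. sq_summable f}"
  morphisms ell2_nth Abs_ell2
  by (rule exI[of _ "\<lambda>_. 0"]) (simp add: sq_summable_def)

setup_lifting type_definition_ell2

instantiation ell2 :: real_vector
begin

lift_definition zero_ell2 :: ell2 is "\<lambda>_. 0"
  by (simp add: sq_summable_def)

lift_definition plus_ell2 :: "ell2 \<Rightarrow> ell2 \<Rightarrow> ell2" is "\<lambda>f g i. f i + g i"
  by (rule sq_summable_add)

lift_definition uminus_ell2 :: "ell2 \<Rightarrow> ell2" is "\<lambda>f i. - f i"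
  by (simp add: sq_summable_def)

lift_definition scaleR_ell2 :: "real \<Rightarrow> ell2 \<Rightarrow> ell2" is "\<lambda>c f i. c * f i"
  by (rule sq_summable_scale)

definition minus_ell2 :: "ell2 \<Rightarrow> ell2 \<Rightarrow> ell2" where
  "minus_ell2 x y = x + - y"

instance
  by standard (simp only: minus_ell2_def; transfer; simp add: algebra_simps fun_eq_iff | transfer; simp add: algebra_simps fun_eq_iff)+

end

instantiation ell2 :: real_inner
begin

lift_definition inner_ell2 :: "ell2 \<Rightarrow> ell2 \<Rightarrow> real" is "\<lambda>f g. \<Sum>i. f i * g i" .

definition norm_ell2 :: "ell2 \<Rightarrow> real" where
  "norm_ell2 x = sqrt (inner x x)"

definition sgn_ell2 :: "ell2 \<Rightarrow> ell2" where
  "sgn_ell2 x = x /\<^sub>R norm x"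

definition dist_ell2 :: "ell2 \<Rightarrow> ell2 \<Rightarrow> real" where
  "dist_ell2 x y = norm (x - y)"

definition uniformity_ell2 :: "(ell2 \<times> ell2) filter" where
  "uniformity_ell2 = (INF e\<in>{0<..}. principal {(x, y). dist x y < e})"

definition open_ell2 :: "ell2 set \<Rightarrow> bool" where
  "open_ell2 U \<longleftrightarrow> (\<forall>x\<in>U. eventually (\<lambda>(x', y). x' = x \<longrightarrow> y \<in> U) uniformity)"

instance
proof
  fix x y z :: ell2 and r :: real
  show "inner x y = inner y x"
    by transfer (simp add: mult.commute)
  show "inner (x + y) z = inner x z + inner y z"
    by transfer (simp add: distrib_right suminf_add sq_summable_mult)
  show "inner (r *\<^sub>R x) y = r * inner x y"
    by transfer (simp add: mult.assoc suminf_mult sq_summable_mult)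
  show "0 \<le> inner x x"
    by transfer (simp add: sq_summable_mult suminf_nonneg)
  show "inner x x = 0 \<longleftrightarrow> x = 0"
    by transfer (auto simp: sq_summable_mult suminf_eq_zero_iff fun_eq_iff)
qed (simp_all add: norm_ell2_def sgn_ell2_def dist_ell2_def uniformity_ell2_def open_ell2_def)

end

lemma ell2_nth_diff: "ell2_nth (x - y) i = ell2_nth x i - ell2_nth y i"
  unfolding minus_ell2_def by transfer simp

lemma ell2_norm_power2_sums: "(\<lambda>i. (ell2_nth x i)\<^sup>2) sums (norm x)\<^sup>2"
proof -
  have "summable (\<lambda>i. (ell2_nth x i)\<^sup>2)"
    using ell2_nth[of x] by (simp add: sq_summable_def)
  moreover have "(norm x)\<^sup>2 = (\<Sum>i. (ell2_nth x i)\<^sup>2)"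
    unfolding power2_norm_eq_inner by transfer (simp add: power2_eq_square)
  ultimately show ?thesis by (simp add: summable_sums)
qed

lemma ell2_sum_le_norm: "(\<Sum>i<n. (ell2_nth x i)\<^sup>2) \<le> (norm x)\<^sup>2"
  using sum_le_suminf[OF sums_summable[OF ell2_norm_power2_sums], of "{..<n}" x]
  by (simp add: sums_unique[OF ell2_norm_power2_sums, symmetric])

lemma ell2_nth_le_norm: "\<bar>ell2_nth x i\<bar> \<le> norm x"
proof -
  have "(ell2_nth x i)\<^sup>2 \<le> (\<Sum>j<Suc i. (ell2_nth x j)\<^sup>2)"
    by (simp add: sum_nonneg)
  also have "\<dots> \<le> (norm x)\<^sup>2" by (rule ell2_sum_le_norm)
  finally show ?thesis by (simp add: abs_le_square_iff[symmetric])
qed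

instance ell2 :: complete_space
proof
  fix X :: "nat \<Rightarrow> ell2"
  assume X: "Cauchy X"
  have "Cauchy (\<lambda>m. ell2_nth (X m) i)" for i
  proof (rule metric_CauchyI)
    fix e :: real assume "0 < e"
    then obtain M where M: "\<And>m n. m \<ge> M \<Longrightarrow> n \<ge> M \<Longrightarrow> dist (X m) (X n) < e"
      using metric_CauchyD[OF X] by blast
    have "dist (ell2_nth (X m) i) (ell2_nth (X n) i) \<le> dist (X m) (X n)" for m n
      using ell2_nth_le_norm[of "X m - X n" i] by (simp add: dist_norm ell2_nth_diff)
    then show "\<exists>M. \<forall>m\<ge>M. \<forall>n\<ge>M. dist (ell2_nth (X m) i) (ell2_nth (X n) i) < e"
      using M by (meson le_less_trans)
  qed
  then have "\<exists>l. (\<lambda>m. ell2_nth (X m) i) \<longlonglongrightarrow> l" for i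
    by (simp add: Cauchy_convergent_iff convergent_def)
  then obtain l where l: "\<And>i. (\<lambda>m. ell2_nth (X m) i) \<longlonglongrightarrow> l i" by metis
  have bound: "\<exists>M. \<forall>m\<ge>M. \<forall>n. (\<Sum>i<n. (ell2_nth (X m) i - l i)\<^sup>2) \<le> e\<^sup>2" if "0 < e" for e
  proof -
    obtain M where M: "\<And>m n. m \<ge> M \<Longrightarrow> n \<ge> M \<Longrightarrow> norm (X m - X n) < e"
      using CauchyD[OF X \<open>0 < e\<close>] by blast
    have "(\<Sum>i<n. (ell2_nth (X m) i - l i)\<^sup>2) \<le> e\<^sup>2" if "m \<ge> M" for m n
    proof (rule LIMSEQ_le_const2)
      show "(\<lambda>k. \<Sum>i<n. (ell2_nth (X m) i - ell2_nth (X k) i)\<^sup>2)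
              \<longlonglongrightarrow> (\<Sum>i<n. (ell2_nth (X m) i - l i)\<^sup>2)"
        by (intro tendsto_intros l)
      have "(\<Sum>i<n. (ell2_nth (X m) i - ell2_nth (X k) i)\<^sup>2) \<le> e\<^sup>2" if "k \<ge> M" for k
      proof -
        have "(\<Sum>i<n. (ell2_nth (X m) i - ell2_nth (X k) i)\<^sup>2) \<le> (norm (X m - X k))\<^sup>2"
          using ell2_sum_le_norm[of "X m - X k" n] by (simp add: ell2_nth_diff)
        also have "\<dots> \<le> e\<^sup>2"
          using M[OF \<open>m \<ge> M\<close> that] by (intro power_mono) auto
        finally show ?thesis .
      qed
      then show "\<exists>N. \<forall>k\<ge>N. (\<Sum>i<n. (ell2_nth (X m) i - ell2_nth (X k) i)\<^sup>2) \<le> e\<^sup>2" by blast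
    qed
    then show ?thesis by blast
  qed
  have sq_diff: "sq_summable (\<lambda>i. ell2_nth (X m) i - l i)"
    if "\<forall>n. (\<Sum>i<n. (ell2_nth (X m) i - l i)\<^sup>2) \<le> c" for m c
    unfolding sq_summable_def by (rule summableI_nonneg_bounded[of _ c]) (use that in auto)
  obtain M where M: "\<forall>n. (\<Sum>i<n. (ell2_nth (X M) i - l i)\<^sup>2) \<le> 1"
    using bound[of 1] by auto
  have "sq_summable (\<lambda>i. ell2_nth (X M) i + (- 1) * (ell2_nth (X M) i - l i))"
    using ell2_nth[of "X M"] by (intro sq_summable_add sq_summable_scale sq_diff[OF M]) simp
  then have sl: "sq_summable l" by simp
  define L where "L = Abs_ell2 l"
  have L: "ell2_nth L = l" unfolding L_def using sl by (simp add: Abs_ell2_inverse)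
  have "X \<longlonglongrightarrow> L"
  proof (rule metric_LIMSEQ_I)
    fix r :: real assume "0 < r"
    then obtain M where M: "\<And>m n. m \<ge> M \<Longrightarrow> (\<Sum>i<n. (ell2_nth (X m) i - l i)\<^sup>2) \<le> (r/2)\<^sup>2"
      using bound[of "r/2"] by auto
    have "dist (X m) L < r" if "m \<ge> M" for m
    proof -
      have "(\<lambda>i. (ell2_nth (X m) i - l i)\<^sup>2) sums (norm (X m - L))\<^sup>2"
        using ell2_norm_power2_sums[of "X m - L"] by (simp add: ell2_nth_diff L)
      then have "(norm (X m - L))\<^sup>2 \<le> (r/2)\<^sup>2"
        using M[OF that] unfolding sums_def by (intro LIMSEQ_le_const2) auto
      then have "norm (X m - L) \<le> r/2"
        using \<open>0 < r\<close> by (simp add: power2_le_iff_abs_le)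
      then show ?thesis using \<open>0 < r\<close> by (simp add: dist_norm)
    qed
    then show "\<exists>M. \<forall>m\<ge>M. dist (X m) L < r" by blast
  qed
  then show "convergent X" by (rule convergentI)
qed

section \<open>The rotation invariant probability measure on the unit sphere\<close>

text \<open>The law of \<open>x / |x|\<close> for \<open>x\<close> uniformly distributed in the unit ball.\<close>

definition sphere_measure :: "'a::euclidean_space measure" where
  "sphere_measure = restrict_space (distr (uniform_measure lborel (ball 0 1)) borel sgn) (sphere 0 1)"

lemma sgn_measurable [measurable]: "(sgn :: 'a::euclidean_space \<Rightarrow> 'a) \<in> borel_measurable borel"
proof -
  have "(\<lambda>x::'a. inverse (norm x) *\<^sub>R x) \<in> borel_measurable borel" by measurable
  then show ?thesis by (simp add: sgn_div_norm[abs_def])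
qed

lemma space_sphere_measure [simp]: "space sphere_measure = sphere 0 1"
  by (simp add: sphere_measure_def space_restrict_space)

lemma sets_sphere_measure [simp, measurable_cong]:
  "sets sphere_measure = sets (restrict_space borel (sphere 0 1))"
  unfolding sphere_measure_def by (rule sets_restrict_space_cong) simp

lemma lborel_ball_pos: "emeasure lborel (ball (0::'a::euclidean_space) 1) \<noteq> 0"
    and lborel_ball_finite: "emeasure lborel (ball (0::'a::euclidean_space) 1) \<noteq> \<infinity>"
  using content_ball_pos[of 1 "0::'a"] emeasure_lborel_ball_finite[of "0::'a" 1]
  by (auto simp: measure_def)

lemma prob_space_distr_sgn:
  "prob_space (distr (uniform_measure lborel (ball (0::'a::euclidean_space) 1)) borel sgn)"
proof -
  interpret prob_space "uniform_measure lborel (ball (0::'a) 1)"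
    by (rule prob_space_uniform_measure[OF lborel_ball_pos lborel_ball_finite])
  show ?thesis by (rule prob_space_distr) simp
qed

lemma prob_space_sphere_measure: "prob_space (sphere_measure :: 'a::euclidean_space measure)"
proof
  let ?u = "uniform_measure lborel (ball (0::'a) 1)"
  interpret D: prob_space "distr ?u borel sgn" by (rule prob_space_distr_sgn)
  have "AE x in lborel. x \<noteq> (0::'a)" by (rule AE_lborel_singleton)
  then have "AE x in ?u. x \<noteq> (0::'a)" by (intro AE_uniform_measureI) auto
  then have "AE x in ?u. sgn x \<in> sphere (0::'a) 1" by eventually_elim (simp add: norm_sgn)
  then have "AE x in distr ?u borel sgn. x \<in> sphere (0::'a) 1"
    by (subst AE_distr_iff) auto
  then have "emeasure (distr ?u borel sgn) (sphere (0::'a) 1) = 1"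
    by (subst D.emeasure_eq_1_AE) auto
  then show "emeasure (sphere_measure :: 'a measure) (space sphere_measure) = 1"
    by (simp add: sphere_measure_def space_restrict_space emeasure_restrict_space)
qed

lemma lborel_orthogonal_invariant:
  fixes f :: "'a::euclidean_space \<Rightarrow> 'a"
  assumes f: "orthogonal_transformation f"
  shows "distr lborel borel f = lborel"
proof -
  have lin: "linear f" by (rule orthogonal_transformation_linear[OF f])
  have fm [measurable]: "f \<in> borel_measurable borel"
    using lin by (intro borel_measurable_continuous_onI linear_continuous_on) (simp add: linear_conv_bounded_linear)
  define N where "N = distr lborel borel f"
  have setsN [measurable_cong, simp]: "sets N = sets borel" by (simp add: N_def)
  have spaceN [simp]: "space N = UNIV" by (simp add: N_def)
  define B where "B = ball (0::'a) 1"
  have [measurable]: "B \<in> sets borel" by (simp add: B_def)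
  have ball_vimage: "f -` ball 0 r = ball 0 r" for r
    using orthogonal_transformation_norm[OF f] by auto
  interpret N: sigma_finite_measure N
  proof
    show "\<exists>A. countable A \<and> A \<subseteq> sets N \<and> \<Union> A = space N \<and> (\<forall>a\<in>A. emeasure N a \<noteq> \<infinity>)"
    proof (intro exI conjI)
      show "countable (range (\<lambda>n::nat. ball (0::'a) (real n)))" by simp
      show "range (\<lambda>n::nat. ball (0::'a) (real n)) \<subseteq> sets N" by auto
      show "\<Union> (range (\<lambda>n::nat. ball (0::'a) (real n))) = space N"
        using reals_Archimedean2 by auto
      show "\<forall>a\<in>range (\<lambda>n::nat. ball (0::'a) (real n)). emeasure N a \<noteq> \<infinity>"
        using emeasure_lborel_ball_finite[of "0::'a"]
        by (auto simp: N_def emeasure_distr ball_vimage less_top[symmetric])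
    qed
  qed
  have trans: "distr N borel ((+) c) = N" for c
  proof -
    obtain b where b: "c = f b"
      using orthogonal_transformation_surj[OF f] by (metis surjD)
    have "distr N borel ((+) c) = distr lborel borel ((+) c \<circ> f)"
      unfolding N_def by (subst distr_distr) auto
    also have "(+) c \<circ> f = f \<circ> (+) b"
      using lin by (simp add: b fun_eq_iff linear_add)
    also have "distr lborel borel (f \<circ> (+) b) = distr (distr lborel borel ((+) b)) borel f"
      by (subst distr_distr) auto
    also have "\<dots> = N" by (simp add: lborel_distr_plus N_def)
    finally show ?thesis .
  qed
  interpret pair_sigma_finite N lborel by standard
  have "N = lborel"
  proof (rule measure_eqI)
    show "sets N = sets lborel" by simp
    fix A assume "A \<in> sets N"
    then have A [measurable]: "A \<in> sets borel" by simp
    have NB: "emeasure N B = emeasure lborel B"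
      by (simp add: N_def emeasure_distr B_def ball_vimage)
    have transN: "(\<integral>\<^sup>+x. indicator A (x + y) \<partial>N) = emeasure N A" for y
    proof -
      have "emeasure N A = (\<integral>\<^sup>+x. indicator A x \<partial>distr N borel ((+) y))"
        by (simp add: trans)
      also have "\<dots> = (\<integral>\<^sup>+x. indicator A (x + y) \<partial>N)"
        by (subst nn_integral_distr) (auto simp: add.commute)
      finally show ?thesis ..
    qed
    have ballN: "(\<integral>\<^sup>+x. indicator B (z - x) \<partial>N) = emeasure N B" for z
    proof -
      have "emeasure N B = (\<integral>\<^sup>+x. indicator B x \<partial>distr N borel ((+) (- z)))"
        by (simp add: trans)
      also have "\<dots> = (\<integral>\<^sup>+x. indicator B (- z + x) \<partial>N)"
        by (subst nn_integral_distr) auto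
      also have "\<dots> = (\<integral>\<^sup>+x. indicator B (z - x) \<partial>N)"
        by (intro nn_integral_cong) (auto simp: B_def indicator_def norm_minus_commute)
      finally show ?thesis ..
    qed
    have transL: "(\<integral>\<^sup>+y. indicator A (x + y) * indicator B y \<partial>lborel)
        = (\<integral>\<^sup>+z. indicator A z * indicator B (z - x) \<partial>lborel)" for x
    proof -
      have "(\<integral>\<^sup>+z. indicator A z * indicator B (z - x) \<partial>lborel)
          = (\<integral>\<^sup>+z. indicator A z * indicator B (z - x) \<partial>distr lborel borel ((+) x))"
        by (simp add: lborel_distr_plus)
      also have "\<dots> = (\<integral>\<^sup>+y. indicator A (x + y) * indicator B y \<partial>lborel)"
        by (subst nn_integral_distr) auto
      finally show ?thesis ..
    qed
    have "emeasure N A * emeasure lborel B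
        = (\<integral>\<^sup>+y. (\<integral>\<^sup>+x. indicator A (x + y) * indicator B y \<partial>N) \<partial>lborel)"
      by (simp add: nn_integral_multc transN nn_integral_cmult)
    also have "\<dots> = (\<integral>\<^sup>+x. (\<integral>\<^sup>+y. indicator A (x + y) * indicator B y \<partial>lborel) \<partial>N)"
      by (rule Fubini') measurable
    also have "\<dots> = (\<integral>\<^sup>+x. (\<integral>\<^sup>+z. indicator A z * indicator B (z - x) \<partial>lborel) \<partial>N)"
      by (simp add: transL)
    also have "\<dots> = (\<integral>\<^sup>+z. (\<integral>\<^sup>+x. indicator A z * indicator B (z - x) \<partial>N) \<partial>lborel)"
      by (rule Fubini'[symmetric]) measurable
    also have "\<dots> = emeasure lborel A * emeasure lborel B"
      by (simp add: nn_integral_cmult nn_integral_multc ballN NB)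
    finally show "emeasure N A = emeasure lborel A"
      using lborel_ball_pos[where 'a='a] lborel_ball_finite[where 'a='a]
      by (auto simp: B_def ennreal_mult_cancel_left mult.commute[of _ "emeasure lborel (ball 0 1)"])
  qed
  then show ?thesis by (simp add: N_def)
qed

lemma sphere_measure_rotation_invariant:
  fixes f :: "'a::euclidean_space \<Rightarrow> 'a"
  assumes f: "orthogonal_transformation f"
  shows "distr sphere_measure sphere_measure f = sphere_measure"
proof -
  have lin: "linear f" by (rule orthogonal_transformation_linear[OF f])
  have nf [simp]: "norm (f x) = norm x" for x by (rule orthogonal_transformation_norm[OF f])
  have fm [measurable]: "f \<in> borel_measurable borel"
    using lin by (intro borel_measurable_continuous_onI linear_continuous_on) (simp add: linear_conv_bounded_linear)
  let ?u = "uniform_measure lborel (ball (0::'a) 1)"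
  define D where "D = distr ?u borel (sgn :: 'a \<Rightarrow> 'a)"
  have inv_u: "distr ?u borel f = ?u"
  proof (rule measure_eqI)
    fix A assume "A \<in> sets (distr ?u borel f)"
    then have A [measurable]: "A \<in> sets borel" by simp
    have "emeasure lborel (ball 0 1 \<inter> A) = emeasure (distr lborel borel f) (ball 0 1 \<inter> A)"
      by (simp add: lborel_orthogonal_invariant[OF f])
    also have "\<dots> = emeasure lborel (f -` (ball 0 1 \<inter> A))"
      by (subst emeasure_distr) auto
    also have "f -` (ball 0 1 \<inter> A) = ball 0 1 \<inter> f -` A" by auto
    finally show "emeasure (distr ?u borel f) A = emeasure ?u A"
      using measurable_sets_borel[OF fm A] by (simp add: emeasure_distr)
  qed simp
  have "distr D borel f = distr ?u borel (f \<circ> sgn)"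
    unfolding D_def by (subst distr_distr) auto
  also have "f \<circ> sgn = sgn \<circ> f"
    using lin by (simp add: fun_eq_iff sgn_div_norm linear_scale)
  also have "distr ?u borel (sgn \<circ> f) = distr (distr ?u borel f) borel sgn"
    by (subst distr_distr) auto
  finally have inv_D: "distr D borel f = D" by (simp add: inv_u D_def)
  have sm: "sphere_measure = restrict_space D (sphere 0 1)"
    by (simp add: sphere_measure_def D_def)
  have fs [measurable]: "f \<in> sphere_measure \<rightarrow>\<^sub>M sphere_measure"
    unfolding measurable_cong_sets[OF sets_sphere_measure sets_sphere_measure]
    by (rule measurable_restrict_space3) auto
  show ?thesis
  proof (rule measure_eqI)
    fix A assume "A \<in> sets (distr sphere_measure sphere_measure f)"
    then have "A \<in> sets (restrict_space borel (sphere (0::'a) 1))" by simp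
    then have A: "A \<subseteq> sphere 0 1" and A' [measurable]: "A \<in> sets borel"
      by (auto simp: sets_restrict_space_iff)
    have [simp]: "space D = UNIV" "sets D = sets borel" by (simp_all add: D_def)
    have "emeasure (distr sphere_measure sphere_measure f) A = emeasure sphere_measure (f -` A)"
    proof (subst emeasure_distr[OF fs])
      show "A \<in> sets sphere_measure"
        using A A' by (simp add: sets_restrict_space_iff)
      have "f -` A \<inter> sphere 0 1 = f -` A" using A by auto
      then show "emeasure sphere_measure (f -` A \<inter> space sphere_measure) = emeasure sphere_measure (f -` A)"
        by simp
    qed
    also have "\<dots> = emeasure D (f -` A)"
      unfolding sm using A by (subst emeasure_restrict_space) auto
    also have "\<dots> = emeasure (distr D borel f) A"
      by (subst emeasure_distr) (auto simp: D_def)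
    also have "\<dots> = emeasure sphere_measure A"
      unfolding inv_D sm using A by (subst emeasure_restrict_space) auto
    finally show "emeasure (distr sphere_measure sphere_measure f) A = emeasure sphere_measure A" .
  qed simp
qed

section \<open>The constant $\vartheta(d)$\<close>

definition sphere_mean :: "real^'n \<Rightarrow> real" where
  "sphere_mean a = (LINT \<xi>|sphere_measure. \<bar>\<Sum>i\<in>UNIV. a $ i * (\<xi> $ i)\<^sup>2\<bar>)"

definition cross_sphere :: "(real^'n) set" where
  "cross_sphere = {a. (\<Sum>i\<in>UNIV. \<bar>a $ i\<bar>) = real CARD('n)}"

text \<open>The dimension is \<open>d = CARD('n)\<close>. The infimum is a minimum, see \<open>vartheta_minimum\<close>.\<close>

definition vartheta :: "'n::finite itself \<Rightarrow> real" where
  "vartheta _ = 1 / (INF a \<in> (cross_sphere :: (real^'n) set). sphere_mean a)"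

lemma sphere_mean_integrable:
  "integrable sphere_measure (\<lambda>\<xi>::real^'n. \<bar>\<Sum>i\<in>UNIV. a $ i * (\<xi> $ i)\<^sup>2\<bar>)"
proof -
  interpret prob_space "sphere_measure :: (real^'n) measure" by (rule prob_space_sphere_measure)
  have "(\<lambda>\<xi>::real^'n. \<bar>\<Sum>i\<in>UNIV. a $ i * (\<xi> $ i)\<^sup>2\<bar>) \<in> borel_measurable borel"
    by (intro borel_measurable_continuous_onI continuous_intros)
  then have "(\<lambda>\<xi>::real^'n. \<bar>\<Sum>i\<in>UNIV. a $ i * (\<xi> $ i)\<^sup>2\<bar>) \<in> borel_measurable sphere_measure"
    unfolding measurable_cong_sets[OF sets_sphere_measure refl] by (rule measurable_restrict_space1)
  moreover have "\<bar>\<Sum>i\<in>UNIV. a $ i * (\<xi> $ i)\<^sup>2\<bar> \<le> (\<Sum>i\<in>UNIV. \<bar>a $ i\<bar>)" if "norm \<xi> = 1" for \<xi> :: "real^'n"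
  proof -
    have "(\<xi> $ i)\<^sup>2 \<le> 1" for i
      using component_le_norm_cart[of \<xi> i] that by (simp add: abs_square_le_1)
    then have "\<bar>a $ i * (\<xi> $ i)\<^sup>2\<bar> \<le> \<bar>a $ i\<bar>" for i
      by (simp add: abs_mult mult_left_le)
    then show ?thesis by (intro order_trans[OF sum_abs] sum_mono)
  qed
  ultimately show ?thesis
    by (intro integrable_const_bound[where B = "\<Sum>i\<in>UNIV. \<bar>a $ i\<bar>"] AE_I2) auto
qed

lemma sphere_mean_lipschitz:
  fixes a b :: "real^'n"
  shows "\<bar>sphere_mean a - sphere_mean b\<bar> \<le> (\<Sum>i\<in>UNIV. \<bar>a $ i - b $ i\<bar>)"
proof -
  interpret prob_space "sphere_measure :: (real^'n) measure" by (rule prob_space_sphere_measure)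
  let ?q = "\<lambda>(a::real^'n) \<xi>. \<Sum>i\<in>UNIV. a $ i * (\<xi> $ i)\<^sup>2"
  have "sphere_mean a - sphere_mean b \<le> (\<Sum>i\<in>UNIV. \<bar>a $ i - b $ i\<bar>)" for a b :: "real^'n"
  proof -
    have "\<bar>?q a \<xi>\<bar> - \<bar>?q b \<xi>\<bar> \<le> (\<Sum>i\<in>UNIV. \<bar>a $ i - b $ i\<bar>)" if "norm \<xi> = 1" for \<xi>
    proof -
      have *: "(\<xi> $ i)\<^sup>2 \<le> 1" for i
        using component_le_norm_cart[of \<xi> i] that by (simp add: abs_square_le_1)
      have "\<bar>?q a \<xi>\<bar> - \<bar>?q b \<xi>\<bar> \<le> \<bar>?q a \<xi> - ?q b \<xi>\<bar>" by linarith
      also have "?q a \<xi> - ?q b \<xi> = (\<Sum>i\<in>UNIV. (a $ i - b $ i) * (\<xi> $ i)\<^sup>2)"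
        by (simp add: sum_subtractf left_diff_distrib)
      also have "\<bar>\<dots>\<bar> \<le> (\<Sum>i\<in>UNIV. \<bar>a $ i - b $ i\<bar>)"
        using * by (intro order_trans[OF sum_abs] sum_mono) (simp add: abs_mult mult_left_le)
      finally show ?thesis .
    qed
    then have "(LINT \<xi>|sphere_measure. \<bar>?q a \<xi>\<bar> - \<bar>?q b \<xi>\<bar>) \<le> (\<Sum>i\<in>UNIV. \<bar>a $ i - b $ i\<bar>)"
      by (intro integral_le_const Bochner_Integration.integrable_diff sphere_mean_integrable AE_I2) auto
    then show ?thesis
      unfolding sphere_mean_def by (simp add: Bochner_Integration.integral_diff sphere_mean_integrable)
  qed
  from this[of a b] this[of b a] show ?thesis
    by (simp only: abs_minus_commute[of "b $ _"])
qed

lemma vartheta_minimum: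
  "\<exists>a \<in> (cross_sphere :: (real^'n) set). 1 / vartheta TYPE('n) = sphere_mean a
      \<and> (\<forall>b \<in> (cross_sphere :: (real^'n) set). sphere_mean a \<le> sphere_mean b)"
proof -
  have "continuous_on UNIV (sphere_mean :: real^'n \<Rightarrow> real)"
    unfolding continuous_on_def
  proof (intro ballI)
    fix a :: "real^'n"
    show "(sphere_mean \<longlongrightarrow> sphere_mean a) (at a)"
    proof (rule LIM_zero_cancel, rule Lim_null_comparison)
      have "((\<lambda>x. \<Sum>i\<in>UNIV. \<bar>x $ i - a $ i\<bar>) \<longlongrightarrow> (\<Sum>i\<in>UNIV. \<bar>a $ i - a $ i\<bar>)) (at a)"
        by (intro tendsto_intros)
      then show "((\<lambda>x. \<Sum>i\<in>UNIV. \<bar>x $ i - a $ i\<bar>) \<longlongrightarrow> 0) (at a)" by simp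
    qed (simp add: sphere_mean_lipschitz)
  qed
  then have cont: "continuous_on cross_sphere (sphere_mean :: real^'n \<Rightarrow> real)"
    by (rule continuous_on_subset) simp
  have "closed (cross_sphere :: (real^'n) set)"
    unfolding cross_sphere_def by (intro closed_Collect_eq continuous_intros)
  moreover have "bounded (cross_sphere :: (real^'n) set)"
    unfolding bounded_iff cross_sphere_def
    by (rule exI[of _ "real CARD('n)"]) (metis (mono_tags, lifting) mem_Collect_eq norm_le_l1_cart)
  ultimately have comp: "compact (cross_sphere :: (real^'n) set)"
    by (simp add: compact_eq_bounded_closed)
  have "(\<chi> i. 1) \<in> (cross_sphere :: (real^'n) set)" by (simp add: cross_sphere_def)
  then have ne: "(cross_sphere :: (real^'n) set) \<noteq> {}" by blast
  obtain a :: "real^'n" where a: "a \<in> cross_sphere" "\<forall>b\<in>(cross_sphere :: (real^'n) set). sphere_mean a \<le> sphere_mean b"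
    using continuous_attains_inf[OF comp ne cont] by blast
  then have "(INF b \<in> (cross_sphere :: (real^'n) set). sphere_mean b) = sphere_mean a"
    by (intro cInf_eq_minimum) auto
  with a show ?thesis by (auto simp: vartheta_def)
qed

section \<open>Contractions, compressions and dilations\<close>

definition symmetric_contraction :: "real^'n^'n \<Rightarrow> bool" where
  "symmetric_contraction X \<longleftrightarrow> transpose X = X \<and> onorm ((*v) X) \<le> 1"

definition selfadjoint_contraction :: "('h::real_inner \<Rightarrow>\<^sub>L 'h) \<Rightarrow> bool" where
  "selfadjoint_contraction T \<longleftrightarrow> (\<forall>x y. inner (T x) y = inner x (T y)) \<and> norm T \<le> 1"

definition isometry :: "('a::real_normed_vector \<Rightarrow>\<^sub>L 'b::real_normed_vector) \<Rightarrow> bool" where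
  "isometry V \<longleftrightarrow> (\<forall>x. norm (V x) = norm x)"

text \<open>The matrix of \<open>V\<^sup>* T V\<close>.\<close>

definition compression :: "((real^'n) \<Rightarrow>\<^sub>L 'h::real_inner) \<Rightarrow> ('h \<Rightarrow>\<^sub>L 'h) \<Rightarrow> real^'n^'n" where
  "compression V T = matrix (adjoint (blinfun_apply V) \<circ> blinfun_apply T \<circ> blinfun_apply V)"

text \<open>A \<open>g\<close>-tuple is a function on \<^typ>\<open>nat\<close> of which only the values at \<open>j < g\<close> matter.\<close>

definition dilates_to :: "nat \<Rightarrow> (nat \<Rightarrow> real^'n^'n) \<Rightarrow> (nat \<Rightarrow> 'h::real_inner \<Rightarrow>\<^sub>L 'h) \<Rightarrow> bool" where
  "dilates_to g X T \<longleftrightarrow> (\<exists>V :: (real^'n) \<Rightarrow>\<^sub>L 'h. isometry V \<and> (\<forall>j<g. X j = compression V (T j)))"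

definition dilates_to_commuting_contractions ::
    "'h::{real_inner, complete_space} itself \<Rightarrow> nat \<Rightarrow> (nat \<Rightarrow> real^'n^'n) \<Rightarrow> bool" where
  "dilates_to_commuting_contractions _ g X \<longleftrightarrow>
    (\<exists>T :: nat \<Rightarrow> 'h \<Rightarrow>\<^sub>L 'h.
       (\<forall>j<g. selfadjoint_contraction (T j)) \<and>
       (\<forall>i<g. \<forall>j<g. T i o\<^sub>L T j = T j o\<^sub>L T i) \<and>
       dilates_to g X T)"

text \<open>HOL cannot quantify over the Hilbert space type \<open>'h\<close> inside the scope of \<open>\<exists>X\<close>. To say that one
  tuple \<open>X\<close> does not dilate on any Hilbert space, one states that \<open>X\<close> does not dilate on
  \<^typ>\<open>ell2\<close>, together with the implication, for all tuples and for an arbitrary \<open>'h\<close>, from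
  dilating on \<open>'h\<close> to dilating on \<^typ>\<open>ell2\<close>.\<close>

text \<open>The library defines \<^const>\<open>adjoint\<close> by choice. For a bounded operator with
  finite-dimensional domain it is the genuine adjoint.\<close>

lemma inner_adjoint_cart:
  fixes V :: "(real^'n) \<Rightarrow>\<^sub>L 'h::real_inner"
  shows "inner (V x) y = inner x (adjoint (blinfun_apply V) y)"
proof -
  have *: "\<forall>x y. inner (V x) y = inner x (\<chi> i. inner (V (axis i 1)) y)"
  proof (intro allI)
    fix x :: "real^'n" and y :: 'h
    have "V x = V (\<Sum>i\<in>UNIV. (x $ i) *\<^sub>R axis i 1)"
      by (simp add: basis_expansion flip: scalar_mult_eq_scaleR)
    also have "\<dots> = (\<Sum>i\<in>UNIV. (x $ i) *\<^sub>R V (axis i 1))"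
      by (simp add: blinfun.sum_right blinfun.scaleR_right)
    finally have "V x = (\<Sum>i\<in>UNIV. (x $ i) *\<^sub>R V (axis i 1))" .
    then show "inner (V x) y = inner x (\<chi> i. inner (V (axis i 1)) y)"
      by (simp add: inner_sum_left inner_vec_def)
  qed
  show ?thesis unfolding adjoint_unique[OF *] using * by blast
qed

lemma compression_nth:
  "compression V T $ i $ j = inner (V (axis i 1)) (T (V (axis j 1)))"
  by (simp add: compression_def matrix_def inner_adjoint_cart inner_axis')

end

theory Submission
  imports Defs
begin

text \<open>Notation: \<open>d = CARD('n)\<close>, \<open>\<sigma>\<close> is the rotation invariant probability measure on the unit sphere,
\<open>q\<^sub>a \<xi> = (\<Sum>i. a\<^sub>i \<xi>\<^sub>i\<^sup>2)\<close> is the quadratic form of the diagonal matrix with entries \<open>a\<close>, and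
\<open>1/\<vartheta>\<close> is the minimum of \<open>\<integral> \<bar>q\<^sub>a\<bar> d\<sigma>\<close> over all \<open>a\<close> with \<open>\<Sum>i. \<bar>a\<^sub>i\<bar> = d\<close>.

Existence. The commuting operators are the multiplications by measurable functions \<open>f\<close> with
\<open>\<bar>f\<bar> \<le> 1\<close> on \<open>L\<^sup>2(\<sigma>)\<close>, and \<open>V x\<close> is the function \<open>\<xi> \<mapsto> \<surd>d \<langle>x, \<xi>\<rangle>\<close>, so that \<open>f\<close> compresses to the
matrix \<open>d \<integral> f(\<xi>) \<xi> \<xi>\<^sup>T d\<sigma>\<close>. Rotating \<open>f\<close> conjugates this matrix, and by the spectral theorem
only diagonal matrices with entries in \<open>[-1/\<vartheta>, 1/\<vartheta>]\<close> have to be obtained. For \<open>f\<close> even in every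
coordinate the matrix is diagonal, with diagonal \<open>(d \<integral> f \<xi>\<^sub>i\<^sup>2 d\<sigma>)\<^sub>i\<close>. These diagonals form a convex set
whose support function at \<open>a\<close> is \<open>d \<integral> \<bar>q\<^sub>a\<bar> d\<sigma>\<close>, attained at \<open>f = sgn q\<^sub>a\<close>; by definition of \<open>\<vartheta>\<close> it
dominates the support function of the cube. Hence the cube lies in the closure of the set, and a point of
the cube outside the set would maximise some \<open>a \<noteq> 0\<close> over the closure. As
\<open>q\<^sub>a\<close> vanishes only on a null set, every maximising sequence tends to \<open>sgn q\<^sub>a\<close> in mean, so the maximiser is the
point given by \<open>sgn q\<^sub>a\<close>, which is in the set (\<open>cube_subset_diagonal_moments\<close>). The space \<open>L\<^sup>2(\<sigma>)\<close> becomes \<open>ell2\<close> through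
a complete orthonormal sequence (\<open>multiplication_operators_on_ell2\<close>).

From dilations to finitely many vectors. If \<open>T\<^sub>1, \<dots>, T\<^sub>g\<close> are commuting self-adjoint contractions, the \<open>2\<^sup>g\<close> products of
the operators \<open>(1 \<plusminus> T\<^sub>j)/2\<close> are positive, have sum \<open>1\<close>, and their sum weighted by the \<open>j\<close>-th sign is \<open>T\<^sub>j\<close>.
Compressing them and splitting the resulting positive matrices into rank-one matrices yields
\<open>\<Sum>m. w\<^sub>m w\<^sub>m\<^sup>T = 1\<close> and \<open>\<Sum>m. s\<^sub>j\<^sub>m w\<^sub>m w\<^sub>m\<^sup>T = Y\<^sub>j\<close> with \<open>\<bar>s\<^sub>j\<^sub>m\<bar> \<le> 1\<close> (\<open>dilation_atoms\<close>): a joint spectral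
measure with finitely many atoms. Multiplication operators on the \<open>L\<^sup>2\<close> space of the finite index set turn such data back into a dilation on
\<open>ell2\<close>, so nothing depends on the Hilbert space (\<open>dilation_on_ell2\<close>).

Optimality. Let \<open>a\<close> be a minimiser, \<open>B\<close> the diagonal matrix of \<open>a\<close> and \<open>X\<^sub>j = U\<^sub>j\<^sup>T (sgn B) U\<^sub>j\<close> for
orthogonal \<open>U\<^sub>1, \<dots>, U\<^sub>g\<close> such that the average of \<open>\<bar>q\<^sub>a(U\<^sub>j v)\<bar>\<close> over \<open>j\<close> is at most \<open>c\<close> for all unit vectors \<open>v\<close>, with \<open>c\<close> as
close to \<open>1/\<vartheta>\<close> as desired (\<open>rotation_average_close_to_mean\<close>). If the matrices \<open>X\<^sub>j/\<theta>\<close> dilate, then pairing with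
\<open>U\<^sub>j\<^sup>T B U\<^sub>j\<close> gives \<open>d/\<theta> = tr(B sgn B)/\<theta> = \<Sum>m. s\<^sub>j\<^sub>m q\<^sub>a(U\<^sub>j w\<^sub>m)\<close>, and averaging over \<open>j\<close> gives
\<open>d/\<theta> \<le> \<Sum>m. c \<parallel>w\<^sub>m\<parallel>\<^sup>2 = c d\<close>. For \<open>\<theta> < \<vartheta>\<close> there is a \<open>c < 1/\<theta>\<close>, a contradiction.\<close>

section \<open>Symmetric matrices\<close>

text \<open>A maximiser \<open>b\<close> of the Rayleigh quotient on the unit sphere of \<open>S\<close> is an eigenvector: moving from \<open>b\<close> in the
direction of the residual \<open>r = f b - l b\<close> would increase the quotient to first order unless \<open>r = 0\<close>.\<close>

lemma Rayleigh_maximiser_eigenvector: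
  fixes f :: "'a::euclidean_space \<Rightarrow> 'a"
  assumes lin: "linear f" and sa: "\<And>x y. inner (f x) y = inner x (f y)"
    and S: "subspace S" "f ` S \<subseteq> S" "S \<noteq> {0}"
  shows "\<exists>b\<in>S. norm b = 1 \<and> (\<exists>l. f b = l *\<^sub>R b)"
proof -
  let ?K = "S \<inter> sphere 0 1"
  have comp: "compact ?K"
    using S(1) by (intro closed_Int_compact closed_subspace) auto
  obtain z where z: "z \<in> S" "z \<noteq> 0"
    using S subspace_0 by blast
  then have "sgn z \<in> ?K"
    using S(1) by (auto simp: sgn_div_norm subspace_scale)
  then have ne: "?K \<noteq> {}" by blast
  have "continuous_on ?K (\<lambda>x. inner (f x) x)"
    using lin by (intro continuous_intros linear_continuous_on) (simp add: linear_conv_bounded_linear)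
  then obtain b where b: "b \<in> ?K" "\<And>x. x \<in> ?K \<Longrightarrow> inner (f x) x \<le> inner (f b) b"
    using continuous_attains_sup[OF comp ne] by blast
  define l where "l = inner (f b) b"
  have bb: "inner b b = 1" "norm b = 1" "b \<in> S" using b(1) by (auto simp: norm_eq_1)
  have le: "inner (f x) x \<le> l * inner x x" if "x \<in> S" for x
  proof (cases "x = 0")
    case False
    then have "sgn x \<in> ?K" using S(1) that by (auto simp: sgn_div_norm subspace_scale)
    from b(2)[OF this] have "inner (f x) x / (norm x * norm x) \<le> l"
      by (simp add: l_def sgn_div_norm linear_scale[OF lin] divide_simps)
    then show ?thesis
      using False by (simp add: field_simps flip: power2_norm_eq_inner power2_eq_square)
  qed (simp add: linear_0[OF lin])
  define r where "r = f b - l *\<^sub>R b"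
  have rS: "r \<in> S" using S bb unfolding r_def by (intro subspace_diff subspace_scale) auto
  have rb: "inner r b = 0" by (simp add: r_def inner_diff_left l_def bb)
  have frb: "inner (f b) r = inner r r"
    using rb by (simp add: r_def inner_diff_left inner_commute)
  define k where "k = inner (f r) r - l * inner r r"
  have ineq: "2 * t * inner r r + t\<^sup>2 * k \<le> 0" for t
  proof -
    have "inner (f (b + t *\<^sub>R r)) (b + t *\<^sub>R r) \<le> l * inner (b + t *\<^sub>R r) (b + t *\<^sub>R r)"
      using S rS bb by (intro le subspace_add subspace_scale)
    moreover have "inner (f r) b = inner r r" using frb sa[of r b] by (simp add: inner_commute)
    ultimately show ?thesis
      using rb by (simp add: linear_add[OF lin] linear_scale[OF lin] inner_add_left inner_add_right
          frb inner_commute[of b r] bb l_def[symmetric] k_def algebra_simps power2_eq_square)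
  qed
  have "inner r r \<le> 0"
  proof (rule ccontr)
    assume "\<not> inner r r \<le> 0"
    then have pos: "inner r r > 0" by (simp only: not_le)
    \<comment> \<open>small enough that the quadratic term \<open>t\<^sup>2 k\<close> does not outweigh the linear one\<close>
    define t where "t = inner r r / (\<bar>k\<bar> + 1)"
    have t: "t > 0" using pos by (simp add: t_def)
    have "t * \<bar>k\<bar> \<le> inner r r" using pos by (simp add: t_def field_simps)
    moreover have "t * (- k) \<le> t * \<bar>k\<bar>" using t by (intro mult_left_mono) auto
    ultimately have "- (t * k) \<le> inner r r" by simp
    then have "- inner r r - t * k < inner r r" using pos by linarith
    then have "t * inner r r > t * (- inner r r - t * k)" using t by (rule mult_strict_left_mono)
    with ineq[of t] show False by (simp add: algebra_simps power2_eq_square)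
  qed
  then have "r = 0" using inner_ge_zero[of r] by (metis inner_eq_zero_iff order_antisym)
  then show ?thesis using bb by (auto simp: r_def)
qed

text \<open>The orthogonal complement of an eigenvector is again invariant, so eigenvectors can be split off one by one.\<close>

lemma selfadjoint_eigenbasis:
  fixes f :: "'a::euclidean_space \<Rightarrow> 'a"
  assumes lin: "linear f" and sa: "\<And>x y. inner (f x) y = inner x (f y)"
    and "subspace S" "f ` S \<subseteq> S"
  shows "\<exists>B \<subseteq> S. pairwise orthogonal B \<and> (\<forall>b\<in>B. norm b = 1 \<and> (\<exists>l. f b = l *\<^sub>R b)) \<and> span B = S"
  using assms(3,4)
proof (induction "dim S" arbitrary: S rule: less_induct)
  case less
  show ?case
  proof (cases "S = {0}")
    case True
    then show ?thesis by (intro exI[of _ "{}"]) auto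
  next
    case False
    then obtain b l where b: "b \<in> S" "norm b = 1" "f b = l *\<^sub>R b"
      using Rayleigh_maximiser_eigenvector[OF lin sa less.prems] by blast
    define S' where "S' = {x \<in> S. inner b x = 0}"
    have sub: "subspace S'"
      using less.prems(1) unfolding S'_def subspace_def by (auto simp: inner_add_right)
    have inv: "f ` S' \<subseteq> S'"
    proof
      fix y assume "y \<in> f ` S'"
      then obtain x where x: "y = f x" "x \<in> S" "inner b x = 0" by (auto simp: S'_def)
      have "inner b (f x) = l * inner b x" using sa[of b x] b(3) by simp
      then show "y \<in> S'" using x less.prems(2) by (auto simp: S'_def)
    qed
    have "b \<notin> S'" using b by (auto simp: S'_def norm_eq_1)
    then have "S' \<subset> S" using b(1) unfolding S'_def by blast
    then have "dim S' < dim S"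
      using sub less.prems(1) by (metis dim_psubset span_eq_iff)
    from less.hyps[OF this sub inv] obtain B where
      B: "B \<subseteq> S'" "pairwise orthogonal B" "\<forall>b\<in>B. norm b = 1 \<and> (\<exists>l. f b = l *\<^sub>R b)" "span B = S'"
      by blast
    have "span (insert b B) = S"
    proof
      show "span (insert b B) \<subseteq> S"
        using b(1) B(1) \<open>S' \<subset> S\<close> less.prems(1) by (intro span_minimal) auto
      show "S \<subseteq> span (insert b B)"
      proof
        fix x assume x: "x \<in> S"
        have "x - inner b x *\<^sub>R b \<in> S'"
          using x b less.prems(1) unfolding S'_def
          by (auto simp: inner_diff_right norm_eq_1 intro: subspace_diff subspace_scale)
        then show "x \<in> span (insert b B)" using B(4) span_breakdown_eq by blast
      qed
    qed
    moreover have "pairwise orthogonal (insert b B)"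
      using B(1,2) by (auto simp: pairwise_insert S'_def orthogonal_def inner_commute)
    ultimately show ?thesis
      using b B \<open>S' \<subset> S\<close> by (intro exI[of _ "insert b B"]) auto
  qed
qed

text \<open>The eigenbasis is indexed by the coordinates, so that \<open>x \<mapsto> (\<chi> i. u i \<bullet> x)\<close> is an orthogonal
transformation of the same space; the third statement is Parseval's identity for it.\<close>

lemma symmetric_matrix_eigenbasis:
  fixes X :: "real^'n^'n"
  assumes "transpose X = X"
  obtains u :: "'n \<Rightarrow> real^'n" and l :: "'n \<Rightarrow> real"
  where "\<And>i. norm (u i) = 1" "\<And>i. X *v u i = l i *\<^sub>R u i"
    and "\<And>x y. inner x y = (\<Sum>i\<in>UNIV. inner (u i) x * inner (u i) y)"
    and "\<And>x y. inner x (X *v y) = (\<Sum>i\<in>UNIV. l i * (inner (u i) x * inner (u i) y))"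
proof -
  have sa: "inner (X *v x) y = inner x (X *v y)" for x y
    using dot_lmul_matrix[of x X y] assms vector_transpose_matrix[of x X] by simp
  obtain B where B: "pairwise orthogonal B" "\<And>b. b \<in> B \<Longrightarrow> norm b = 1"
     "\<And>b. b \<in> B \<Longrightarrow> \<exists>l. X *v b = l *\<^sub>R b" "span B = UNIV"
    using selfadjoint_eigenbasis[of "(*v) X" UNIV, OF matrix_vector_mul_linear sa] by auto
  have ind: "independent B"
    using B(2) by (intro pairwise_orthogonal_independent[OF B(1)]) force
  have fin: "finite B" using ind by (rule independent_imp_finite)
  have "card B = CARD('n)"
    using dim_eq_card[OF _ ind, of UNIV] B(4) by (simp add: dim_UNIV)
  then obtain u where u: "bij_betw u (UNIV::'n set) B"
    using finite_same_card_bij[of "UNIV :: 'n set" B] fin by auto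
  then have uB: "u i \<in> B" for i by (auto simp: bij_betw_def)
  have "\<exists>l. \<forall>i. X *v u i = l i *\<^sub>R u i" using B(3)[OF uB] by (intro choice) blast
  then obtain l where l: "\<And>i. X *v u i = l i *\<^sub>R u i" by blast
  have parseval: "inner x y = (\<Sum>i\<in>UNIV. inner (u i) x * inner (u i) y)" for x y
  proof -
    have "y = (\<Sum>b\<in>B. inner b y *\<^sub>R b)"
      using orthonormal_basis_expand[OF B(1) B(2) _ fin, of y] B(4) by (simp add: inner_commute)
    also have "\<dots> = (\<Sum>i\<in>UNIV. inner (u i) y *\<^sub>R u i)"
      by (rule sum.reindex_bij_betw[OF u, symmetric])
    finally have "inner x y = inner x (\<Sum>i\<in>UNIV. inner (u i) y *\<^sub>R u i)" by (rule arg_cong)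
    then show ?thesis by (simp add: inner_sum_right inner_commute mult.commute)
  qed
  show thesis
  proof (rule that)
    show "norm (u i) = 1" for i using B(2) uB by blast
    show "inner x (X *v y) = (\<Sum>i\<in>UNIV. l i * (inner (u i) x * inner (u i) y))" for x y
      by (subst parseval) (simp add: sa[symmetric] l mult_ac)
  qed (fact l parseval)+
qed

lemma inner_matrix_axis: "axis i 1 \<bullet> (X *v axis j 1) = (X :: real^'n^'n) $ i $ j"
  by (simp add: matrix_vector_mult_basis column_def inner_axis')

section \<open>Commuting contractions and finitely many rank-one matrices\<close>

definition positive_operator :: "('h::real_inner \<Rightarrow>\<^sub>L 'h) \<Rightarrow> bool" where
  "positive_operator A \<longleftrightarrow> (\<forall>x y. inner (A x) y = inner x (A y)) \<and> (\<forall>x. 0 \<le> inner (A x) x)"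

text \<open>If \<open>0 \<le> A \<le> 1\<close>, then also \<open>0 \<le> A - A\<^sup>2 \<le> 1\<close>, since
\<open>A - A\<^sup>2 = A (1 - A) A + (1 - A) A (1 - A)\<close>.\<close>

lemma positive_operator_square_deficit:
  fixes A :: "'h::real_inner \<Rightarrow>\<^sub>L 'h"
  assumes A: "positive_operator A" and A1: "positive_operator (id_blinfun - A)"
  shows "positive_operator (A - (A o\<^sub>L A))" "positive_operator (id_blinfun - (A - (A o\<^sub>L A)))"
proof -
  have sa: "inner (A x) y = inner x (A y)" for x y
    using A by (simp add: positive_operator_def)
  have pos: "0 \<le> inner (A x) x" "0 \<le> inner (x - A x) x" for x
    using A A1 unfolding positive_operator_def
    by (blast, metis blinfun.diff_left id_blinfun.rep_eq)
  have "0 \<le> inner (A x - A (A x)) x" for x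
  proof -
    have "inner (A x - A (A x)) x
        = inner (A x - A (A x)) (A x) + inner (A (x - A x)) (x - A x)"
      by (simp add: inner_diff_left inner_diff_right blinfun.diff_right sa)
    then show ?thesis using pos(2)[of "A x"] pos(1)[of "x - A x"] by simp
  qed
  then show "positive_operator (A - (A o\<^sub>L A))"
    by (simp add: positive_operator_def blinfun.diff_left inner_diff_left inner_diff_right sa)
  have "0 \<le> inner (x - (A x - A (A x))) x" for x
  proof -
    have "inner (x - (A x - A (A x))) x = inner (x - A x) x + inner (A x) (A x)"
      by (simp add: inner_diff_left sa)
    then show ?thesis using pos(2)[of x] by simp
  qed
  then show "positive_operator (id_blinfun - (A - (A o\<^sub>L A)))"
    by (simp add: positive_operator_def blinfun.diff_left inner_diff_left inner_diff_right sa)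
qed

text \<open>The argument of F. Riesz. With \<open>a\<^sub>0 = A\<close> and \<open>a\<^sub>n\<^sub>+\<^sub>1 = a\<^sub>n - a\<^sub>n\<^sup>2\<close> the sum
of the \<open>\<parallel>a\<^sub>n x\<parallel>\<^sup>2\<close> telescopes to at most \<open>\<langle>A x, x\<rangle>\<close>, so \<open>a\<^sub>n x\<close> tends to \<open>0\<close>. As \<open>B\<close> commutes with all \<open>a\<^sub>n\<close>, the
numbers \<open>\<langle>a\<^sub>n x, B x\<rangle>\<close> decrease by \<open>\<langle>B a\<^sub>n x, a\<^sub>n x\<rangle> \<ge> 0\<close> in each step, and their limit is \<open>0\<close>; hence the initial one is
nonnegative.\<close>

lemma positive_operator_compose:
  fixes A B :: "'h::real_inner \<Rightarrow>\<^sub>L 'h"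
  assumes A: "positive_operator A" "positive_operator (id_blinfun - A)"
    and B: "positive_operator B" and comm: "A o\<^sub>L B = B o\<^sub>L A"
  shows "positive_operator (A o\<^sub>L B)"
proof -
  define a where "a = rec_nat A (\<lambda>_ c. c - (c o\<^sub>L c))"
  have a0: "a 0 = A" and aS: "a (Suc n) = a n - (a n o\<^sub>L a n)" for n
    by (simp_all add: a_def)
  have pos: "positive_operator (a n) \<and> positive_operator (id_blinfun - a n)" for n
    by (induction n) (use A positive_operator_square_deficit in \<open>auto simp: a0 aS\<close>)
  have saA: "inner (a n x) y = inner x (a n y)" for n x y
    using pos[of n] by (simp add: positive_operator_def)
  have saB: "inner (B x) y = inner x (B y)" for x y
    using B by (simp add: positive_operator_def)
  have comm_a: "a n (B x) = B (a n x)" for n x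
  proof (induction n arbitrary: x)
    case 0
    show ?case using arg_cong[OF comm, of "\<lambda>C. blinfun_apply C x"] by (simp add: a0)
  qed (simp add: aS blinfun.diff_left blinfun.diff_right)
  have "0 \<le> inner (A (B x)) x" for x
  proof -
    define p where "p n = inner (a n x) x" for n
    have p_step: "(norm (a n x))\<^sup>2 = p n - p (Suc n)" for n
    proof -
      have "p n - p (Suc n) = inner (a n (a n x)) x"
        by (simp add: p_def aS blinfun.diff_left inner_diff_left)
      also have "\<dots> = (norm (a n x))\<^sup>2"
        by (simp only: saA power2_norm_eq_inner)
      finally show ?thesis by simp
    qed
    have "(\<Sum>k<n. (norm (a k x))\<^sup>2) \<le> p 0" for n
    proof -
      have "(\<Sum>k<n. (norm (a k x))\<^sup>2) = p 0 - p n"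
        by (simp add: p_step sum_lessThan_telescope')
      moreover have "0 \<le> p n" using pos[of n] unfolding p_def positive_operator_def by blast
      ultimately show ?thesis by simp
    qed
    then have "summable (\<lambda>k. (norm (a k x))\<^sup>2)"
      by (intro summableI_nonneg_bounded) auto
    then have "(\<lambda>k. (norm (a k x))\<^sup>2) \<longlonglongrightarrow> 0" by (rule summable_LIMSEQ_zero)
    then have "(\<lambda>k. norm (a k x)) \<longlonglongrightarrow> 0"
      using tendsto_real_sqrt[of _ 0] by fastforce
    then have "(\<lambda>k. a k x) \<longlonglongrightarrow> 0" by (rule tendsto_norm_zero_cancel)
    then have lim: "(\<lambda>k. inner (a k x) (B x)) \<longlonglongrightarrow> inner 0 (B x)"
      by (intro tendsto_intros)
    have "inner (a (Suc k) x) (B x) \<le> inner (a k x) (B x)" for k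
    proof -
      have "inner (a k x) (B x) - inner (a (Suc k) x) (B x) = inner (B (a k x)) (a k x)"
        by (simp add: aS blinfun.diff_left inner_diff_left saA saB comm_a)
      moreover have "0 \<le> inner (B (a k x)) (a k x)"
        using B unfolding positive_operator_def by blast
      ultimately show ?thesis by simp
    qed
    then have "inner 0 (B x) \<le> inner (a 0 x) (B x)"
      by (intro decseq_ge[OF _ lim] decseq_SucI)
    then show ?thesis by (simp add: a0[symmetric] saA inner_commute comm_a saB)
  qed
  moreover have "inner (A (B x)) y = inner x (A (B y))" for x y
    using saA[of 0] comm_a[of 0] by (simp add: a0 saB)
  ultimately show ?thesis by (simp add: positive_operator_def)
qed

lemma inner_compression:
  fixes V :: "(real^'n) \<Rightarrow>\<^sub>L 'h::real_inner"
  shows "inner x (compression V T *v y) = inner (V x) (T (V y))"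
proof -
  have "linear (adjoint (blinfun_apply V) \<circ> blinfun_apply T \<circ> blinfun_apply V)"
    by (intro linearI; rule vector_eq_ldot[THEN iffD1])
      (simp_all add: inner_add_right blinfun.bilinear_simps flip: inner_adjoint_cart)
  then show ?thesis
    by (simp add: compression_def matrix_works inner_adjoint_cart)
qed

lemma isometry_inner:
  fixes V :: "'a::real_inner \<Rightarrow>\<^sub>L 'b::real_inner"
  assumes "isometry V"
  shows "inner (V x) (V y) = inner x y"
proof -
  have n: "norm (V z) = norm z" for z using assms by (simp add: isometry_def)
  show ?thesis
    using n[of "x + y"] by (simp add: dot_norm n blinfun.add_right[symmetric])
qed

definition sign_weight :: "nat set \<Rightarrow> nat \<Rightarrow> real" where
  "sign_weight A j = (if j \<in> A then 1 else -1)"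

text \<open>The product of the commuting operators \<open>(1 \<plusminus> T\<^sub>j)/2\<close>, \<open>j < g\<close>, with signs given by \<open>A\<close>. If the \<open>T\<^sub>j\<close> are
symmetries, it is the projection onto their joint eigenspace with this sign pattern; for contractions it is
the compression of such a projection for suitable commuting symmetries that dilate the \<open>T\<^sub>j\<close>.\<close>

primrec sign_operator ::
  "(nat \<Rightarrow> 'h::real_normed_vector \<Rightarrow>\<^sub>L 'h) \<Rightarrow> nat set \<Rightarrow> nat \<Rightarrow> ('h \<Rightarrow>\<^sub>L 'h)" where
  "sign_operator T A 0 = id_blinfun"
| "sign_operator T A (Suc g) =
     ((1/2) *\<^sub>R (id_blinfun + sign_weight A g *\<^sub>R T g)) o\<^sub>L sign_operator T A g"

lemma sign_operator_insert: "g \<le> n \<Longrightarrow> sign_operator T (insert n A) g = sign_operator T A g"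
  by (induction g) (auto simp: sign_weight_def)

lemma sum_Pow_lessThan_Suc:
  "(\<Sum>A\<in>Pow {..<Suc g}. F A) = (\<Sum>A\<in>Pow {..<g}. F A) + (\<Sum>A\<in>Pow {..<g}. F (insert g A) :: 'a::comm_monoid_add)"
proof -
  have "inj_on (insert g) (Pow {..<g})"
    by (rule inj_onI) (metis Pow_iff insert_ident lessThan_iff less_irrefl subsetD)
  moreover have "Pow {..<g} \<inter> insert g ` Pow {..<g} = {}" by auto
  ultimately show ?thesis
    by (simp add: lessThan_Suc Pow_insert sum.union_disjoint sum.reindex)
qed

lemma half_scaleR_sum_diff:
  fixes u v :: "'a::real_vector"
  shows "(1/2) *\<^sub>R (u - v) + (1/2) *\<^sub>R (u + v) = u" "(1/2) *\<^sub>R (u + v) - (1/2) *\<^sub>R (u - v) = v"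
  by (simp_all flip: scaleR_add_right scaleR_diff_right add: scaleR_half_double)

lemma sign_operator_Suc_sum:
  assumes "A \<subseteq> {..<g}"
  shows "sign_operator T A (Suc g) + sign_operator T (insert g A) (Suc g) = sign_operator T A g"
    and "sign_operator T (insert g A) (Suc g) - sign_operator T A (Suc g) = T g o\<^sub>L sign_operator T A g"
  using assms
  by (auto intro!: blinfun_eqI simp: sign_operator_insert sign_weight_def blinfun.bilinear_simps half_scaleR_sum_diff)

lemma sum_sign_operator: "(\<Sum>A\<in>Pow {..<g}. sign_operator T A g) = id_blinfun"
proof (induction g)
  case (Suc g)
  have "(\<Sum>A\<in>Pow {..<Suc g}. sign_operator T A (Suc g))
      = (\<Sum>A\<in>Pow {..<g}. sign_operator T A (Suc g) + sign_operator T (insert g A) (Suc g))"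
    by (simp only: sum_Pow_lessThan_Suc sum.distrib)
  also have "\<dots> = (\<Sum>A\<in>Pow {..<g}. sign_operator T A g)"
    by (intro sum.cong refl sign_operator_Suc_sum) auto
  finally show ?case using Suc by simp
qed simp

lemma sum_sign_weight_operator:
  "j < g \<Longrightarrow> (\<Sum>A\<in>Pow {..<g}. sign_weight A j *\<^sub>R sign_operator T A g) = T j"
proof (induction g)
  case (Suc g)
  have eq: "(\<Sum>A\<in>Pow {..<Suc g}. sign_weight A j *\<^sub>R sign_operator T A (Suc g))
      = (\<Sum>A\<in>Pow {..<g}. sign_weight A j *\<^sub>R sign_operator T A (Suc g)
          + sign_weight (insert g A) j *\<^sub>R sign_operator T (insert g A) (Suc g))"
    by (simp only: sum_Pow_lessThan_Suc sum.distrib)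
  show ?case
  proof (cases "j = g")
    case True
    have "(\<Sum>A\<in>Pow {..<Suc g}. sign_weight A j *\<^sub>R sign_operator T A (Suc g))
        = (\<Sum>A\<in>Pow {..<g}. T g o\<^sub>L sign_operator T A g)"
      unfolding eq
    proof (intro sum.cong refl)
      fix A assume "A \<in> Pow {..<g}"
      then have "sign_weight A j = -1" "sign_weight (insert g A) j = 1" and A: "A \<subseteq> {..<g}"
        using True by (auto simp: sign_weight_def)
      then show "sign_weight A j *\<^sub>R sign_operator T A (Suc g)
          + sign_weight (insert g A) j *\<^sub>R sign_operator T (insert g A) (Suc g)
          = T g o\<^sub>L sign_operator T A g"
        by (simp only: sign_operator_Suc_sum(2)[OF A, symmetric]) simp
    qed
    also have "\<dots> = T g o\<^sub>L (\<Sum>A\<in>Pow {..<g}. sign_operator T A g)"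
      by (rule blinfun_eqI) (simp add: blinfun.sum_left blinfun.sum_right)
    also have "\<dots> = T g" by (rule blinfun_eqI) (simp add: sum_sign_operator)
    finally show ?thesis using True by simp
  next
    case False
    have "(\<Sum>A\<in>Pow {..<Suc g}. sign_weight A j *\<^sub>R sign_operator T A (Suc g))
        = (\<Sum>A\<in>Pow {..<g}. sign_weight A j *\<^sub>R sign_operator T A g)"
      unfolding eq
    proof (intro sum.cong refl)
      fix A assume "A \<in> Pow {..<g}"
      then have A: "A \<subseteq> {..<g}" by simp
      have "sign_weight (insert g A) j = sign_weight A j"
        using False by (simp add: sign_weight_def)
      then show "sign_weight A j *\<^sub>R sign_operator T A (Suc g)
          + sign_weight (insert g A) j *\<^sub>R sign_operator T (insert g A) (Suc g)
          = sign_weight A j *\<^sub>R sign_operator T A g"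
        by (simp only: sign_operator_Suc_sum(1)[OF A, symmetric] scaleR_add_right)
    qed
    then show ?thesis using Suc False by simp
  qed
qed simp

lemma sign_operator_commute:
  assumes "\<And>j. j < g \<Longrightarrow> S o\<^sub>L T j = T j o\<^sub>L S"
  shows "S o\<^sub>L sign_operator T A g = sign_operator T A g o\<^sub>L S"
  using assms
proof (induction g)
  case (Suc g)
  have IH: "S (sign_operator T A g x) = sign_operator T A g (S x)" for x
    using Suc by (metis blinfun_apply_blinfun_compose less_SucI)
  have "S (T g x) = T g (S x)" for x
    using Suc.prems[of g] by (metis blinfun_apply_blinfun_compose lessI)
  then show ?case
    by (intro blinfun_eqI) (simp add: IH blinfun.bilinear_simps)
qed (auto intro: blinfun_eqI)

lemma half_sum_positive:
  fixes T :: "'h::real_inner \<Rightarrow>\<^sub>L 'h"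
  assumes "selfadjoint_contraction T" "\<bar>c\<bar> = 1"
  shows "positive_operator ((1/2) *\<^sub>R (id_blinfun + c *\<^sub>R T))"
proof -
  have "\<bar>c * inner (T x) x\<bar> \<le> inner x x" for x
  proof -
    have "\<bar>inner (T x) x\<bar> \<le> norm (T x) * norm x" by (rule Cauchy_Schwarz_ineq2)
    also have "norm (T x) \<le> 1 * norm x"
      using norm_blinfun[of T x] assms(1) mult_right_mono[of "norm T" 1 "norm x"]
      by (simp add: selfadjoint_contraction_def)
    then have "norm (T x) * norm x \<le> inner x x"
      using mult_right_mono[of "norm (T x)" "norm x" "norm x"]
      by (simp add: power2_norm_eq_inner flip: power2_eq_square)
    finally show ?thesis using assms(2) by (simp add: abs_mult)
  qed
  then have "- inner x x \<le> c * inner (T x) x" for x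
    by (metis abs_le_iff minus_le_iff)
  then show ?thesis
    using assms(1) unfolding positive_operator_def selfadjoint_contraction_def
    by (auto simp: blinfun.bilinear_simps inner_add_left inner_add_right add_increasing2)
     (metis add.commute diff_ge_0_iff_ge diff_minus_eq_add)
qed

lemma sign_operator_positive:
  fixes T :: "nat \<Rightarrow> 'h::real_inner \<Rightarrow>\<^sub>L 'h"
  assumes "\<And>j. j < g \<Longrightarrow> selfadjoint_contraction (T j)"
    and "\<And>i j. i < g \<Longrightarrow> j < g \<Longrightarrow> T i o\<^sub>L T j = T j o\<^sub>L T i"
  shows "positive_operator (sign_operator T A g)"
  using assms
proof (induction g)
  case (Suc g)
  let ?c = "sign_weight A g"
  let ?F = "\<lambda>c. (1/2) *\<^sub>R (id_blinfun + c *\<^sub>R T g)"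
  have pos: "positive_operator (?F c)" if "\<bar>c\<bar> = 1" for c
    using Suc.prems(1) that by (intro half_sum_positive) auto
  have "id_blinfun - ?F c = ?F (- c)" for c
    by (rule blinfun_eqI) (simp add: blinfun.bilinear_simps algebra_simps flip: scaleR_add_left)
  then have pos': "positive_operator (id_blinfun - ?F ?c)"
    using pos[of "- ?c"] by (simp add: sign_weight_def)
  have c: "T g o\<^sub>L sign_operator T A g = sign_operator T A g o\<^sub>L T g"
    using Suc.prems(2) by (intro sign_operator_commute) auto
  have "T g (sign_operator T A g x) = sign_operator T A g (T g x)" for x
    using c by (metis blinfun_apply_blinfun_compose)
  then have "?F ?c o\<^sub>L sign_operator T A g = sign_operator T A g o\<^sub>L ?F ?c"
    by (intro blinfun_eqI) (simp add: blinfun.bilinear_simps)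
  then show ?case
    using Suc unfolding sign_operator.simps
    by (intro positive_operator_compose pos pos') (auto simp: sign_weight_def)
qed (simp add: positive_operator_def)


text \<open>The compressions of the positive operators \<open>sign_operator T A g\<close> are positive matrices; each is the sum over \<open>i\<close> of
the rank-one matrices of the vectors \<open>v A i\<close>, an eigenbasis scaled by the square roots of the eigenvalues. Hence
the atoms are indexed by pairs \<open>(A, i)\<close>.\<close>

lemma dilation_atoms:
  fixes Y :: "nat \<Rightarrow> real^'n^'n"
  assumes "dilates_to_commuting_contractions TYPE('h::{real_inner, complete_space}) g Y"
  obtains I :: "(nat set \<times> 'n) set" and w :: "nat set \<times> 'n \<Rightarrow> real^'n"
    and s :: "nat \<Rightarrow> nat set \<times> 'n \<Rightarrow> real"
  where "finite I" "\<And>j m. \<bar>s j m\<bar> \<le> 1"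
    "\<And>x y. (\<Sum>m\<in>I. inner (w m) x * inner (w m) y) = inner x y"
    "\<And>j x y. j < g \<Longrightarrow> (\<Sum>m\<in>I. s j m * (inner (w m) x * inner (w m) y)) = inner x (Y j *v y)"
proof -
  obtain T :: "nat \<Rightarrow> 'h \<Rightarrow>\<^sub>L 'h" and V :: "(real^'n) \<Rightarrow>\<^sub>L 'h"
    where T: "\<And>j. j < g \<Longrightarrow> selfadjoint_contraction (T j)"
      "\<And>i j. i < g \<Longrightarrow> j < g \<Longrightarrow> T i o\<^sub>L T j = T j o\<^sub>L T i"
      and V: "isometry V" and Y: "\<And>j. j < g \<Longrightarrow> Y j = compression V (T j)"
    using assms unfolding dilates_to_commuting_contractions_def dilates_to_def by blast
  define P where "P A = sign_operator T A g" for A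
  have P: "positive_operator (P A)" for A
    unfolding P_def by (rule sign_operator_positive[OF T])
  have ex: "\<exists>v :: 'n \<Rightarrow> real^'n. \<forall>x y. inner (V x) (P A (V y)) = (\<Sum>i\<in>UNIV. inner (v i) x * inner (v i) y)" for A
  proof -
    have sa: "inner (P A x) y = inner x (P A y)" and pos: "0 \<le> inner (P A x) x" for x y
      using P[of A] unfolding positive_operator_def by blast+
    define M where "M = compression V (P A)"
    have M: "inner x (M *v y) = inner (V x) (P A (V y))" for x y
      unfolding M_def by (rule inner_compression)
    have "transpose M = M"
      by (simp add: vec_eq_iff transpose_def M_def compression_nth) (metis sa inner_commute)
    then obtain u :: "'n \<Rightarrow> real^'n" and l where u: "\<And>i. norm (u i) = 1" "\<And>i. M *v u i = l i *\<^sub>R u i"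
      "\<And>x y. inner x (M *v y) = (\<Sum>i\<in>UNIV. l i * (inner (u i) x * inner (u i) y))"
      by (rule symmetric_matrix_eigenbasis) blast
    have l: "0 \<le> l i" for i
      using M[of "u i" "u i"] pos[of "V (u i)"] u(1)[of i] by (simp add: u(2) sa norm_eq_1)
    have "l i * (inner (u i) x * inner (u i) y)
        = inner (sqrt (l i) *\<^sub>R u i) x * inner (sqrt (l i) *\<^sub>R u i) y" for i x y
      using real_sqrt_mult_self[of "l i"] l[of i] by simp
    then show ?thesis
      by (intro exI[of _ "\<lambda>i. sqrt (l i) *\<^sub>R u i"]) (simp only: M[symmetric] u(3) simp_thms)
  qed
  have "\<exists>v :: nat set \<Rightarrow> 'n \<Rightarrow> real^'n. \<forall>A x y.
      inner (V x) (P A (V y)) = (\<Sum>i\<in>UNIV. inner (v A i) x * inner (v A i) y)"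
    using ex by (rule choice[OF allI])
  then obtain v :: "nat set \<Rightarrow> 'n \<Rightarrow> real^'n" where v: "\<And>A x y.
      inner (V x) (P A (V y)) = (\<Sum>i\<in>UNIV. inner (v A i) x * inner (v A i) y)"
    by blast
  have sum_eq: "(\<Sum>(A, i)\<in>Pow {..<g} \<times> UNIV. c A * (inner (v A i) x * inner (v A i) y))
      = inner (V x) ((\<Sum>A\<in>Pow {..<g}. c A *\<^sub>R P A) (V y))" for c x y
  proof -
    have "(\<Sum>(A, i)\<in>Pow {..<g} \<times> UNIV. c A * (inner (v A i) x * inner (v A i) y))
        = (\<Sum>A\<in>Pow {..<g}. c A * inner (V x) (P A (V y)))"
      by (simp add: v sum_distrib_left flip: sum.cartesian_product)
    then show ?thesis
      by (simp add: blinfun.sum_left blinfun.scaleR_left inner_sum_right)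
  qed
  show thesis
  proof (rule that)
    show "finite (Pow {..<g} \<times> (UNIV :: 'n set))" by simp
    show "\<bar>(\<lambda>(A, i). sign_weight A j) m\<bar> \<le> 1" for j and m :: "nat set \<times> 'n"
      by (cases m) (simp add: sign_weight_def)
    show "(\<Sum>m\<in>Pow {..<g} \<times> UNIV. inner ((\<lambda>(A, i). v A i) m) x * inner ((\<lambda>(A, i). v A i) m) y) = inner x y" for x y
      using sum_eq[of "\<lambda>_. 1" x y] sum_sign_operator[of T g] V
      by (simp add: P_def case_prod_beta isometry_inner)
    show "(\<Sum>m\<in>Pow {..<g} \<times> UNIV. (\<lambda>(A, i). sign_weight A j) m *
        (inner ((\<lambda>(A, i). v A i) m) x * inner ((\<lambda>(A, i). v A i) m) y)) = inner x (Y j *v y)"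
      if "j < g" for j x y
      using sum_eq[of "\<lambda>A. sign_weight A j" x y] sum_sign_weight_operator[OF that, of T] Y[OF that]
      by (simp add: P_def case_prod_beta inner_compression)
  qed
qed

section \<open>Bounded operators on the space of square-summable sequences\<close>

lemma ell2_nth_add: "ell2_nth (x + y) i = ell2_nth x i + ell2_nth y i"
  by transfer simp

lemma ell2_nth_scaleR: "ell2_nth (c *\<^sub>R x) i = c * ell2_nth x i"
  by transfer simp

lemma ell2_eqI: "(\<And>i. ell2_nth x i = ell2_nth y i) \<Longrightarrow> x = y"
  by (metis ell2_nth_inject ext)

lift_definition ell2_unit :: "nat \<Rightarrow> ell2" is "\<lambda>j i. if i = j then 1 else 0"
  unfolding sq_summable_def by (rule summable_finite[of "{j}" for j]) auto

lemma inner_ell2_unit: "inner x (ell2_unit j) = ell2_nth x j"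
proof transfer
  fix f :: "nat \<Rightarrow> real" and j
  show "(\<Sum>i. f i * (if i = j then 1 else 0)) = f j"
    using suminf_finite[of "{j}" "\<lambda>i. f i * (if i = j then 1 else 0)"] by simp
qed

lemma ell2_nth_unit: "ell2_nth (ell2_unit j) i = (if i = j then 1 else 0)"
  by transfer simp

lemma inner_ell2_unit_unit: "inner (ell2_unit i) (ell2_unit j) = (if i = j then 1 else 0)"
  by (simp add: inner_ell2_unit ell2_nth_unit)

lemma ell2_expansion: "(\<lambda>j. ell2_nth x j *\<^sub>R ell2_unit j) sums x"
proof -
  let ?S = "\<lambda>n. \<Sum>j<n. ell2_nth x j *\<^sub>R ell2_unit j"
  have "(norm (?S n - x))\<^sup>2 = (norm x)\<^sup>2 - (\<Sum>j<n. (ell2_nth x j)\<^sup>2)" for n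
  proof -
    have 1: "inner x (?S n) = (\<Sum>j<n. (ell2_nth x j)\<^sup>2)"
      by (simp add: inner_sum_right inner_ell2_unit power2_eq_square)
    have 2: "inner (?S n) (?S n) = (\<Sum>j<n. (ell2_nth x j)\<^sup>2)"
      by (simp add: inner_sum_right inner_sum_left inner_ell2_unit_unit power2_eq_square
          if_distrib sum.delta cong: if_cong)
    show ?thesis
      using 1 2 by (simp add: power2_norm_eq_inner inner_diff_left inner_diff_right inner_commute)
  qed
  moreover have "(\<lambda>n. (norm x)\<^sup>2 - (\<Sum>j<n. (ell2_nth x j)\<^sup>2)) \<longlonglongrightarrow> (norm x)\<^sup>2 - (norm x)\<^sup>2"
    using ell2_norm_power2_sums[of x] unfolding sums_def by (intro tendsto_intros)
  ultimately have "(\<lambda>n. (norm (?S n - x))\<^sup>2) \<longlonglongrightarrow> 0" by simp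
  then have "(\<lambda>n. norm (?S n - x)) \<longlonglongrightarrow> 0"
    using tendsto_real_sqrt[of _ 0] by fastforce
  then show ?thesis
    unfolding sums_def by (rule LIM_zero_cancel[OF tendsto_norm_zero_cancel])
qed

text \<open>Both sides are continuous and linear in \<open>y\<close>, and the unit vectors have dense span.\<close>

lemma blinfun_ell2_symmetricI:
  fixes T :: "ell2 \<Rightarrow>\<^sub>L ell2"
  assumes "\<And>x j. inner (T x) (ell2_unit j) = inner x (T (ell2_unit j))"
  shows "inner (T x) y = inner x (T y)"
proof -
  have "(\<lambda>j. inner (T x) (ell2_nth y j *\<^sub>R ell2_unit j)) sums inner (T x) y"
    by (rule bounded_linear.sums[OF bounded_linear_inner_right ell2_expansion])
  moreover have "(\<lambda>j. inner x (T (ell2_nth y j *\<^sub>R ell2_unit j))) sums inner x (T y)"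
    by (intro bounded_linear.sums[OF bounded_linear_inner_right]
        bounded_linear.sums[OF blinfun.bounded_linear_right] ell2_expansion)
  ultimately show ?thesis
    by (simp add: assms blinfun.scaleR_right sums_unique2)
qed

text \<open>The infinite matrix with rows \<open>a k\<close> is a contraction if its transpose contracts finitely supported vectors;
this is proved by testing the transpose on the finite truncations of \<open>T x\<close>.\<close>

lemma ell2_row_operator:
  fixes a :: "nat \<Rightarrow> ell2"
  assumes a: "\<And>n y. (norm (\<Sum>k<n. y k *\<^sub>R a k))\<^sup>2 \<le> (\<Sum>k<n. (y k)\<^sup>2)"
  shows "\<exists>T :: ell2 \<Rightarrow>\<^sub>L ell2. norm T \<le> 1 \<and> (\<forall>x k. ell2_nth (blinfun_apply T x) k = inner x (a k))"
proof -
  have bound: "(\<Sum>k<n. (inner x (a k))\<^sup>2) \<le> (norm x)\<^sup>2" for x n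
  proof -
    let ?s = "\<Sum>k<n. (inner x (a k))\<^sup>2" and ?v = "\<Sum>k<n. inner x (a k) *\<^sub>R a k"
    \<comment> \<open>\<open>?s\<close> is the squared norm of the truncation of \<open>T x\<close>, and \<open>?v\<close> is its image under the transpose\<close>
    have "?s\<^sup>2 = (inner x ?v)\<^sup>2"
      by (simp add: inner_sum_right power2_eq_square)
    also have "\<dots> \<le> (norm x)\<^sup>2 * (norm ?v)\<^sup>2"
      using Cauchy_Schwarz_ineq[of x ?v] by (simp add: power2_norm_eq_inner)
    also have "\<dots> \<le> (norm x)\<^sup>2 * ?s"
      by (intro mult_left_mono a) simp
    finally have *: "?s * ?s \<le> (norm x)\<^sup>2 * ?s" by (simp add: power2_eq_square)
    show ?thesis
    proof (cases "?s = 0")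
      case False
      moreover have "0 \<le> ?s" by (intro sum_nonneg) simp
      ultimately show ?thesis using * by (metis mult_le_cancel_right not_less order_antisym)
    qed simp
  qed
  have sq: "sq_summable (\<lambda>k. inner x (a k))" for x
    unfolding sq_summable_def
    by (rule summableI_nonneg_bounded[of _ "(norm x)\<^sup>2"]) (auto simp: bound)
  define F where "F x = Abs_ell2 (\<lambda>k. inner x (a k))" for x
  have F: "ell2_nth (F x) k = inner x (a k)" for x k
    using sq[of x] by (simp add: F_def Abs_ell2_inverse)
  have norm_F: "norm (F x) \<le> norm x * 1" for x
  proof -
    have "(norm (F x))\<^sup>2 \<le> (norm x)\<^sup>2"
      using ell2_norm_power2_sums[of "F x"] bound[of x] unfolding sums_def F
      by (intro LIMSEQ_le_const2) auto
    then show ?thesis by (simp add: power2_le_iff_abs_le)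
  qed
  have "bounded_linear F"
    by (rule bounded_linear_intro[of _ 1])
      (auto intro!: ell2_eqI simp: F ell2_nth_add ell2_nth_scaleR inner_add_left norm_F[simplified])
  then obtain T :: "ell2 \<Rightarrow>\<^sub>L ell2" where T: "blinfun_apply T = F"
    by (metis bounded_linear_Blinfun_apply)
  have "norm T \<le> 1"
    by (rule norm_blinfun_bound) (use norm_F in \<open>auto simp: T mult.commute\<close>)
  then show ?thesis using T F by auto
qed

lemma ell2_nth_sum: "ell2_nth (\<Sum>i\<in>I. x i) k = (\<Sum>i\<in>I. ell2_nth (x i) k)"
  by (simp add: inner_sum_left flip: inner_ell2_unit)

section \<open>Complete orthonormal sequences and multiplication operators\<close>

definition bounded_measurable :: "'a measure \<Rightarrow> ('a \<Rightarrow> real) set" where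
  "bounded_measurable M = {h \<in> borel_measurable M. \<exists>K. \<forall>x\<in>space M. \<bar>h x\<bar> \<le> K}"

lemma bounded_measurableI:
  "h \<in> borel_measurable M \<Longrightarrow> (\<And>x. x \<in> space M \<Longrightarrow> \<bar>h x\<bar> \<le> K) \<Longrightarrow> h \<in> bounded_measurable M"
  by (auto simp: bounded_measurable_def)

lemma bounded_measurableD: "h \<in> bounded_measurable M \<Longrightarrow> h \<in> borel_measurable M"
  by (simp add: bounded_measurable_def)

lemma bounded_measurable_const [simp]: "(\<lambda>_. c) \<in> bounded_measurable M"
  by (rule bounded_measurableI[of _ _ "\<bar>c\<bar>"]) auto

lemma bounded_measurable_add:
  assumes "h \<in> bounded_measurable M" "k \<in> bounded_measurable M"
  shows "(\<lambda>x. h x + k x) \<in> bounded_measurable M"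
proof -
  obtain H K where "\<And>x. x \<in> space M \<Longrightarrow> \<bar>h x\<bar> \<le> H" "\<And>x. x \<in> space M \<Longrightarrow> \<bar>k x\<bar> \<le> K"
    using assms by (auto simp: bounded_measurable_def)
  then have "\<bar>h x + k x\<bar> \<le> H + K" if "x \<in> space M" for x
    using that by (meson abs_triangle_ineq add_mono order_trans)
  then show ?thesis
    by (intro bounded_measurableI[of _ _ "H + K"] borel_measurable_add[OF assms[THEN bounded_measurableD]])
qed

lemma bounded_measurable_mult:
  assumes "h \<in> bounded_measurable M" "k \<in> bounded_measurable M"
  shows "(\<lambda>x. h x * k x) \<in> bounded_measurable M"
proof -
  obtain H K where b: "\<And>x. x \<in> space M \<Longrightarrow> \<bar>h x\<bar> \<le> H" "\<And>x. x \<in> space M \<Longrightarrow> \<bar>k x\<bar> \<le> K"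
    using assms by (auto simp: bounded_measurable_def)
  have "\<bar>h x * k x\<bar> \<le> H * K" if "x \<in> space M" for x
    using b[OF that] by (simp add: abs_mult mult_mono')
  then show ?thesis
    by (intro bounded_measurableI[of _ _ "H * K"] borel_measurable_times[OF assms[THEN bounded_measurableD]])
qed

lemma bounded_measurable_cmult:
  "h \<in> bounded_measurable M \<Longrightarrow> (\<lambda>x. c * h x) \<in> bounded_measurable M"
  by (intro bounded_measurable_mult) auto

lemma bounded_measurable_diff:
  "h \<in> bounded_measurable M \<Longrightarrow> k \<in> bounded_measurable M \<Longrightarrow> (\<lambda>x. h x - k x) \<in> bounded_measurable M"
  using bounded_measurable_add[of h M "\<lambda>x. -1 * k x"] bounded_measurable_cmult[of k M "-1"] by simp

lemma bounded_measurable_sum: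
  "(\<And>i. i \<in> I \<Longrightarrow> h i \<in> bounded_measurable M) \<Longrightarrow> (\<lambda>x. \<Sum>i\<in>I. h i x) \<in> bounded_measurable M"
  by (induction I rule: infinite_finite_induct) (auto intro: bounded_measurable_add)

lemma bounded_measurable_indicator: "A \<in> sets M \<Longrightarrow> indicator A \<in> bounded_measurable M"
  by (rule bounded_measurableI[of _ _ 1]) (auto simp: indicator_def)

lemmas bounded_measurable_intros =
  bounded_measurable_const bounded_measurable_add bounded_measurable_diff bounded_measurable_mult
  bounded_measurable_cmult bounded_measurable_sum

text \<open>The functions whose multiplication operators on \<open>L\<^sup>2\<close> are self-adjoint contractions.\<close>

definition contractive_multipliers :: "'a measure \<Rightarrow> ('a \<Rightarrow> real) set" where
  "contractive_multipliers M = {f \<in> borel_measurable M. \<forall>x\<in>space M. \<bar>f x\<bar> \<le> 1}"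

definition L2_inner :: "'a measure \<Rightarrow> ('a \<Rightarrow> real) \<Rightarrow> ('a \<Rightarrow> real) \<Rightarrow> real" where
  "L2_inner M h k = (LINT x|M. h x * k x)"

text \<open>The normalisation divides by zero exactly if \<open>u n\<close> depends linearly on its predecessors in \<open>L\<^sup>2\<close>; as \<open>x / 0 = 0\<close>,
the sequence then contains the zero function. So its members are pairwise orthogonal and each has norm \<open>1\<close> or is zero,
which covers finite-dimensional \<open>L\<^sup>2\<close> spaces as well.\<close>

function gram_schmidt :: "'a measure \<Rightarrow> (nat \<Rightarrow> 'a \<Rightarrow> real) \<Rightarrow> nat \<Rightarrow> 'a \<Rightarrow> real" where
  "gram_schmidt M u n =
     (let r = (\<lambda>x. u n x - (\<Sum>k<n. L2_inner M (u n) (gram_schmidt M u k) * gram_schmidt M u k x))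
      in (\<lambda>x. r x / sqrt (L2_inner M r r)))"
  by auto
termination by (relation "Wellfounded.measure (\<lambda>(M, u, n). n)") auto

declare gram_schmidt.simps [simp del]

context finite_measure
begin

lemma integrable_bounded_measurable:
  assumes "h \<in> bounded_measurable M"
  shows "integrable M h"
proof -
  obtain K where "\<And>x. x \<in> space M \<Longrightarrow> \<bar>h x\<bar> \<le> K"
    using assms by (auto simp: bounded_measurable_def)
  then show ?thesis
    by (intro integrable_const_bound[of _ K] AE_I2 bounded_measurableD[OF assms]) simp
qed

lemma L2_inner_commute: "L2_inner M h k = L2_inner M k h"
  by (simp add: L2_inner_def mult.commute)

lemma L2_inner_self_nonneg: "0 \<le> L2_inner M h h"
  by (simp add: L2_inner_def)

lemma L2_inner_cmult_left: "L2_inner M (\<lambda>x. c * h x) k = c * L2_inner M h k"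
  by (simp add: L2_inner_def mult.assoc)

lemma L2_inner_add_left:
  assumes "h \<in> bounded_measurable M" "h' \<in> bounded_measurable M" "k \<in> bounded_measurable M"
  shows "L2_inner M (\<lambda>x. h x + h' x) k = L2_inner M h k + L2_inner M h' k"
  using assms unfolding L2_inner_def distrib_right
  by (intro Bochner_Integration.integral_add integrable_bounded_measurable bounded_measurable_mult)

lemma L2_inner_diff_left:
  assumes "h \<in> bounded_measurable M" "h' \<in> bounded_measurable M" "k \<in> bounded_measurable M"
  shows "L2_inner M (\<lambda>x. h x - h' x) k = L2_inner M h k - L2_inner M h' k"
  using assms unfolding L2_inner_def left_diff_distrib
  by (intro Bochner_Integration.integral_diff integrable_bounded_measurable bounded_measurable_mult)

lemma L2_inner_add_right:
  assumes "h \<in> bounded_measurable M" "h' \<in> bounded_measurable M" "k \<in> bounded_measurable M"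
  shows "L2_inner M k (\<lambda>x. h x + h' x) = L2_inner M k h + L2_inner M k h'"
  using L2_inner_add_left[OF assms] by (simp add: L2_inner_commute)

lemma L2_inner_diff_right:
  assumes "h \<in> bounded_measurable M" "h' \<in> bounded_measurable M" "k \<in> bounded_measurable M"
  shows "L2_inner M k (\<lambda>x. h x - h' x) = L2_inner M k h - L2_inner M k h'"
  using L2_inner_diff_left[OF assms] by (simp add: L2_inner_commute)

lemma L2_inner_sum_left:
  assumes "\<And>i. i \<in> I \<Longrightarrow> h i \<in> bounded_measurable M" "k \<in> bounded_measurable M"
  shows "L2_inner M (\<lambda>x. \<Sum>i\<in>I. c i * h i x) k = (\<Sum>i\<in>I. c i * L2_inner M (h i) k)"
proof -
  have "L2_inner M (\<lambda>x. \<Sum>i\<in>I. c i * h i x) k = (\<Sum>i\<in>I. LINT x|M. c i * (h i x * k x))"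
    using assms unfolding L2_inner_def sum_distrib_right mult.assoc
    by (intro Bochner_Integration.integral_sum integrable_bounded_measurable bounded_measurable_intros) auto
  then show ?thesis by (simp add: L2_inner_def)
qed

lemma L2_inner_sum_right:
  assumes "\<And>i. i \<in> I \<Longrightarrow> h i \<in> bounded_measurable M" "k \<in> bounded_measurable M"
  shows "L2_inner M k (\<lambda>x. \<Sum>i\<in>I. c i * h i x) = (\<Sum>i\<in>I. c i * L2_inner M k (h i))"
  using L2_inner_sum_left[where c = c, OF assms] by (simp add: L2_inner_commute)

text \<open>The third statement says that each \<open>e n\<close> has norm \<open>1\<close> or is orthogonal to everything. The last one is the
equality case of Bessel's inequality: \<open>u n\<close> is in the span of \<open>e 0, \<dots>, e n\<close>.\<close>

lemma gram_schmidt_orthonormal: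
  assumes u: "\<And>n. u n \<in> bounded_measurable M"
  defines "e \<equiv> gram_schmidt M u"
  shows "e n \<in> bounded_measurable M"
    and "i \<noteq> j \<Longrightarrow> L2_inner M (e i) (e j) = 0"
    and "L2_inner M h (e n) * L2_inner M (e n) (e n) = L2_inner M h (e n)"
    and "L2_inner M (e n) (e n) \<le> 1"
    and "L2_inner M (u n) (u n) = (\<Sum>k<Suc n. (L2_inner M (u n) (e k))\<^sup>2)"
proof -
  define r where "r n = (\<lambda>x. u n x - (\<Sum>k<n. L2_inner M (u n) (e k) * e k x))" for n
  have e_r: "e n = (\<lambda>x. r n x / sqrt (L2_inner M (r n) (r n)))" for n
    unfolding e_def r_def by (subst gram_schmidt.simps) (simp add: Let_def)
  have e_r': "e n = (\<lambda>x. (1 / sqrt (L2_inner M (r n) (r n))) * r n x)" for n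
    by (subst e_r) auto
  show bm: "e n \<in> bounded_measurable M" for n
  proof (induction n rule: less_induct)
    case (less n)
    then have "r n \<in> bounded_measurable M"
      unfolding r_def by (intro bounded_measurable_intros u) auto
    then show ?case by (subst e_r') (rule bounded_measurable_cmult)
  qed
  have r_bm: "r n \<in> bounded_measurable M" for n
    unfolding r_def by (intro bounded_measurable_intros u bm)
  have r_nonneg: "0 \<le> L2_inner M (r n) (r n)" for n
    by (rule L2_inner_self_nonneg)
  have e_inner: "L2_inner M (e n) k = L2_inner M (r n) k / sqrt (L2_inner M (r n) (r n))" for n k
    by (subst e_r', subst L2_inner_cmult_left) simp
  have e_zero: "e n = (\<lambda>_. 0)" if "L2_inner M (r n) (r n) = 0" for n
    using that by (subst e_r) simp
  have e_one: "L2_inner M (e n) (e n) = 1" if "L2_inner M (r n) (r n) \<noteq> 0" for n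
    using that r_nonneg[of n] L2_inner_commute[of "r n" "e n"] by (simp add: e_inner)
  show norm1: "L2_inner M h (e n) * L2_inner M (e n) (e n) = L2_inner M h (e n)" for h n
    by (cases "L2_inner M (r n) (r n) = 0") (simp_all add: e_one, simp add: e_zero L2_inner_def)
  show "L2_inner M (e n) (e n) \<le> 1"
    by (cases "L2_inner M (r n) (r n) = 0") (simp_all add: e_one, simp add: e_zero L2_inner_def)
  have orth_r: "\<forall>k<n. L2_inner M (r n) (e k) = 0" for n
  proof (induction n rule: less_induct)
    case (less n)
    have "L2_inner M (r n) (e k) = 0" if k: "k < n" for k
    proof -
      have "L2_inner M (e i) (e k) = 0" if "i < n" "i \<noteq> k" for i
        using less that k L2_inner_commute[of "e i" "e k"]
        by (cases i k rule: linorder_cases) (auto simp: e_inner)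
      then have "(\<Sum>i<n. L2_inner M (u n) (e i) * L2_inner M (e i) (e k))
          = (\<Sum>i<n. if i = k then L2_inner M (u n) (e k) else 0)"
        by (intro sum.cong) (auto simp: norm1)
      then show ?thesis
        using k unfolding r_def
        by (simp add: L2_inner_diff_left L2_inner_sum_left u bm bounded_measurable_intros)
    qed
    then show ?case by blast
  qed
  show orth: "i \<noteq> j \<Longrightarrow> L2_inner M (e i) (e j) = 0" for i j
    using L2_inner_commute[of "e i" "e j"] orth_r
    by (cases i j rule: linorder_cases) (auto simp: e_inner)
  have u_inner: "L2_inner M (u n) k = L2_inner M (r n) k
      + (\<Sum>i<n. L2_inner M (u n) (e i) * L2_inner M (e i) k)" if "k \<in> bounded_measurable M" for k
    using that unfolding r_def
    by (simp add: L2_inner_diff_left L2_inner_sum_left u bm bounded_measurable_intros)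
  have ru: "L2_inner M (r n) (u n) = L2_inner M (r n) (r n)"
    using u_inner[OF r_bm[of n]] orth_r[of n] L2_inner_commute[of "e k" "r n" for k]
      L2_inner_commute[of "u n" "r n"] by simp
  have "L2_inner M (u n) (e n) = L2_inner M (r n) (r n) / sqrt (L2_inner M (r n) (r n))"
    using u_inner[OF bm[of n]] orth e_inner[of n "r n"] L2_inner_commute[of "r n" "e n"] by simp
  then have "(L2_inner M (u n) (e n))\<^sup>2 = L2_inner M (r n) (r n)"
    using r_nonneg[of n] by (simp add: real_div_sqrt)
  then show "L2_inner M (u n) (u n) = (\<Sum>k<Suc n. (L2_inner M (u n) (e k))\<^sup>2)"
    using u_inner[OF u[of n]] ru L2_inner_commute[of "u n" "e k" for k] by (simp add: power2_eq_square)
qed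

text \<open>If the functions \<open>e k\<close> are pairwise orthogonal and each has norm \<open>1\<close> or is zero, this is the squared distance of \<open>h\<close> from
the span of \<open>e 0, \<dots>, e (n - 1)\<close>.\<close>

definition L2_defect :: "(nat \<Rightarrow> 'a \<Rightarrow> real) \<Rightarrow> ('a \<Rightarrow> real) \<Rightarrow> nat \<Rightarrow> real" where
  "L2_defect e h n = L2_inner M h h - (\<Sum>k<n. (L2_inner M h (e k))\<^sup>2)"

text \<open>Bessel's inequality.\<close>

lemma L2_defect_nonneg:
  assumes e: "\<And>n. e n \<in> bounded_measurable M"
    "\<And>i j. i \<noteq> j \<Longrightarrow> L2_inner M (e i) (e j) = 0"
    "\<And>n. L2_inner M (e n) (e n) \<le> 1"
    and h: "h \<in> bounded_measurable M"
  shows "0 \<le> L2_defect e h n"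
proof -
  let ?P = "\<lambda>x. \<Sum>k<n. L2_inner M h (e k) * e k x"
  let ?s = "\<Sum>k<n. (L2_inner M h (e k))\<^sup>2"
  have P: "?P \<in> bounded_measurable M" by (intro bounded_measurable_intros e)
  have hP: "L2_inner M h ?P = ?s"
    by (simp add: L2_inner_sum_right e h power2_eq_square)
  have eP: "L2_inner M (e k) ?P = L2_inner M h (e k) * L2_inner M (e k) (e k)" if "k < n" for k
  proof -
    have "L2_inner M (e k) ?P = (\<Sum>i<n. L2_inner M h (e i) * L2_inner M (e k) (e i))"
      by (simp add: L2_inner_sum_right e)
    also have "\<dots> = (\<Sum>i<n. if i = k then L2_inner M h (e k) * L2_inner M (e k) (e k) else 0)"
      using e(2)[of k] by (intro sum.cong) auto
    finally show ?thesis using that by simp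
  qed
  have "L2_inner M ?P ?P = (\<Sum>k<n. L2_inner M h (e k) * L2_inner M (e k) ?P)"
    by (rule L2_inner_sum_left) (intro e P)+
  also have "\<dots> = (\<Sum>k<n. (L2_inner M h (e k))\<^sup>2 * L2_inner M (e k) (e k))"
    by (intro sum.cong) (auto simp: eP power2_eq_square)
  also have "\<dots> \<le> ?s"
    by (intro sum_mono) (use e(3) in \<open>simp add: mult_left_le\<close>)
  finally have PP: "L2_inner M ?P ?P \<le> ?s" .
  have "0 \<le> L2_inner M (\<lambda>x. h x - ?P x) (\<lambda>x. h x - ?P x)"
    by (rule L2_inner_self_nonneg)
  also have "\<dots> = L2_inner M h h - 2 * ?s + L2_inner M ?P ?P"
    using h P bounded_measurable_diff[OF h P] hP
    by (simp add: L2_inner_diff_left L2_inner_diff_right L2_inner_commute[of ?P h])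
  finally show ?thesis using PP by (simp add: L2_defect_def)
qed

lemma L2_defect_parallelogram:
  assumes e: "\<And>n. e n \<in> bounded_measurable M"
    and h: "h \<in> bounded_measurable M" and k: "k \<in> bounded_measurable M"
  shows "L2_defect e (\<lambda>x. h x + k x) n + L2_defect e (\<lambda>x. h x - k x) n
      = 2 * L2_defect e h n + 2 * L2_defect e k n"
proof -
  have hk: "(\<lambda>x. h x + k x) \<in> bounded_measurable M" "(\<lambda>x. h x - k x) \<in> bounded_measurable M"
    using h k by (auto intro: bounded_measurable_intros)
  have "L2_inner M (\<lambda>x. h x + k x) (\<lambda>x. h x + k x) + L2_inner M (\<lambda>x. h x - k x) (\<lambda>x. h x - k x)
      = 2 * L2_inner M h h + 2 * L2_inner M k k"
    using h k hk
    by (simp add: L2_inner_add_left L2_inner_diff_left L2_inner_add_right L2_inner_diff_right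
        L2_inner_commute[of k h])
  moreover have "(L2_inner M (\<lambda>x. h x + k x) (e i))\<^sup>2 + (L2_inner M (\<lambda>x. h x - k x) (e i))\<^sup>2
      = 2 * (L2_inner M h (e i))\<^sup>2 + 2 * (L2_inner M k (e i))\<^sup>2" for i
    by (simp add: L2_inner_add_left L2_inner_diff_left h k e power2_eq_square algebra_simps)
  then have "(\<Sum>i<n. (L2_inner M (\<lambda>x. h x + k x) (e i))\<^sup>2) + (\<Sum>i<n. (L2_inner M (\<lambda>x. h x - k x) (e i))\<^sup>2)
      = 2 * (\<Sum>i<n. (L2_inner M h (e i))\<^sup>2) + 2 * (\<Sum>i<n. (L2_inner M k (e i))\<^sup>2)"
    by (simp add: sum_distrib_left flip: sum.distrib)
  ultimately show ?thesis by (simp add: L2_defect_def algebra_simps)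
qed

text \<open>The bounded functions for which Parseval's identity holds.\<close>

definition complete_for :: "(nat \<Rightarrow> 'a \<Rightarrow> real) \<Rightarrow> ('a \<Rightarrow> real) set" where
  "complete_for e = {h \<in> bounded_measurable M. L2_defect e h \<longlonglongrightarrow> 0}"

context
  fixes e :: "nat \<Rightarrow> 'a \<Rightarrow> real"
  assumes e: "\<And>n. e n \<in> bounded_measurable M"
    and orth: "\<And>i j. i \<noteq> j \<Longrightarrow> L2_inner M (e i) (e j) = 0"
    and norm_le: "\<And>n. L2_inner M (e n) (e n) \<le> 1"
begin

lemma L2_defect_add_le:
  assumes "h \<in> bounded_measurable M" "k \<in> bounded_measurable M"
  shows "L2_defect e (\<lambda>x. h x + k x) n \<le> 2 * L2_defect e h n + 2 * L2_defect e k n"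
  using L2_defect_parallelogram[where e = e, OF e assms, of n]
    L2_defect_nonneg[where e = e, OF e orth norm_le bounded_measurable_diff[OF assms], of n]
  by linarith

lemma complete_for_add:
  assumes "h \<in> complete_for e" "k \<in> complete_for e"
  shows "(\<lambda>x. h x + k x) \<in> complete_for e"
proof -
  have hk: "h \<in> bounded_measurable M" "k \<in> bounded_measurable M"
    and lim: "L2_defect e h \<longlonglongrightarrow> 0" "L2_defect e k \<longlonglongrightarrow> 0"
    using assms by (auto simp: complete_for_def)
  have "(\<lambda>n. 2 * L2_defect e h n + 2 * L2_defect e k n) \<longlonglongrightarrow> 2 * 0 + 2 * 0"
    by (intro tendsto_intros lim)
  then have lim': "(\<lambda>n. 2 * L2_defect e h n + 2 * L2_defect e k n) \<longlonglongrightarrow> 0" by simp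
  have "L2_defect e (\<lambda>x. h x + k x) \<longlonglongrightarrow> 0"
  proof (rule tendsto_sandwich[OF _ _ tendsto_const lim'])
    show "\<forall>\<^sub>F n in sequentially. 0 \<le> L2_defect e (\<lambda>x. h x + k x) n"
      using L2_defect_nonneg[where e = e, OF e orth norm_le bounded_measurable_add[OF hk]] by simp
    show "\<forall>\<^sub>F n in sequentially. L2_defect e (\<lambda>x. h x + k x) n \<le> 2 * L2_defect e h n + 2 * L2_defect e k n"
      using L2_defect_add_le[OF hk] by simp
  qed
  then show ?thesis using hk by (simp add: complete_for_def bounded_measurable_add)
qed

lemma complete_for_cmult:
  assumes "h \<in> complete_for e"
  shows "(\<lambda>x. c * h x) \<in> complete_for e"
proof -
  have "L2_defect e (\<lambda>x. c * h x) n = c\<^sup>2 * L2_defect e h n" for n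
    by (simp add: L2_defect_def L2_inner_cmult_left L2_inner_commute[of h "\<lambda>x. c * h x"]
        power_mult_distrib right_diff_distrib sum_distrib_left power2_eq_square mult_ac)
  then have "L2_defect e (\<lambda>x. c * h x) = (\<lambda>n. c\<^sup>2 * L2_defect e h n)" by (rule ext)
  then show ?thesis
    using assms tendsto_mult[OF tendsto_const[of "c\<^sup>2"], of "L2_defect e h" 0]
    by (simp add: complete_for_def bounded_measurable_cmult)
qed

text \<open>By the parallelogram law the defect of \<open>h\<close> is at most twice the defect of \<open>H i\<close> plus twice the squared
norm of \<open>h - H i\<close>, and the latter tends to \<open>0\<close> by dominated convergence.\<close>

lemma complete_for_bounded_limit:
  assumes H: "\<And>i. H i \<in> complete_for e" and h: "h \<in> borel_measurable M"
    and bound: "\<And>i x. x \<in> space M \<Longrightarrow> \<bar>H i x\<bar> \<le> K"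
    and lim: "\<And>x. x \<in> space M \<Longrightarrow> (\<lambda>i. H i x) \<longlonglongrightarrow> h x"
  shows "h \<in> complete_for e"
proof -
  have bound_h: "\<bar>h x\<bar> \<le> K" if "x \<in> space M" for x
    by (rule LIMSEQ_le_const2[OF tendsto_rabs[OF lim[OF that]]]) (use bound that in auto)
  have hb: "h \<in> bounded_measurable M" by (rule bounded_measurableI[OF h bound_h])
  have Hb: "H i \<in> bounded_measurable M" and Hd: "L2_defect e (H i) \<longlonglongrightarrow> 0" for i
    using H by (auto simp: complete_for_def)
  have Db: "(\<lambda>x. h x - H i x) \<in> bounded_measurable M" for i
    by (intro bounded_measurable_intros hb Hb)
  have "(\<lambda>i. L2_inner M (\<lambda>x. h x - H i x) (\<lambda>x. h x - H i x)) \<longlonglongrightarrow> (LINT x|M. 0)"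
    unfolding L2_inner_def
  proof (rule integral_dominated_convergence[where w = "\<lambda>_. (2 * K) * (2 * K)"])
    show "AE x in M. (\<lambda>i. (h x - H i x) * (h x - H i x)) \<longlonglongrightarrow> 0"
    proof (rule AE_I2)
      fix x assume x: "x \<in> space M"
      have "(\<lambda>i. (h x - H i x) * (h x - H i x)) \<longlonglongrightarrow> (h x - h x) * (h x - h x)"
        by (intro tendsto_intros lim x)
      then show "(\<lambda>i. (h x - H i x) * (h x - H i x)) \<longlonglongrightarrow> 0" by simp
    qed
    show "AE x in M. norm ((h x - H i x) * (h x - H i x)) \<le> 2 * K * (2 * K)" for i
    proof (rule AE_I2)
      fix x assume "x \<in> space M"
      then have "\<bar>h x - H i x\<bar> \<le> 2 * K"
        using bound_h[of x] bound[of x i] by linarith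
      then have "\<bar>h x - H i x\<bar> * \<bar>h x - H i x\<bar> \<le> 2 * K * (2 * K)"
        by (intro mult_mono') auto
      then show "norm ((h x - H i x) * (h x - H i x)) \<le> 2 * K * (2 * K)"
        by (simp only: real_norm_def abs_mult)
    qed
  qed (use h Hb[THEN bounded_measurableD] in auto)
  then have to_0: "(\<lambda>i. L2_inner M (\<lambda>x. h x - H i x) (\<lambda>x. h x - H i x)) \<longlonglongrightarrow> 0" by simp
  have "L2_defect e h \<longlonglongrightarrow> 0"
  proof (rule LIMSEQ_I)
    fix r :: real assume r: "0 < r"
    then have r4: "0 < r/4" by simp
    obtain i where i: "L2_inner M (\<lambda>x. h x - H i x) (\<lambda>x. h x - H i x) < r/4"
      using order_tendstoD(2)[OF to_0 r4] unfolding eventually_sequentially by blast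
    obtain N where N: "\<And>n. n \<ge> N \<Longrightarrow> L2_defect e (H i) n < r/4"
      using order_tendstoD(2)[OF Hd[of i] r4] unfolding eventually_sequentially by blast
    have "norm (L2_defect e h n - 0) < r" if "n \<ge> N" for n
    proof -
      have "L2_defect e (\<lambda>x. (h x - H i x) + H i x) n
          \<le> 2 * L2_defect e (\<lambda>x. h x - H i x) n + 2 * L2_defect e (H i) n"
        by (rule L2_defect_add_le[OF Db Hb])
      moreover have "L2_defect e (\<lambda>x. h x - H i x) n \<le> L2_inner M (\<lambda>x. h x - H i x) (\<lambda>x. h x - H i x)"
        by (simp add: L2_defect_def sum_nonneg)
      moreover have "0 \<le> L2_defect e h n" by (rule L2_defect_nonneg[where e = e, OF e orth norm_le hb])
      ultimately show ?thesis using i N[OF that] by simp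
    qed
    then show "\<exists>N. \<forall>n\<ge>N. norm (L2_defect e h n - 0) < r" by blast
  qed
  then show ?thesis using hb by (simp add: complete_for_def)
qed

lemma complete_for_cong:
  assumes "h \<in> complete_for e" "\<And>x. x \<in> space M \<Longrightarrow> h x = k x"
  shows "k \<in> complete_for e"
proof -
  obtain K where K: "\<And>x. x \<in> space M \<Longrightarrow> \<bar>h x\<bar> \<le> K"
    using assms(1) by (auto simp: complete_for_def bounded_measurable_def)
  have "k \<in> borel_measurable M"
    using assms measurable_cong[of M h k] by (auto simp: complete_for_def dest: bounded_measurableD)
  then show ?thesis
    by (rule complete_for_bounded_limit[of "\<lambda>_. h", OF assms(1) _ K]) (use assms(2) in auto)
qed

text \<open>The sets whose indicators satisfy Parseval's identity form a Dynkin system, so a generator that is stable under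
intersections suffices.\<close>

lemma complete_for_indicator:
  assumes G: "G \<subseteq> Pow (space M)" "Int_stable G" "sets M = sigma_sets (space M) G"
    and ind: "\<And>A. A \<in> G \<Longrightarrow> indicator A \<in> complete_for e"
    and one: "(\<lambda>_. 1) \<in> complete_for e"
    and A: "A \<in> sets M"
  shows "indicator A \<in> complete_for e"
proof -
  have "A \<in> sigma_sets (space M) G" using A G(3) by simp
  with G(2,1) show ?thesis
  proof (induction rule: sigma_sets_induct_disjoint)
    case (basic A)
    then show ?case by (rule ind)
  next
    case empty
    then show ?case
      using complete_for_cmult[OF one, of 0] by (simp add: indicator_def)
  next
    case (compl A)
    have "(\<lambda>x. 1 + (-1) * indicator A x) \<in> complete_for e"
      by (intro complete_for_add one complete_for_cmult compl)
    then show ?case by (rule complete_for_cong) (auto simp: indicator_def)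
  next
    case (union A)
    have A: "A i \<in> sets M" for i using union(2) G(3) by auto
    have fin: "(\<lambda>x. \<Sum>i<n. indicator (A i) x) \<in> complete_for e" for n
    proof (induction n)
      case 0
      then show ?case using complete_for_cmult[OF one, of 0] by simp
    next
      case (Suc n)
      then show ?case using complete_for_add[OF Suc union(3)[of n]] by simp
    qed
    have eq: "(\<Sum>i<n. indicator (A i) x) = (indicator (\<Union>i<n. A i) x :: real)" for n x
      using union(1) by (intro indicator_UN_disjoint[symmetric]) (auto simp: disjoint_family_on_def)
    show ?case
    proof (rule complete_for_bounded_limit[OF fin])
      show "indicator (\<Union> (range A)) \<in> borel_measurable M" using A by auto
      show "\<bar>\<Sum>i<n. indicator (A i) x\<bar> \<le> (1::real)" for n x unfolding eq by (simp add: indicator_def)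
      show "(\<lambda>n. \<Sum>i<n. indicator (A i) x) \<longlonglongrightarrow> (indicator (\<Union> (range A)) x :: real)" for x
        unfolding eq by (rule LIMSEQ_indicator_UN)
    qed
  qed
qed

lemma complete_for_bounded_measurable:
  assumes ind: "\<And>A. A \<in> sets M \<Longrightarrow> indicator A \<in> complete_for e"
    and h: "h \<in> bounded_measurable M"
  shows "h \<in> complete_for e"
proof -
  have nonneg: "(\<exists>K. \<forall>x\<in>space M. u x \<le> K) \<longrightarrow> u \<in> complete_for e"
    if "u \<in> borel_measurable M" "\<And>x. 0 \<le> u x" for u
    using that
  proof (induction rule: borel_measurable_induct_real)
    case (set A)
    then show ?case using ind by simp
  next
    case (mult u c)
    show ?case
    proof
      assume "\<exists>K. \<forall>x\<in>space M. c * u x \<le> K"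
      then obtain K where K: "\<And>x. x \<in> space M \<Longrightarrow> c * u x \<le> K" by blast
      show "(\<lambda>x. c * u x) \<in> complete_for e"
      proof (cases "c = 0")
        case True
        then show ?thesis
          using complete_for_cong[OF complete_for_cmult[OF ind[OF sets.empty_sets], of 0]] by simp
      next
        case False
        then have "\<forall>x\<in>space M. u x \<le> K / c"
          using K mult(1) by (auto simp: field_simps)
        then show ?thesis using mult by (intro complete_for_cmult) blast
      qed
    qed
  next
    case (add u v)
    show ?case
    proof
      assume "\<exists>K. \<forall>x\<in>space M. v x + u x \<le> K"
      then obtain K where K: "\<And>x. x \<in> space M \<Longrightarrow> v x + u x \<le> K" by blast
      have "u x \<le> K" "v x \<le> K" if "x \<in> space M" for x
        using K[OF that] \<open>\<And>x. 0 \<le> u x\<close>[of x] \<open>\<And>x. 0 \<le> v x\<close>[of x] by linarith+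
      then show "(\<lambda>x. v x + u x) \<in> complete_for e"
        using add by (intro complete_for_add) blast+
    qed
  next
    case (seq U)
    show ?case
    proof
      assume "\<exists>K. \<forall>x\<in>space M. u x \<le> K"
      then obtain K where K: "\<And>x. x \<in> space M \<Longrightarrow> u x \<le> K" by blast
      have le: "U i x \<le> K" if "x \<in> space M" for i x
      proof -
        have "incseq (\<lambda>i. U i x)" using \<open>incseq U\<close> by (auto simp: incseq_def le_fun_def)
        from incseq_le[OF this seq(4)[OF that], of i] show ?thesis using K[OF that] by linarith
      qed
      then have "U i \<in> complete_for e" for i using seq(5) by blast
      then show "u \<in> complete_for e"
        by (rule complete_for_bounded_limit[where K = K, OF _ that(1)]) (use le seq(2,4) in auto)
    qed
  qed
  obtain K where K: "\<And>x. x \<in> space M \<Longrightarrow> \<bar>h x\<bar> \<le> K"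
    using h by (auto simp: bounded_measurable_def)
  have hm: "h \<in> borel_measurable M" using h by (rule bounded_measurableD)
  have "(\<lambda>x. max 0 (h x)) \<in> complete_for e" "(\<lambda>x. max 0 (- h x)) \<in> complete_for e"
    using K hm
    by (auto intro!: nonneg[rule_format] exI[of _ "\<bar>K\<bar>"])  (force simp: abs_le_iff)+
  then have "(\<lambda>x. max 0 (h x) + (-1) * max 0 (- h x)) \<in> complete_for e"
    by (intro complete_for_add complete_for_cmult)
  then show ?thesis by (rule complete_for_cong) auto
qed

end

text \<open>The sequence arises from the indicators of a countable generator, and of the whole space, by the Gram-Schmidt process.
Countability of the generator is what makes \<open>L\<^sup>2\<close> separable.\<close>

lemma complete_orthonormal_sequence:
  assumes G: "countable G" "G \<subseteq> Pow (space M)" "Int_stable G" "sets M = sigma_sets (space M) G"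
  obtains e :: "nat \<Rightarrow> 'a \<Rightarrow> real"
  where "\<And>n. e n \<in> bounded_measurable M" "\<And>i j. i \<noteq> j \<Longrightarrow> L2_inner M (e i) (e j) = 0"
    "\<And>n. L2_inner M (e n) (e n) \<le> 1"
    "\<And>h. h \<in> bounded_measurable M \<Longrightarrow> (\<lambda>k. (L2_inner M h (e k))\<^sup>2) sums L2_inner M h h"
proof -
  define G' where "G' = insert (space M) G"
  have G': "countable G'" "G' \<noteq> {}" "G' \<subseteq> sets M" using G by (auto simp: G'_def)
  define u :: "nat \<Rightarrow> 'a \<Rightarrow> real" where "u n = indicator (from_nat_into G' n)" for n
  have u: "u n \<in> bounded_measurable M" for n
    using from_nat_into[OF G'(2), of n] G'(3) unfolding u_def
    by (intro bounded_measurable_indicator) auto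
  define e where "e = gram_schmidt M u"
  note gs = gram_schmidt_orthonormal[of u, OF u, folded e_def]
  have u_complete: "u n \<in> complete_for e" for n
  proof -
    have "L2_defect e (u n) k = 0" if "k \<ge> Suc n" for k
    proof (rule antisym)
      have "(\<Sum>i<Suc n. (L2_inner M (u n) (e i))\<^sup>2) \<le> (\<Sum>i<k. (L2_inner M (u n) (e i))\<^sup>2)"
        using that by (intro sum_mono2) auto
      then show "L2_defect e (u n) k \<le> 0" using gs(5)[of n] by (simp only: L2_defect_def diff_le_0_iff_le)
      show "0 \<le> L2_defect e (u n) k" by (rule L2_defect_nonneg[where e = e, OF gs(1,2,4) u])
    qed
    then have "\<forall>\<^sub>F k in sequentially. L2_defect e (u n) k = 0"
      unfolding eventually_sequentially by blast
    then have "L2_defect e (u n) \<longlonglongrightarrow> 0" by (rule tendsto_eventually)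
    then show ?thesis using u by (simp add: complete_for_def)
  qed
  have G_complete: "indicator A \<in> complete_for e" if "A \<in> G'" for A
    using u_complete[of "to_nat_on G' A"] that G'(1) by (simp add: u_def)
  have one: "(\<lambda>_. 1) \<in> complete_for e"
    by (rule complete_for_cong[where e = e, OF gs(1,2,4) G_complete[of "space M"]]) (auto simp: G'_def)
  have ind: "indicator A \<in> complete_for e" if "A \<in> sets M" for A
    by (rule complete_for_indicator[where e = e, OF gs(1,2,4) G(2-4) _ one that])
      (auto intro: G_complete simp: G'_def)
  have all: "h \<in> complete_for e" if "h \<in> bounded_measurable M" for h
    by (rule complete_for_bounded_measurable[where e = e, OF gs(1,2,4) ind that])
  show thesis
  proof (rule that[of e])
    fix h assume "h \<in> bounded_measurable M"
    then have "L2_defect e h \<longlonglongrightarrow> 0" using all by (simp add: complete_for_def)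
    then have "(\<lambda>n. L2_inner M h h - L2_defect e h n) \<longlonglongrightarrow> L2_inner M h h - 0"
      by (intro tendsto_intros)
    then show "(\<lambda>k. (L2_inner M h (e k))\<^sup>2) sums L2_inner M h h"
      by (simp add: sums_def L2_defect_def)
  qed (use gs in auto)
qed

text \<open>Here \<open>c h\<close> is the sequence of coefficients of \<open>h\<close>, and \<open>T f\<close> is multiplication by \<open>f\<close> in these
coordinates: the \<open>k\<close>-th entry of \<open>T f x\<close> is \<open>\<langle>x, c (f e\<^sub>k)\<rangle>\<close>, defined
for every \<open>x\<close> and not only for sequences of coefficients of bounded functions. That the operators commute follows from self-adjointness, because the \<open>k\<close>-th entry of
\<open>T f (T g x)\<close> is \<open>\<langle>T g x, c (f e\<^sub>k)\<rangle> = \<langle>x, c (g f e\<^sub>k)\<rangle>\<close>.\<close>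

lemma multiplication_operators_on_ell2:
  assumes G: "countable G" "G \<subseteq> Pow (space M)" "Int_stable G" "sets M = sigma_sets (space M) G"
  obtains c :: "('a \<Rightarrow> real) \<Rightarrow> ell2" and T :: "('a \<Rightarrow> real) \<Rightarrow> ell2 \<Rightarrow>\<^sub>L ell2"
  where "\<And>h k. h \<in> bounded_measurable M \<Longrightarrow> k \<in> bounded_measurable M \<Longrightarrow>
      inner (c h) (c k) = (LINT x|M. h x * k x)"
    and "\<And>f h. f \<in> contractive_multipliers M \<Longrightarrow> h \<in> bounded_measurable M \<Longrightarrow> T f (c h) = c (\<lambda>x. f x * h x)"
    and "\<And>f. f \<in> contractive_multipliers M \<Longrightarrow> selfadjoint_contraction (T f)"
    and "\<And>f g. f \<in> contractive_multipliers M \<Longrightarrow> g \<in> contractive_multipliers M \<Longrightarrow>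
      T f o\<^sub>L T g = T g o\<^sub>L T f"
proof -
  obtain e where e: "\<And>n. e n \<in> bounded_measurable M" "\<And>i j. i \<noteq> j \<Longrightarrow> L2_inner M (e i) (e j) = 0"
      "\<And>n. L2_inner M (e n) (e n) \<le> 1"
      and parseval: "\<And>h. h \<in> bounded_measurable M \<Longrightarrow> (\<lambda>k. (L2_inner M h (e k))\<^sup>2) sums L2_inner M h h"
    using complete_orthonormal_sequence[OF G] by metis
  define c where "c h = Abs_ell2 (\<lambda>k. L2_inner M h (e k))" for h
  have c_nth: "ell2_nth (c h) k = L2_inner M h (e k)" if "h \<in> bounded_measurable M" for h k
    using sums_summable[OF parseval[OF that]] by (simp add: c_def Abs_ell2_inverse sq_summable_def)
  have c_norm: "(norm (c h))\<^sup>2 = L2_inner M h h" if "h \<in> bounded_measurable M" for h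
    using ell2_norm_power2_sums[of "c h"] parseval[OF that] by (simp add: c_nth that sums_unique2)
  have c_inner: "inner (c h) (c k) = L2_inner M h k"
    if h: "h \<in> bounded_measurable M" and k: "k \<in> bounded_measurable M" for h k
  proof -
    have hk: "(\<lambda>x. h x + k x) \<in> bounded_measurable M" using h k by (rule bounded_measurable_add)
    have "c h + c k = c (\<lambda>x. h x + k x)"
      by (rule ell2_eqI) (simp add: ell2_nth_add c_nth h k hk L2_inner_add_left e)
    then have "inner (c h) (c k) = (L2_inner M (\<lambda>x. h x + k x) (\<lambda>x. h x + k x)
        - L2_inner M h h - L2_inner M k k) / 2"
      using h k hk by (simp add: dot_norm c_norm)
    then show ?thesis
      using h k hk by (simp add: L2_inner_add_left L2_inner_add_right L2_inner_commute[of k h])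
  qed
  define F where "F = contractive_multipliers M"
  have F: "f \<in> bounded_measurable M" if "f \<in> F" for f
    using that by (auto simp: F_def contractive_multipliers_def intro: bounded_measurableI)
  have "\<exists>T :: ell2 \<Rightarrow>\<^sub>L ell2. norm T \<le> 1 \<and>
      (\<forall>x k. ell2_nth (blinfun_apply T x) k = inner x (c (\<lambda>t. f t * e k t)))" if f: "f \<in> F" for f
  proof (rule ell2_row_operator)
    fix n :: nat and y :: "nat \<Rightarrow> real"
    let ?P = "\<lambda>t. \<Sum>k<n. y k * e k t"
    have P: "?P \<in> bounded_measurable M" by (intro bounded_measurable_intros e)
    have fe: "(\<lambda>t. f t * e k t) \<in> bounded_measurable M" for k
      by (intro bounded_measurable_mult e F f)
    have fP: "(\<lambda>t. f t * ?P t) \<in> bounded_measurable M"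
      by (rule bounded_measurable_mult[OF F[OF f] P])
    have "(\<Sum>k<n. y k *\<^sub>R c (\<lambda>t. f t * e k t)) = c (\<lambda>t. f t * ?P t)"
    proof (rule ell2_eqI)
      fix i
      have "L2_inner M (\<lambda>t. \<Sum>k<n. y k * (f t * e k t)) (e i)
          = (\<Sum>k<n. y k * L2_inner M (\<lambda>t. f t * e k t) (e i))"
        by (rule L2_inner_sum_left[OF fe e(1)])
      moreover have "(\<lambda>t. \<Sum>k<n. y k * (f t * e k t)) = (\<lambda>t. f t * ?P t)"
        by (simp add: sum_distrib_left mult.left_commute)
      ultimately show "ell2_nth (\<Sum>k<n. y k *\<^sub>R c (\<lambda>t. f t * e k t)) i = ell2_nth (c (\<lambda>t. f t * ?P t)) i"
        by (simp add: ell2_nth_sum ell2_nth_scaleR c_nth fe fP)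
    qed
    then have "(norm (\<Sum>k<n. y k *\<^sub>R c (\<lambda>t. f t * e k t)))\<^sup>2 = L2_inner M (\<lambda>t. f t * ?P t) (\<lambda>t. f t * ?P t)"
      by (simp only: c_norm[OF fP])
    also have "\<dots> \<le> L2_inner M ?P ?P"
      unfolding L2_inner_def
    proof (intro integral_mono integrable_bounded_measurable bounded_measurable_mult[OF fP fP]
        bounded_measurable_mult[OF P P])
      fix t assume "t \<in> space M"
      then have "f t * f t \<le> 1" using f by (auto simp: F_def contractive_multipliers_def abs_le_square_iff[of _ 1, simplified] power2_eq_square)
      then have "(f t * f t) * (?P t * ?P t) \<le> 1 * (?P t * ?P t)" by (rule mult_right_mono) simp
      then show "f t * ?P t * (f t * ?P t) \<le> ?P t * ?P t" by (simp only: mult_ac mult_1)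
    qed
    also have "L2_inner M ?P ?P = (\<Sum>k<n. y k * L2_inner M (e k) ?P)"
      by (rule L2_inner_sum_left) (intro e P)+
    also have "\<dots> = (\<Sum>k<n. (y k)\<^sup>2 * L2_inner M (e k) (e k))"
    proof (intro sum.cong refl)
      fix k assume k: "k \<in> {..<n}"
      have "L2_inner M (e k) ?P = (\<Sum>i<n. y i * L2_inner M (e k) (e i))"
        by (rule L2_inner_sum_right) (intro e)+
      also have "\<dots> = (\<Sum>i<n. if i = k then y k * L2_inner M (e k) (e k) else 0)"
        using e(2)[of k] by (intro sum.cong) auto
      finally show "y k * L2_inner M (e k) ?P = (y k)\<^sup>2 * L2_inner M (e k) (e k)"
        using k by (simp add: power2_eq_square)
    qed
    also have "\<dots> \<le> (\<Sum>k<n. (y k)\<^sup>2)"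
      by (intro sum_mono) (use e(3) in \<open>simp add: mult_left_le\<close>)
    finally show "(norm (\<Sum>k<n. y k *\<^sub>R c (\<lambda>t. f t * e k t)))\<^sup>2 \<le> (\<Sum>k<n. (y k)\<^sup>2)" .
  qed
  then obtain T :: "('a \<Rightarrow> real) \<Rightarrow> ell2 \<Rightarrow>\<^sub>L ell2" where T_norm: "\<And>f. f \<in> F \<Longrightarrow> norm (T f) \<le> 1"
    and T_nth: "\<And>f x k. f \<in> F \<Longrightarrow> ell2_nth (T f x) k = inner x (c (\<lambda>t. f t * e k t))"
    by metis
  have fh: "(\<lambda>t. f t * h t) \<in> bounded_measurable M" if "f \<in> F" "h \<in> bounded_measurable M" for f h :: "'a \<Rightarrow> real"
    using F[OF that(1)] that(2) by (rule bounded_measurable_mult)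
  have T_c: "T f (c h) = c (\<lambda>x. f x * h x)" if "f \<in> F" "h \<in> bounded_measurable M" for f h
    by (rule ell2_eqI) (simp add: T_nth c_inner c_nth fh e that, simp add: L2_inner_def mult_ac)
  have T_sym: "inner (T f x) y = inner x (T f y)" if f: "f \<in> F" for f x y
  proof (rule blinfun_ell2_symmetricI)
    fix x j
    have "T f (ell2_unit j) = c (\<lambda>t. f t * e j t)"
      by (rule ell2_eqI) (simp add: T_nth f c_nth fh e inner_ell2_unit inner_commute[of "ell2_unit j"],
          simp add: L2_inner_def mult_ac)
    then show "inner (T f x) (ell2_unit j) = inner x (T f (ell2_unit j))"
      by (simp add: inner_ell2_unit T_nth f)
  qed
  have T_comm: "T f o\<^sub>L T g = T g o\<^sub>L T f" if f: "f \<in> F" and g: "g \<in> F" for f g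
  proof (intro blinfun_eqI ell2_eqI)
    fix x k
    have *: "ell2_nth (T f (T g x)) k = inner x (c (\<lambda>t. g t * (f t * e k t)))" if "f \<in> F" "g \<in> F" for f g
      using that by (simp add: T_nth T_sym T_c fh e)
    show "ell2_nth ((T f o\<^sub>L T g) x) k = ell2_nth ((T g o\<^sub>L T f) x) k"
      using *[OF f g] *[OF g f] by (simp add: mult.left_commute)
  qed
  show thesis
    by (rule that[of c T]) (use c_inner T_c T_norm T_sym T_comm in
        \<open>auto simp: L2_inner_def selfadjoint_contraction_def F_def\<close>)
qed

text \<open>A Naimark dilation: the vector field \<open>w\<close> is a density of the positive matrix-valued measure \<open>w w\<^sup>T dM\<close> of total
mass \<open>1\<close>, and integration against it is the compression of multiplication operators.\<close>

lemma commuting_dilation_of_integrals: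
  fixes w :: "'a \<Rightarrow> real^'n"
  assumes G: "countable G" "G \<subseteq> Pow (space M)" "Int_stable G" "sets M = sigma_sets (space M) G"
    and w: "\<And>i. (\<lambda>x. w x $ i) \<in> bounded_measurable M"
    and w1: "\<And>i j. (LINT x|M. w x $ i * w x $ j) = (if i = j then 1 else 0)"
  obtains V :: "(real^'n) \<Rightarrow>\<^sub>L ell2" and T :: "('a \<Rightarrow> real) \<Rightarrow> ell2 \<Rightarrow>\<^sub>L ell2"
  where "isometry V" "\<And>f. f \<in> contractive_multipliers M \<Longrightarrow> selfadjoint_contraction (T f)"
    "\<And>f g. f \<in> contractive_multipliers M \<Longrightarrow> g \<in> contractive_multipliers M \<Longrightarrow> T f o\<^sub>L T g = T g o\<^sub>L T f"
    "\<And>f i j. f \<in> contractive_multipliers M \<Longrightarrow> compression V (T f) $ i $ j = (LINT x|M. f x * (w x $ i * w x $ j))"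
proof -
  obtain c :: "('a \<Rightarrow> real) \<Rightarrow> ell2" and T :: "('a \<Rightarrow> real) \<Rightarrow> ell2 \<Rightarrow>\<^sub>L ell2"
    where c: "\<And>h k. h \<in> bounded_measurable M \<Longrightarrow> k \<in> bounded_measurable M \<Longrightarrow>
      inner (c h) (c k) = (LINT x|M. h x * k x)"
    and T_c: "\<And>f h. f \<in> contractive_multipliers M \<Longrightarrow> h \<in> bounded_measurable M \<Longrightarrow> T f (c h) = c (\<lambda>x. f x * h x)"
    and T: "\<And>f. f \<in> contractive_multipliers M \<Longrightarrow> selfadjoint_contraction (T f)"
      "\<And>f g. f \<in> contractive_multipliers M \<Longrightarrow> g \<in> contractive_multipliers M \<Longrightarrow> T f o\<^sub>L T g = T g o\<^sub>L T f"
    by (rule multiplication_operators_on_ell2[OF G]) (rule that)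
  define V0 where "V0 x = (\<Sum>i\<in>UNIV. x $ i *\<^sub>R c (\<lambda>t. w t $ i))" for x :: "real^'n"
  have "linear V0"
    by (rule linearI) (simp_all add: V0_def scaleR_add_left sum.distrib scaleR_sum_right)
  then have "bounded_linear V0" by (simp add: linear_conv_bounded_linear)
  then obtain V where V: "blinfun_apply V = V0" by (metis bounded_linear_Blinfun_apply)
  have V_axis: "V (axis i 1) = c (\<lambda>t. w t $ i)" for i
    by (simp add: V V0_def axis_def if_distrib[of "\<lambda>a. a *\<^sub>R _"] cong: if_cong)
  have ww: "inner (c (\<lambda>t. w t $ i)) (c (\<lambda>t. w t $ j)) = (if i = j then 1 else 0)" for i j
    by (simp add: c w w1)
  have "inner (V x) (V x) = inner x x" for x
    by (simp add: V V0_def inner_sum_left inner_sum_right ww inner_vec_def if_distrib cong: if_cong)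
  then have "isometry V" by (simp add: isometry_def norm_eq)
  moreover have "compression V (T f) $ i $ j = (LINT x|M. f x * (w x $ i * w x $ j))" if f: "f \<in> contractive_multipliers M" for f i j
  proof -
    have fb: "f \<in> bounded_measurable M"
      using f by (auto simp: contractive_multipliers_def intro: bounded_measurableI)
    show ?thesis
      by (simp add: compression_nth V_axis T_c f w c bounded_measurable_mult[OF fb] mult_ac)
  qed
  ultimately show thesis using T by (intro that)
qed

end

section \<open>Averages over rotations of the sphere\<close>

lemma orthogonal_transformation_measurable_sphere:
  fixes U :: "'a::euclidean_space \<Rightarrow> 'a"
  assumes U: "orthogonal_transformation U"
  shows "U \<in> sphere_measure \<rightarrow>\<^sub>M sphere_measure"
proof -
  have "U \<in> borel_measurable borel"
    using orthogonal_transformation_linear[OF U]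
    by (intro borel_measurable_continuous_onI linear_continuous_on)
      (simp add: linear_conv_bounded_linear)
  then show ?thesis
    unfolding measurable_cong_sets[OF sets_sphere_measure sets_sphere_measure]
    by (rule measurable_restrict_space3) (use orthogonal_transformation_norm[OF U] in auto)
qed

lemma sphere_integral_orthogonal:
  fixes U :: "'a::euclidean_space \<Rightarrow> 'a" and f :: "'a \<Rightarrow> real"
  assumes U: "orthogonal_transformation U" and f: "f \<in> borel_measurable sphere_measure"
  shows "(LINT x|sphere_measure. f (U x)) = (LINT x|sphere_measure. f x)"
  using integral_distr[OF orthogonal_transformation_measurable_sphere[OF U] f]
  by (simp add: sphere_measure_rotation_invariant[OF U])

lemma borel_measurable_sphere_continuous:
  "continuous_on (sphere 0 1) f \<Longrightarrow> (f :: 'a::euclidean_space \<Rightarrow> real) \<in> borel_measurable sphere_measure"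
  unfolding measurable_cong_sets[OF sets_sphere_measure refl]
  by (rule borel_measurable_continuous_on_restrict)

lemma integrable_sphere_continuous:
  fixes f :: "'a::euclidean_space \<Rightarrow> real"
  assumes "continuous_on (sphere 0 1) f"
  shows "integrable sphere_measure f"
proof -
  interpret prob_space "sphere_measure :: 'a measure" by (rule prob_space_sphere_measure)
  have "bounded (f ` sphere 0 1)"
    by (intro compact_imp_bounded compact_continuous_image assms compact_sphere)
  then obtain K where "\<And>x. x \<in> sphere 0 1 \<Longrightarrow> norm (f x) \<le> K"
    unfolding bounded_iff by blast
  then show ?thesis
    by (intro integrable_const_bound[of _ K] AE_I2 borel_measurable_sphere_continuous assms) simp
qed

lemma sum_list_le_with_one_smaller:
  fixes f :: "'b \<Rightarrow> real"
  assumes "x \<in> set xs" "f x \<le> d" "\<And>y. y \<in> set xs \<Longrightarrow> f y \<le> c"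
  shows "(\<Sum>y\<leftarrow>xs. f y) \<le> (real (length xs) - 1) * c + d"
proof -
  have "(\<Sum>y\<leftarrow>remove1 x xs. f y) \<le> (\<Sum>y\<leftarrow>remove1 x xs. c)"
    using assms(3) notin_set_remove1[of _ xs x] by (intro sum_list_mono) blast
  also have "\<dots> = (real (length xs) - 1) * c"
    using assms(1) length_pos_if_in_set[OF assms(1)]
    by (simp add: sum_list_triv length_remove1 of_nat_diff Suc_le_eq)
  finally show ?thesis
    using sum_list_map_remove1[OF assms(1), of f] assms(2) by simp
qed

text \<open>Let \<open>s\<close> be the infimum of the upper bounds attained by averages of \<open>f\<close> over finite families of rotations. It cannot
exceed the mean \<open>m\<close>: an average that stays below \<open>s + \<delta>\<close> has mean \<open>m\<close> and is therefore at most \<open>m\<close> at some point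
\<open>p\<close>, hence at most \<open>(s + m)/2\<close> in a ball around \<open>p\<close> of a radius that depends only on the modulus of continuity of \<open>f\<close>. A fixed number
\<open>N\<close> of such balls covers the sphere, and averaging once more over rotations that move their centres to \<open>p\<close> lowers the bound
everywhere by about \<open>(s - m)/(2 N)\<close>, so that it drops below \<open>s\<close> if \<open>\<delta>\<close> is small compared to this gain. The same idea yields
von Neumann's mean on a compact group.\<close>

lemma rotation_average_close_to_mean:
  fixes f :: "real^'n \<Rightarrow> real" and c :: real
  assumes cont: "continuous_on (sphere 0 1) f" and c: "(LINT x|sphere_measure. f x) < c"
  obtains Us :: "((real^'n) \<Rightarrow> real^'n) list"
  where "Us \<noteq> []" "\<And>U. U \<in> set Us \<Longrightarrow> orthogonal_transformation U"
    "\<And>v. norm v = 1 \<Longrightarrow> (\<Sum>U\<leftarrow>Us. f (U v)) \<le> length Us * c"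
proof -
  interpret prob_space "sphere_measure :: (real^'n) measure" by (rule prob_space_sphere_measure)
  define m where "m = (LINT x|sphere_measure. f x)"
  define Adm :: "((real^'n) \<Rightarrow> real^'n) list set"
    where "Adm = {Us. Us \<noteq> [] \<and> (\<forall>U\<in>set Us. orthogonal_transformation U)}"
  define B :: "real set" where "B = {b. \<exists>Us\<in>Adm. \<forall>v. norm v = 1 \<longrightarrow> (\<Sum>U\<leftarrow>Us. f (U v)) \<le> length Us * b}"
  have mean: "integrable sphere_measure (\<lambda>v. \<Sum>U\<leftarrow>Us. f (U v)) \<and>
      (LINT v|sphere_measure. (\<Sum>U\<leftarrow>Us. f (U v))) = length Us * m"
    if "\<forall>U\<in>set Us. orthogonal_transformation U" for Us :: "((real^'n) \<Rightarrow> real^'n) list"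
    using that
  proof (induction Us)
    case (Cons U Us)
    then have U: "orthogonal_transformation U" by simp
    have "integrable (distr sphere_measure sphere_measure U) f"
      unfolding sphere_measure_rotation_invariant[OF U] by (rule integrable_sphere_continuous[OF cont])
    then have "integrable sphere_measure (\<lambda>v. f (U v))"
      by (rule integrable_distr[OF orthogonal_transformation_measurable_sphere[OF U]])
    then show ?case
      using Cons sphere_integral_orthogonal[OF U borel_measurable_sphere_continuous[OF cont]]
      by (simp add: m_def algebra_simps)
  qed simp
  have small_point: "\<exists>p. norm p = 1 \<and> (\<Sum>U\<leftarrow>Us. f (U p)) \<le> length Us * m" if "Us \<in> Adm" for Us
  proof (rule ccontr)
    assume "\<not> ?thesis"
    then have "length Us * m < (LINT v|sphere_measure. (\<Sum>U\<leftarrow>Us. f (U v)))"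
      using mean[of Us] that by (intro expectation_greater AE_I2) (auto simp: Adm_def not_le)
    then show False using mean[of Us] that by (simp add: Adm_def)
  qed
  have B_ge: "m \<le> b" if "b \<in> B" for b
  proof -
    obtain Us where Us: "Us \<in> Adm" "\<And>v. norm v = 1 \<Longrightarrow> (\<Sum>U\<leftarrow>Us. f (U v)) \<le> length Us * b"
      using \<open>b \<in> B\<close> by (auto simp: B_def)
    have "(LINT v|sphere_measure. (\<Sum>U\<leftarrow>Us. f (U v))) \<le> length Us * b"
      using mean[of Us] Us by (intro integral_le_const AE_I2) (auto simp: Adm_def)
    then show ?thesis using mean[of Us] Us(1) by (simp add: Adm_def)
  qed
  have "bounded (f ` sphere 0 1)"
    by (intro compact_imp_bounded compact_continuous_image cont compact_sphere)
  then obtain K where K: "\<And>x. x \<in> sphere 0 1 \<Longrightarrow> norm (f x) \<le> K"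
    unfolding bounded_iff by blast
  have "K \<in> B"
    unfolding B_def
  proof (intro CollectI bexI[of _ "[\<lambda>x. x]"] allI impI)
    show "[\<lambda>x. x] \<in> Adm" by (simp add: Adm_def orthogonal_transformation_id)
    show "(\<Sum>U\<leftarrow>[\<lambda>x. x]. f (U v)) \<le> length [\<lambda>x::real^'n. x] * K" if "norm v = 1" for v
      using abs_le_D1[of "f v" K] K[of v] that by simp
  qed
  then have B_ne: "B \<noteq> {}" by blast
  have B_bdd: "bdd_below B" using B_ge by (rule bdd_belowI)
  define s where "s = Inf B"
  have "s \<le> m"
  proof (rule ccontr)
    assume "\<not> s \<le> m"
    then have sm: "m < s" by simp
    have "uniformly_continuous_on (sphere 0 1) f"
      by (intro compact_uniformly_continuous cont compact_sphere)
    then obtain r where r: "r > 0" "\<And>x y. x \<in> sphere 0 1 \<Longrightarrow> y \<in> sphere 0 1 \<Longrightarrow> dist y x < r \<Longrightarrow>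
        dist (f y) (f x) < (s - m) / 2"
      unfolding uniformly_continuous_on_def using sm
      by (metis diff_gt_0_iff_gt half_gt_zero)
    obtain C where C: "finite C" "C \<subseteq> sphere (0::real^'n) 1" "sphere 0 1 \<subseteq> (\<Union>q\<in>C. ball q r)"
      by (rule compactE_image[OF compact_sphere, of "sphere 0 1" "\<lambda>q. ball q r" 0 1])
        (use r(1) in \<open>auto intro!: bexI\<close>)
    then obtain qs where qs: "set qs = C" using finite_list by blast
    define N where "N = length qs"
    have "axis undefined 1 \<in> sphere (0::real^'n) 1" by simp
    then have "C \<noteq> {}" using C(3) by blast
    then have N: "N > 0" using qs by (auto simp: N_def)
    \<comment> \<open>half of the gain \<open>(s - m)/(2 N)\<close> of the second averaging\<close>
    define \<delta> where "\<delta> = (s - m) / (4 * N)"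
    have \<delta>: "\<delta> > 0" using sm N by (simp add: \<delta>_def)
    obtain b where "b \<in> B" "b < s + \<delta>"
      using cInf_lessD[OF B_ne, of "s + \<delta>"] \<delta> by (auto simp: s_def)
    then obtain Us where Us: "Us \<in> Adm" "\<And>v. norm v = 1 \<Longrightarrow> (\<Sum>U\<leftarrow>Us. f (U v)) \<le> length Us * b"
      by (auto simp: B_def)
    have Us_orth: "orthogonal_transformation U" if "U \<in> set Us" for U
      using Us(1) that by (auto simp: Adm_def)
    define L where "L = real (length Us)"
    have L: "L > 0" using Us(1) by (auto simp: Adm_def L_def)
    have Us_le: "(\<Sum>U\<leftarrow>Us. f (U v)) \<le> L * (s + \<delta>)" if "norm v = 1" for v
    proof -
      have "L * b \<le> L * (s + \<delta>)" using \<open>b < s + \<delta>\<close> L by simp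
      then show ?thesis using Us(2)[OF that] by (simp add: L_def)
    qed
    obtain p where p: "norm p = 1" "(\<Sum>U\<leftarrow>Us. f (U p)) \<le> L * m"
      using small_point[OF Us(1)] by (auto simp: L_def)
    have near: "(\<Sum>U\<leftarrow>Us. f (U v)) \<le> L * ((s + m) / 2)" if v: "norm v = 1" "dist v p < r" for v
    proof -
      have "f (U v) \<le> f (U p) + (s - m) / 2" if "U \<in> set Us" for U
      proof -
        note U = Us_orth[OF that]
        have "dist (U v) (U p) = dist v p"
          by (simp add: dist_norm orthogonal_transformation_norm[OF U]
              flip: linear_diff[OF orthogonal_transformation_linear[OF U]])
        then have "dist (f (U v)) (f (U p)) < (s - m) / 2"
          using v p by (intro r(2)) (auto simp: orthogonal_transformation_norm[OF U])
        then show ?thesis unfolding dist_real_def by linarith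
      qed
      then have "(\<Sum>U\<leftarrow>Us. f (U v)) \<le> (\<Sum>U\<leftarrow>Us. f (U p) + (s - m) / 2)"
        by (intro sum_list_mono) auto
      also have "\<dots> = (\<Sum>U\<leftarrow>Us. f (U p)) + L * ((s - m) / 2)"
        by (simp add: sum_list_addf sum_list_triv L_def)
      also have "\<dots> \<le> L * m + L * ((s - m) / 2)" using p(2) by simp
      finally show ?thesis by (simp add: field_simps)
    qed
    have "\<forall>q\<in>C. \<exists>R. orthogonal_transformation R \<and> R q = p"
    proof
      fix q assume "q \<in> C"
      then have "norm q = 1" using C(2) by auto
      then show "\<exists>R. orthogonal_transformation R \<and> R q = p"
        using orthogonal_transformation_exists_1[OF _ p(1)] by metis
    qed
    then obtain R where R: "\<And>q. q \<in> C \<Longrightarrow> orthogonal_transformation (R q)" "\<And>q. q \<in> C \<Longrightarrow> R q q = p"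
      by metis
    define Ws where "Ws = concat (map (\<lambda>q. map (\<lambda>U. U \<circ> R q) Us) qs)"
    have Ws: "Ws \<in> Adm"
      using Us_orth R(1) N L unfolding Ws_def Adm_def N_def L_def qs[symmetric]
      by (auto intro: orthogonal_transformation_compose)
    have lenW: "real (length Ws) = N * L"
      by (simp add: Ws_def length_concat o_def sum_list_triv N_def L_def)
    define b' where "b' = ((real N - 1) * (s + \<delta>) + (s + m) / 2) / N"
    have "(\<Sum>W\<leftarrow>Ws. f (W v)) \<le> length Ws * b'" if v: "norm v = 1" for v
    proof -
      obtain q where q: "q \<in> C" "dist v q < r"
        using C(3) v by (auto simp: dist_commute)
      have Rv: "norm (R q' v) = 1" if "q' \<in> C" for q'
        using orthogonal_transformation_norm[OF R(1)[OF that]] v by simp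
      have "dist (R q v) p = dist v q"
        using orthogonal_transformation_norm[OF R(1)[OF q(1)], of "v - q"]
        by (simp add: dist_norm R(2)[OF q(1)] linear_diff[OF orthogonal_transformation_linear[OF R(1)[OF q(1)]]])
      then have "(\<Sum>U\<leftarrow>Us. f (U (R q v))) \<le> L * ((s + m) / 2)"
        using q by (intro near Rv) auto
      then have "(\<Sum>q\<leftarrow>qs. \<Sum>U\<leftarrow>Us. f (U (R q v))) \<le> (real (length qs) - 1) * (L * (s + \<delta>)) + L * ((s + m) / 2)"
        using q(1) qs by (intro sum_list_le_with_one_smaller[of q] Us_le Rv) auto
      also have "\<dots> = length Ws * b'"
        using N by (simp add: lenW b'_def N_def[symmetric] field_simps)
      also have "(\<Sum>q\<leftarrow>qs. \<Sum>U\<leftarrow>Us. f (U (R q v))) = (\<Sum>W\<leftarrow>Ws. f (W v))"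
        unfolding Ws_def by (induction qs) (auto simp: o_def)
      finally show ?thesis .
    qed
    then have "b' \<in> B" using Ws unfolding B_def by blast
    then have "s \<le> b'" unfolding s_def using B_bdd by (rule cInf_lower)
    moreover have "N * b' = N * s + (N - 1) * \<delta> - (s - m) / 2"
      using N by (simp add: b'_def field_simps of_nat_diff)
    moreover have "(real N - 1) * \<delta> < (s - m) / 2"
    proof -
      have "(real N - 1) * \<delta> \<le> real N * \<delta>" using \<delta> by simp
      also have "\<dots> = (s - m) / 4" using N by (simp add: \<delta>_def field_simps)
      finally show ?thesis using sm by simp
    qed
    ultimately have "N * b' < N * s" using N by (simp add: of_nat_diff)
    then show False using \<open>s \<le> b'\<close> N by simp
  qed
  then obtain b where "b \<in> B" "b < c"
    using cInf_lessD[OF B_ne, of c] c by (auto simp: s_def m_def)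
  then obtain Us where Us: "Us \<in> Adm" "\<And>v. norm v = 1 \<Longrightarrow> (\<Sum>U\<leftarrow>Us. f (U v)) \<le> length Us * b"
    by (auto simp: B_def)
  show thesis
  proof (rule that[of Us])
    show "(\<Sum>U\<leftarrow>Us. f (U v)) \<le> length Us * c" if "norm v = 1" for v
      using Us(2)[OF that] mult_left_mono[of b c "real (length Us)"] \<open>b < c\<close> by linarith
  qed (use Us(1) in \<open>auto simp: Adm_def\<close>)
qed

section \<open>Moments of functions on the sphere\<close>

definition diagonal_form :: "real^'n \<Rightarrow> real^'n \<Rightarrow> real" where
  "diagonal_form a x = (\<Sum>i\<in>UNIV. a $ i * (x $ i)\<^sup>2)"

lemma diagonal_form_scaleR: "diagonal_form a (c *\<^sub>R x) = c\<^sup>2 * diagonal_form a x"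
  by (simp add: diagonal_form_def sum_distrib_left power_mult_distrib mult.left_commute)

lemma continuous_on_diagonal_form [continuous_intros]:
  "continuous_on S f \<Longrightarrow> continuous_on S (\<lambda>x. diagonal_form a (f x))"
  unfolding diagonal_form_def by (intro continuous_intros)

lemma diagonal_form_add_axis:
  "diagonal_form a (x + axis i 1) = diagonal_form a x + 2 * a $ i * x $ i + a $ i"
proof -
  have "a $ j * ((x + axis i 1) $ j)\<^sup>2
      = a $ j * (x $ j)\<^sup>2 + (if j = i then 2 * a $ i * x $ i + a $ i else 0)" for j
    by (simp add: axis_def power2_sum algebra_simps)
  then show ?thesis by (simp add: diagonal_form_def sum.distrib)
qed

text \<open>After a translation by the \<open>i\<close>-th unit vector, where \<open>a $ i \<noteq> 0\<close>, the origin is off the quadric and each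
ray from it meets the quadric in at most two points, the roots of a quadratic polynomial. The product of the two
roots is \<open>a $ i / diagonal_form a x\<close>, so the sets where \<open>diagonal_form a x / a $ i\<close> is at least,
respectively at most, \<open>1\<close> meet each ray at most once.\<close>

lemma negligible_diagonal_form_zeros:
  fixes a :: "real^'n"
  assumes "a \<noteq> 0"
  shows "negligible {x. diagonal_form a x = 0}"
proof -
  obtain i where ai: "a $ i \<noteq> 0" using assms by (auto simp: vec_eq_iff)
  let ?e = "axis i 1 :: real^'n"
  let ?S = "{x. diagonal_form a (x + ?e) = 0}"
  let ?S1 = "?S \<inter> {x. 1 \<le> diagonal_form a x / a $ i}"
  let ?S2 = "?S \<inter> {x. diagonal_form a x / a $ i \<le> 1}"
  have other_root: "c * (diagonal_form a x / a $ i) = 1"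
    if "x \<in> ?S" "c *\<^sub>R x \<in> ?S" "c \<noteq> 1" for c x
  proof -
    let ?q = "diagonal_form a x"
    have 1: "?q + 2 * a $ i * x $ i + a $ i = 0"
      using that(1) by (simp add: diagonal_form_add_axis)
    have 2: "c\<^sup>2 * ?q + 2 * a $ i * (c * x $ i) + a $ i = 0"
      using that(2) by (simp add: diagonal_form_add_axis diagonal_form_scaleR)
    have "(c - 1) * (c * ?q - a $ i)
        = (c\<^sup>2 * ?q + 2 * a $ i * (c * x $ i) + a $ i) - c * (?q + 2 * a $ i * x $ i + a $ i)"
      by (simp add: algebra_simps power2_eq_square)
    then have "(c - 1) * (c * ?q - a $ i) = 0" unfolding 1 2 by simp
    then show ?thesis using that(3) ai by simp
  qed
  have closed: "closed ?S1" "closed ?S2"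
    by (intro closed_Int closed_Collect_eq closed_Collect_le continuous_intros; simp add: ai)+
  have "negligible ?S1"
  proof (rule starlike_negligible[OF closed(1), of 0])
    fix c :: real and x assume *: "0 + c *\<^sub>R x \<in> ?S1" "0 \<le> c" "0 + x \<in> ?S1"
    show "c = 1"
    proof (rule ccontr)
      assume "c \<noteq> 1"
      then have r: "c * (diagonal_form a x / a $ i) = 1" using * by (intro other_root) auto
      have "1 \<le> diagonal_form a x / a $ i" "1 \<le> c * (c * (diagonal_form a x / a $ i))"
        using * by (auto simp: diagonal_form_scaleR power2_eq_square)
      moreover from mult_left_mono[OF this(1) *(2)] have "c \<le> 1" unfolding r by simp
      ultimately have "c = 1" unfolding r by simp
      with \<open>c \<noteq> 1\<close> show False by simp
    qed
  qed
  moreover have "negligible ?S2"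
  proof (rule starlike_negligible[OF closed(2), of 0])
    fix c :: real and x assume *: "0 + c *\<^sub>R x \<in> ?S2" "0 \<le> c" "0 + x \<in> ?S2"
    show "c = 1"
    proof (rule ccontr)
      assume "c \<noteq> 1"
      then have r: "c * (diagonal_form a x / a $ i) = 1" using * by (intro other_root) auto
      have "diagonal_form a x / a $ i \<le> 1" "c * (c * (diagonal_form a x / a $ i)) \<le> 1"
        using * by (auto simp: diagonal_form_scaleR power2_eq_square)
      moreover from mult_left_mono[OF this(1) *(2)] have "1 \<le> c" unfolding r by simp
      ultimately have "c = 1" unfolding r by simp
      with \<open>c \<noteq> 1\<close> show False by simp
    qed
  qed
  ultimately have "negligible (?S1 \<union> ?S2)" by (rule negligible_Un)
  then have "negligible ?S" by (rule negligible_subset) auto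
  then have "negligible ((+) ?e ` ?S)" by (rule negligible_translation)
  moreover have "(+) ?e ` ?S = {x. diagonal_form a x = 0}"
    by (auto simp: image_iff add.commute intro!: exI[of _ "x - ?e" for x])
  ultimately show ?thesis by simp
qed

lemma AE_sphere_measureI:
  assumes "AE x in lborel. P (sgn x)" "{x. P x} \<in> sets borel"
  shows "AE x in (sphere_measure :: 'a::euclidean_space measure). P x"
proof -
  let ?u = "uniform_measure lborel (ball (0::'a) 1)"
  have "AE x in ?u. P (sgn x)"
    using assms(1) by (intro AE_uniform_measureI) auto
  then have "AE x in distr ?u borel sgn. P x"
    using assms(2) by (subst AE_distr_iff) auto
  then show ?thesis
    unfolding sphere_measure_def by (subst AE_restrict_space_iff) auto
qed

lemma AE_sphere_diagonal_form_nonzero: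
  fixes a :: "real^'n"
  assumes "a \<noteq> 0"
  shows "AE x in sphere_measure. diagonal_form a x \<noteq> 0"
proof (rule AE_sphere_measureI)
  have closed: "closed {x. diagonal_form a x = 0}"
    by (intro closed_Collect_eq continuous_intros)
  have "{x. diagonal_form a x = 0} \<in> null_sets lborel"
    using negligible_diagonal_form_zeros[OF assms] closed
    by (simp add: negligible_iff_null_sets null_sets_completion_iff)
  then have "AE x in lborel. diagonal_form a x \<noteq> 0"
    by (rule AE_I') auto
  moreover have "AE x in lborel. x \<noteq> (0::real^'n)" by (rule AE_lborel_singleton)
  ultimately show "AE x in lborel. diagonal_form a (sgn x) \<noteq> 0"
    by eventually_elim (simp add: sgn_div_norm diagonal_form_scaleR)
  have "{x. diagonal_form a x \<noteq> 0} = - {x. diagonal_form a x = 0}" by auto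
  then show "{x. diagonal_form a x \<noteq> 0} \<in> sets borel" using closed by simp
qed

definition reflect :: "'n \<Rightarrow> real^'n \<Rightarrow> real^'n" where
  "reflect i x = (\<chi> j. if j = i then - x $ j else x $ j)"

lemma orthogonal_transformation_reflect: "orthogonal_transformation (reflect i)"
  unfolding orthogonal_transformation_def reflect_def
  by (auto intro!: linearI sum.cong simp: vec_eq_iff inner_vec_def)

lemma orthogonal_transformation_permute:
  assumes "p permutes UNIV"
  shows "orthogonal_transformation (\<lambda>x::real^'n. \<chi> k. x $ p k)"
  unfolding orthogonal_transformation_def
proof (intro conjI allI linearI)
  fix v w :: "real^'n"
  show "(\<chi> k. v $ p k) \<bullet> (\<chi> k. w $ p k) = v \<bullet> w"
    using sum.permute[OF assms, of "\<lambda>k. v $ k * w $ k"] by (simp add: inner_vec_def o_def)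
qed (simp_all add: vec_eq_iff)

lemma sphere_coordinate_bounded_measurable:
  "(\<lambda>x::real^'n. x $ i) \<in> bounded_measurable sphere_measure"
proof (rule bounded_measurableI[of _ _ 1])
  show "(\<lambda>x::real^'n. x $ i) \<in> borel_measurable sphere_measure"
    by (intro borel_measurable_sphere_continuous continuous_intros)
  show "\<bar>x $ i\<bar> \<le> 1" if "x \<in> space sphere_measure" for x :: "real^'n"
    using that component_le_norm_cart[of x i] by simp
qed

lemma finite_measure_sphere: "finite_measure (sphere_measure :: 'a::euclidean_space measure)"
  by (rule prob_space.finite_measure[OF prob_space_sphere_measure])

text \<open>Evenness in every coordinate makes the mixed moments vanish.\<close>

definition even_multipliers :: "(real^'n \<Rightarrow> real) set" where
  "even_multipliers = {f \<in> contractive_multipliers sphere_measure. \<forall>i x. f (reflect i x) = f x}"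

lemma even_multiplier_bounded_measurable:
  "f \<in> even_multipliers \<Longrightarrow> f \<in> bounded_measurable sphere_measure"
  by (rule bounded_measurableI[of _ _ 1]) (auto simp: even_multipliers_def contractive_multipliers_def)

lemma even_multiplier_off_diagonal:
  fixes f :: "real^'n \<Rightarrow> real"
  assumes f: "f \<in> even_multipliers" and "i \<noteq> j"
  shows "(LINT x|sphere_measure. f x * (x $ i * x $ j)) = 0"
proof -
  let ?g = "\<lambda>x::real^'n. f x * (x $ i * x $ j)"
  have "?g \<in> borel_measurable sphere_measure"
    by (intro bounded_measurableD bounded_measurable_mult even_multiplier_bounded_measurable[OF f]
        sphere_coordinate_bounded_measurable)
  then have "(LINT x|sphere_measure. ?g (reflect i x)) = (LINT x|sphere_measure. ?g x)"
    by (rule sphere_integral_orthogonal[OF orthogonal_transformation_reflect])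
  moreover have "?g (reflect i x) = - ?g x" for x
    using f \<open>i \<noteq> j\<close> by (simp add: even_multipliers_def) (simp add: reflect_def)
  ultimately show ?thesis by simp
qed

text \<open>All \<open>\<integral> \<xi>\<^sub>i\<^sup>2 d\<sigma>\<close> agree, since the coordinates can be permuted, and they sum to \<open>1\<close>.\<close>

lemma sphere_second_moments:
  "(LINT x::real^'n|sphere_measure. x $ i * x $ j) = (if i = j then 1 / CARD('n) else 0)"
proof (cases "i = j")
  case True
  interpret prob_space "sphere_measure :: (real^'n) measure" by (rule prob_space_sphere_measure)
  let ?m = "\<lambda>k::'n. LINT x::real^'n|sphere_measure. x $ k * x $ k"
  have bm: "(\<lambda>x::real^'n. x $ k * x $ k) \<in> bounded_measurable sphere_measure" for k
    by (intro bounded_measurable_mult sphere_coordinate_bounded_measurable)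
  have "?m k = ?m i" for k
    using sphere_integral_orthogonal[OF orthogonal_transformation_permute[OF permutes_swap_id[of i UNIV k]]
        bounded_measurableD[OF bm[of i]]]
    by simp
  then have "(\<Sum>k\<in>UNIV. ?m k) = (\<Sum>k\<in>(UNIV :: 'n set). ?m i)" by (intro sum.cong refl)
  then have "real CARD('n) * ?m i = (\<Sum>k\<in>UNIV. ?m k)" by simp
  also have "\<dots> = (LINT x::real^'n|sphere_measure. (\<Sum>k\<in>UNIV. x $ k * x $ k))"
    by (intro Bochner_Integration.integral_sum[symmetric] integrable_bounded_measurable bm)
  also have "\<dots> = (LINT x|(sphere_measure :: (real^'n) measure). 1)"
  proof (intro Bochner_Integration.integral_cong refl)
    fix x :: "real^'n" assume "x \<in> space sphere_measure"
    then have "x \<bullet> x = 1" by (simp add: norm_eq_1)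
    then show "(\<Sum>k\<in>UNIV. x $ k * x $ k) = 1" by (simp add: inner_vec_def)
  qed
  finally show ?thesis using True prob_space by (simp add: field_simps)
next
  case False
  have "(\<lambda>_. 1) \<in> (even_multipliers :: (real^'n \<Rightarrow> real) set)"
    by (simp add: even_multipliers_def contractive_multipliers_def)
  from even_multiplier_off_diagonal[OF this False] False show ?thesis by simp
qed

lemma sphere_mean_diagonal_form: "sphere_mean a = (LINT x|sphere_measure. \<bar>diagonal_form a x\<bar>)"
  by (simp add: sphere_mean_def diagonal_form_def)

text \<open>The definition of the constant, made homogeneous in \<open>a\<close>.\<close>

lemma sphere_mean_ge:
  fixes a :: "real^'n"
  shows "(\<Sum>i\<in>UNIV. \<bar>a $ i\<bar>) * (1 / vartheta TYPE('n)) \<le> CARD('n) * sphere_mean a"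
proof (cases "a = 0")
  case True
  then show ?thesis by (simp add: sphere_mean_def)
next
  case False
  let ?s = "\<Sum>i\<in>UNIV. \<bar>a $ i\<bar>" and ?d = "real CARD('n)"
  have "?s > 0"
    using False by (auto simp: vec_eq_iff intro!: sum_pos2)
  then have "(?d / ?s) *\<^sub>R a \<in> cross_sphere"
    by (simp add: cross_sphere_def abs_mult flip: sum_divide_distrib sum_distrib_left)
  then have "1 / vartheta TYPE('n) \<le> sphere_mean ((?d / ?s) *\<^sub>R a)"
    using vartheta_minimum[where 'n='n] by auto
  also have "\<dots> = (LINT x|sphere_measure. \<bar>?d / ?s\<bar> * \<bar>diagonal_form a x\<bar>)"
    unfolding sphere_mean_diagonal_form abs_mult[symmetric]
    by (simp add: diagonal_form_def sum_distrib_left mult.assoc)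
  also have "\<dots> = ?d / ?s * sphere_mean a"
    using \<open>?s > 0\<close> by (simp add: sphere_mean_diagonal_form)
  finally show ?thesis using \<open>?s > 0\<close> by (simp add: field_simps)
qed

text \<open>The diagonal of the compression of multiplication by an even \<open>f\<close>.\<close>

definition diagonal_moments :: "(real^'n \<Rightarrow> real) \<Rightarrow> real^'n" where
  "diagonal_moments f = (\<chi> i. CARD('n) * (LINT x|sphere_measure. f x * (x $ i)\<^sup>2))"

lemma sphere_integrable:
  "h \<in> bounded_measurable sphere_measure \<Longrightarrow> integrable (sphere_measure :: 'a::euclidean_space measure) h"
  by (rule finite_measure.integrable_bounded_measurable[OF finite_measure_sphere])

lemma even_multiplier_square_bounded_measurable:
  "f \<in> even_multipliers \<Longrightarrow> (\<lambda>x. f x * (x $ i)\<^sup>2) \<in> bounded_measurable sphere_measure"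
  unfolding power2_eq_square
  by (intro bounded_measurable_mult even_multiplier_bounded_measurable sphere_coordinate_bounded_measurable)

lemma inner_diagonal_moments:
  fixes a :: "real^'n"
  assumes f: "f \<in> even_multipliers"
  shows "a \<bullet> diagonal_moments f = CARD('n) * (LINT x|sphere_measure. f x * diagonal_form a x)"
proof -
  have "(LINT x|sphere_measure. f x * diagonal_form a x)
      = (LINT x|sphere_measure. (\<Sum>i\<in>UNIV. a $ i * (f x * (x $ i)\<^sup>2)))"
    by (simp add: diagonal_form_def sum_distrib_left mult.left_commute)
  also have "\<dots> = (\<Sum>i\<in>UNIV. LINT x|sphere_measure. a $ i * (f x * (x $ i)\<^sup>2))"
    by (intro Bochner_Integration.integral_sum sphere_integrable bounded_measurable_cmult
        even_multiplier_square_bounded_measurable f)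
  also have "\<dots> = (\<Sum>i\<in>UNIV. a $ i * (LINT x|sphere_measure. f x * (x $ i)\<^sup>2))" by simp
  finally show ?thesis
    by (simp add: diagonal_moments_def inner_vec_def sum_distrib_left mult.left_commute)
qed

lemma diagonal_form_bounded_measurable:
  "diagonal_form a \<in> bounded_measurable (sphere_measure :: (real^'n) measure)"
  unfolding diagonal_form_def[abs_def] power2_eq_square
  by (intro bounded_measurable_sum bounded_measurable_cmult bounded_measurable_mult
      sphere_coordinate_bounded_measurable)

lemma sgn_diagonal_form_even_multiplier: "(\<lambda>x. sgn (diagonal_form a x)) \<in> even_multipliers"
proof -
  have [measurable]: "diagonal_form a \<in> borel_measurable sphere_measure"
    by (rule bounded_measurableD[OF diagonal_form_bounded_measurable])
  have "diagonal_form a (reflect i x) = diagonal_form a x" for i x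
    unfolding diagonal_form_def reflect_def by (intro sum.cong) auto
  moreover have "(\<lambda>x. sgn (diagonal_form a x)) \<in> borel_measurable sphere_measure" by measurable
  ultimately show ?thesis
    by (simp add: even_multipliers_def contractive_multipliers_def sgn_real_def)
qed

lemma inner_diagonal_moments_sgn:
  fixes a :: "real^'n"
  shows "a \<bullet> diagonal_moments (\<lambda>x. sgn (diagonal_form a x)) = CARD('n) * sphere_mean a"
  by (simp add: inner_diagonal_moments[OF sgn_diagonal_form_even_multiplier]
      sphere_mean_diagonal_form sgn_mult_self_eq abs_sgn[symmetric] mult.commute[of "sgn _"])


lemma convex_diagonal_moments: "convex (diagonal_moments ` (even_multipliers :: (real^'n \<Rightarrow> real) set))"
proof (rule convexI, clarify)
  fix f g :: "real^'n \<Rightarrow> real" and u v :: real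
  assume f: "f \<in> even_multipliers" and g: "g \<in> even_multipliers"
    and uv: "0 \<le> u" "0 \<le> v" "u + v = 1"
  let ?h = "\<lambda>x. u * f x + v * g x"
  have "?h \<in> bounded_measurable sphere_measure"
    by (intro bounded_measurable_add bounded_measurable_cmult even_multiplier_bounded_measurable f g)
  moreover have "\<bar>?h x\<bar> \<le> 1" if "norm x = 1" for x
  proof -
    have fg: "\<bar>f x\<bar> \<le> 1" "\<bar>g x\<bar> \<le> 1"
      using f g that by (auto simp: even_multipliers_def contractive_multipliers_def)
    have "\<bar>?h x\<bar> \<le> u * \<bar>f x\<bar> + v * \<bar>g x\<bar>"
      using abs_triangle_ineq[of "u * f x" "v * g x"] uv by (simp add: abs_mult)
    also have "\<dots> \<le> u * 1 + v * 1" using fg uv by (intro add_mono mult_left_mono)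
    finally show ?thesis using uv by simp
  qed
  ultimately have h: "?h \<in> even_multipliers"
    using f g by (auto simp: even_multipliers_def contractive_multipliers_def dest: bounded_measurableD)
  have eq: "u *\<^sub>R diagonal_moments f + v *\<^sub>R diagonal_moments g = diagonal_moments ?h"
  proof (simp add: vec_eq_iff diagonal_moments_def, intro allI)
    fix i
    have "(LINT x|sphere_measure. ?h x * (x $ i)\<^sup>2)
        = (LINT x|sphere_measure. u * (f x * (x $ i)\<^sup>2) + v * (g x * (x $ i)\<^sup>2))"
      by (simp add: algebra_simps)
    also have "\<dots> = u * (LINT x|sphere_measure. f x * (x $ i)\<^sup>2) + v * (LINT x|sphere_measure. g x * (x $ i)\<^sup>2)"
      by (subst Bochner_Integration.integral_add)
        (auto intro!: sphere_integrable bounded_measurable_cmult even_multiplier_square_bounded_measurable f g)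
    finally show "u * (CARD('n) * (LINT x|sphere_measure. f x * (x $ i)\<^sup>2))
        + v * (CARD('n) * (LINT x|sphere_measure. g x * (x $ i)\<^sup>2))
        = CARD('n) * (LINT x|sphere_measure. ?h x * (x $ i)\<^sup>2)"
      by (simp add: distrib_left mult.left_commute)
  qed
  show "u *\<^sub>R diagonal_moments f + v *\<^sub>R diagonal_moments g
      \<in> diagonal_moments ` even_multipliers"
    unfolding eq using h by (rule imageI)
qed

text \<open>If \<open>y\<close> is the limit of the moments of \<open>f\<^sub>n\<close> and maximises \<open>a\<close>, then \<open>\<integral> \<bar>q\<bar> \<bar>sgn q - f\<^sub>n\<bar> d\<sigma>\<close> tends to \<open>0\<close>, because
\<open>\<bar>q\<bar> \<bar>sgn q - f\<bar> = \<bar>q\<bar> - f q\<close> for \<open>\<bar>f\<bar> \<le> 1\<close>. The weight \<open>\<bar>q\<bar>\<close> can be dropped: with \<open>h\<^sub>k = max 0 (1 - k \<bar>q\<bar>)\<close> one has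
\<open>\<bar>sgn q - f\<bar> \<le> 2 h\<^sub>k + k \<bar>q\<bar> \<bar>sgn q - f\<bar>\<close>, and \<open>\<integral> h\<^sub>k d\<sigma>\<close> tends to \<open>0\<close> because \<open>q\<close> vanishes on a null set
only.\<close>

lemma exposed_diagonal_moment:
  fixes a y :: "real^'n"
  assumes a: "a \<noteq> 0"
    and y: "y \<in> closure (diagonal_moments ` even_multipliers)"
    and max: "CARD('n) * sphere_mean a \<le> a \<bullet> y"
  shows "y = diagonal_moments (\<lambda>x. sgn (diagonal_form a x))"
proof -
  interpret prob_space "sphere_measure :: (real^'n) measure" by (rule prob_space_sphere_measure)
  let ?q = "diagonal_form a" and ?d = "real CARD('n)"
  let ?s = "\<lambda>x. sgn (?q x)"
  have s: "?s \<in> even_multipliers" by (rule sgn_diagonal_form_even_multiplier)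
  obtain m where m: "\<And>n. m n \<in> diagonal_moments ` even_multipliers" "m \<longlonglongrightarrow> y"
    using y by (auto simp: closure_sequential)
  then have "\<forall>n. \<exists>f. f \<in> even_multipliers \<and> m n = diagonal_moments f" by blast
  then obtain f where f: "\<And>n. f n \<in> even_multipliers" "\<And>n. m n = diagonal_moments (f n)"
    by metis
  have q_bm: "?q \<in> bounded_measurable sphere_measure" by (rule diagonal_form_bounded_measurable)
  have bm: "f n \<in> bounded_measurable sphere_measure" "?s \<in> bounded_measurable sphere_measure" for n
    by (intro even_multiplier_bounded_measurable f s)+
  have abs_bm: "(\<lambda>x. \<bar>h x\<bar>) \<in> bounded_measurable M" if "h \<in> bounded_measurable M" for h and M :: "(real^'n) measure"
    using that by (auto simp: bounded_measurable_def)
  have f1: "\<bar>f n x\<bar> \<le> 1" if "norm x = 1" for n x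
    using f(1)[of n] that by (auto simp: even_multipliers_def contractive_multipliers_def)
  define D where "D n x = \<bar>?s x - f n x\<bar>" for n x
  have D_bm: "D n \<in> bounded_measurable sphere_measure" for n
    unfolding D_def by (intro abs_bm bounded_measurable_diff bm)
  define E where "E n = (LINT x|sphere_measure. \<bar>?q x\<bar> * D n x)" for n
  have E_eq: "?d * E n = ?d * sphere_mean a - a \<bullet> m n" for n
  proof -
    have "E n = (LINT x|sphere_measure. \<bar>?q x\<bar> - f n x * ?q x)"
      unfolding E_def
    proof (intro Bochner_Integration.integral_cong refl)
      fix x :: "real^'n" assume "x \<in> space sphere_measure"
      then have "\<bar>f n x\<bar> \<le> 1" using f1 by simp
      then show "\<bar>?q x\<bar> * D n x = \<bar>?q x\<bar> - f n x * ?q x"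
        by (cases "?q x" "0::real" rule: linorder_cases)
          (auto simp: D_def algebra_simps abs_le_iff)
    qed
    also have "\<dots> = sphere_mean a - (LINT x|sphere_measure. f n x * ?q x)"
      unfolding sphere_mean_diagonal_form
      by (intro Bochner_Integration.integral_diff sphere_integrable abs_bm bounded_measurable_mult bm q_bm)
    finally show ?thesis by (simp add: f(2) inner_diagonal_moments f(1) right_diff_distrib)
  qed
  have "(\<lambda>n. ?d * sphere_mean a - a \<bullet> m n) \<longlonglongrightarrow> ?d * sphere_mean a - a \<bullet> y"
    by (intro tendsto_intros m)
  moreover have "0 \<le> ?d * sphere_mean a - a \<bullet> m n" for n
    unfolding E_eq[symmetric] E_def D_def by (intro mult_nonneg_nonneg Bochner_Integration.integral_nonneg) auto
  ultimately have "0 \<le> ?d * sphere_mean a - a \<bullet> y" by (intro LIMSEQ_le_const) auto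
  with max have ay: "?d * sphere_mean a - a \<bullet> y = 0" by simp
  have "(\<lambda>n. ?d * E n) \<longlonglongrightarrow> 0"
    unfolding E_eq ay[symmetric] by (intro tendsto_intros m)
  then have "(\<lambda>n. (1 / ?d) * (?d * E n)) \<longlonglongrightarrow> (1 / ?d) * 0" by (intro tendsto_intros)
  then have E_lim: "E \<longlonglongrightarrow> 0" by simp
  define h where "h k x = max 0 (1 - real k * \<bar>?q x\<bar>)" for k x
  define H where "H k = (LINT x|sphere_measure. h k x)" for k
  have q_meas [measurable]: "?q \<in> borel_measurable sphere_measure" by (rule bounded_measurableD[OF q_bm])
  have h_bm: "h k \<in> bounded_measurable sphere_measure" for k
  proof (rule bounded_measurableI[of _ _ 1])
    show "h k \<in> borel_measurable sphere_measure" unfolding h_def[abs_def] by measurable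
  qed (auto simp: h_def)
  have "H \<longlonglongrightarrow> (LINT x|(sphere_measure :: (real^'n) measure). 0)"
    unfolding H_def
  proof (rule integral_dominated_convergence[where w = "\<lambda>_. 1"])
    show "AE x in sphere_measure. (\<lambda>k. h k x) \<longlonglongrightarrow> 0"
      using AE_sphere_diagonal_form_nonzero[OF a]
    proof eventually_elim
      fix x assume "?q x \<noteq> 0"
      then have q: "\<bar>?q x\<bar> > 0" by simp
      obtain K where K: "1 < real K * \<bar>?q x\<bar>" using ex_less_of_nat_mult[OF q] by blast
      have "h k x = 0" if "k \<ge> K" for k
      proof -
        have "real K * \<bar>?q x\<bar> \<le> real k * \<bar>?q x\<bar>" using that by (intro mult_right_mono) auto
        then show ?thesis using K by (simp add: h_def)
      qed
      then have "\<forall>\<^sub>F k in sequentially. h k x = 0" unfolding eventually_sequentially by blast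
      then show "(\<lambda>k. h k x) \<longlonglongrightarrow> 0" by (rule tendsto_eventually)
    qed
  qed (use h_bm[THEN bounded_measurableD] in \<open>auto simp: h_def\<close>)
  then have H_lim: "H \<longlonglongrightarrow> 0" by simp
  have moment_bound: "\<bar>m n $ i - diagonal_moments ?s $ i\<bar> \<le> ?d * (2 * H k + real k * E n)" for n i k
  proof -
    let ?c = "\<lambda>x::real^'n. (x $ i)\<^sup>2"
    have c1: "?c x \<le> 1" if "norm x = 1" for x
      using component_le_norm_cart[of x i] that by (simp add: abs_square_le_1)
    have D_le: "D n x \<le> 2 * h k x + real k * (\<bar>?q x\<bar> * D n x)" if "norm x = 1" for x
    proof -
      have D2: "0 \<le> D n x" "D n x \<le> 2"
        using f1[OF that, of n] by (auto simp: D_def sgn_real_def)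
      have "D n x * (1 - real k * \<bar>?q x\<bar>) \<le> D n x * h k x"
        using D2 by (intro mult_left_mono) (auto simp: h_def)
      also have "\<dots> \<le> 2 * h k x" using D2 by (intro mult_right_mono) (auto simp: h_def)
      finally show ?thesis by (simp add: algebra_simps)
    qed
    have int: "integrable sphere_measure (\<lambda>x. f n x * ?c x)" "integrable sphere_measure (\<lambda>x. ?s x * ?c x)"
      by (intro sphere_integrable even_multiplier_square_bounded_measurable f s)+
    have "m n $ i - diagonal_moments ?s $ i = ?d * (LINT x|sphere_measure. f n x * ?c x - ?s x * ?c x)"
      by (simp add: f(2) diagonal_moments_def Bochner_Integration.integral_diff int right_diff_distrib)
    then have "\<bar>m n $ i - diagonal_moments ?s $ i\<bar> = ?d * \<bar>LINT x|sphere_measure. f n x * ?c x - ?s x * ?c x\<bar>"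
      by (simp add: abs_mult)
    also have "\<bar>LINT x|sphere_measure. f n x * ?c x - ?s x * ?c x\<bar>
        \<le> (LINT x|sphere_measure. \<bar>f n x * ?c x - ?s x * ?c x\<bar>)"
      by (rule integral_abs_bound)
    also have "\<dots> \<le> (LINT x|sphere_measure. 2 * h k x + real k * (\<bar>?q x\<bar> * D n x))"
    proof (rule integral_mono)
      show "integrable sphere_measure (\<lambda>x. \<bar>f n x * ?c x - ?s x * ?c x\<bar>)" using int by auto
      show "integrable sphere_measure (\<lambda>x. 2 * h k x + real k * (\<bar>?q x\<bar> * D n x))"
        by (intro sphere_integrable bounded_measurable_add bounded_measurable_cmult
            bounded_measurable_mult abs_bm q_bm D_bm h_bm)
      fix x :: "real^'n" assume "x \<in> space sphere_measure"
      then have x: "norm x = 1" by simp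
      have "\<bar>f n x * ?c x - ?s x * ?c x\<bar> = D n x * ?c x"
        by (simp add: D_def abs_mult abs_minus_commute flip: left_diff_distrib)
      also have "\<dots> \<le> D n x * 1" using c1[OF x] by (intro mult_left_mono) (auto simp: D_def)
      finally show "\<bar>f n x * ?c x - ?s x * ?c x\<bar> \<le> 2 * h k x + real k * (\<bar>?q x\<bar> * D n x)"
        using D_le[OF x] by simp
    qed
    also have "\<dots> = 2 * H k + real k * E n"
      unfolding H_def E_def
      by (subst Bochner_Integration.integral_add)
        (auto intro!: sphere_integrable bounded_measurable_cmult bounded_measurable_mult abs_bm q_bm D_bm h_bm)
    finally show ?thesis by (simp add: mult_left_mono)
  qed
  have "\<bar>y $ i - diagonal_moments ?s $ i\<bar> \<le> ?d * (2 * H k)" for i k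
  proof (rule LIMSEQ_le)
    show "(\<lambda>n. \<bar>m n $ i - diagonal_moments ?s $ i\<bar>) \<longlonglongrightarrow> \<bar>y $ i - diagonal_moments ?s $ i\<bar>"
      by (intro tendsto_intros m)
    have "(\<lambda>n. ?d * (2 * H k + real k * E n)) \<longlonglongrightarrow> ?d * (2 * H k + real k * 0)"
      by (intro tendsto_intros E_lim)
    then show "(\<lambda>n. ?d * (2 * H k + real k * E n)) \<longlonglongrightarrow> ?d * (2 * H k)" by simp
  qed (use moment_bound in blast)
  note le = this
  have lim: "(\<lambda>k. ?d * (2 * H k)) \<longlonglongrightarrow> ?d * (2 * 0)" by (intro tendsto_intros H_lim)
  have "\<bar>y $ i - diagonal_moments ?s $ i\<bar> \<le> ?d * (2 * 0)" for i
    by (rule LIMSEQ_le_const[OF lim]) (use le in blast)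
  then show ?thesis by (simp add: vec_eq_iff)
qed

text \<open>A point \<open>y\<close> of the cube that is not in the convex set of moments can still be separated weakly from it by some \<open>a\<close>.
Since \<open>a \<bullet> y\<close> does not exceed the support function of the set, \<open>y\<close> maximises \<open>a\<close> over the closure, to which it
belongs by strict separation, and \<open>exposed_diagonal_moment\<close> puts it into the set.\<close>

lemma cube_subset_diagonal_moments:
  fixes y :: "real^'n"
  assumes y: "\<And>i. \<bar>y $ i\<bar> \<le> 1 / vartheta TYPE('n)"
  shows "\<exists>f\<in>even_multipliers. diagonal_moments f = y"
proof (rule ccontr)
  assume neg: "\<not> ?thesis"
  let ?C = "diagonal_moments ` (even_multipliers :: (real^'n \<Rightarrow> real) set)"
  let ?f = "\<lambda>a x. sgn (diagonal_form (a::real^'n) x)"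
  have notin: "y \<notin> ?C" using neg by auto
  have support: "a \<bullet> y \<le> CARD('n) * sphere_mean a" for a
  proof -
    have "a \<bullet> y \<le> (\<Sum>i\<in>UNIV. \<bar>a $ i\<bar> * (1 / vartheta TYPE('n)))"
      unfolding inner_vec_def
    proof (intro sum_mono)
      fix i
      have "a $ i * y $ i \<le> \<bar>a $ i\<bar> * \<bar>y $ i\<bar>" by (metis abs_ge_self abs_mult)
      also have "\<dots> \<le> \<bar>a $ i\<bar> * (1 / vartheta TYPE('n))" using y by (intro mult_left_mono) auto
      finally show "a $ i \<bullet> y $ i \<le> \<bar>a $ i\<bar> * (1 / vartheta TYPE('n))" by simp
    qed
    also have "\<dots> \<le> CARD('n) * sphere_mean a"
      using sphere_mean_ge[of a] by (simp add: sum_divide_distrib)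
    finally show ?thesis .
  qed
  have attained: "diagonal_moments (?f a) \<in> ?C" for a
    by (intro imageI sgn_diagonal_form_even_multiplier)
  have "y \<in> closure ?C"
  proof (rule ccontr)
    assume "y \<notin> closure ?C"
    then obtain a b where ab: "a \<bullet> y < b" "\<And>x. x \<in> closure ?C \<Longrightarrow> b < a \<bullet> x"
      using separating_hyperplane_closed_point[of "closure ?C" y] convex_diagonal_moments
      by (auto intro: convex_closure)
    have "b < a \<bullet> diagonal_moments (?f (- a))"
      using attained closure_subset by (intro ab) blast
    also have "\<dots> = - (CARD('n) * sphere_mean (- a))"
      using inner_diagonal_moments_sgn[of "- a"] by simp
    also have "\<dots> \<le> - ((- a) \<bullet> y)" using support[of "- a"] by linarith
    finally show False using ab(1) by simp
  qed
  moreover have "\<exists>a b. a \<noteq> 0 \<and> (\<forall>x\<in>?C. a \<bullet> x \<le> b) \<and> (\<forall>x\<in>{y}. b \<le> a \<bullet> x)"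
    by (rule separating_hyperplane_sets[OF convex_diagonal_moments convex_singleton])
      (use attained notin in blast)+
  then obtain a b where ab: "a \<noteq> 0" "\<And>x. x \<in> ?C \<Longrightarrow> a \<bullet> x \<le> b" "b \<le> a \<bullet> y"
    by blast
  moreover have "CARD('n) * sphere_mean a \<le> a \<bullet> y"
    using ab(2)[OF attained[of a]] ab(3) by (simp add: inner_diagonal_moments_sgn)
  ultimately have "y = diagonal_moments (?f a)" by (intro exposed_diagonal_moment)
  then show False using attained[of a] notin by simp
qed

section \<open>The universal commuting dilation\<close>

lemma countable_Int_stable_generator:
  assumes "countable G" "G \<subseteq> Pow \<Omega>"
  obtains H where "countable H" "H \<subseteq> Pow \<Omega>" "Int_stable H" "sigma_sets \<Omega> H = sigma_sets \<Omega> G"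
proof
  let ?H = "(\<lambda>F. \<Omega> \<inter> \<Inter>F) ` {F. finite F \<and> F \<subseteq> G}"
  show "countable ?H"
    using assms(1) by (intro countable_image countable_Collect_finite_subset)
  show "?H \<subseteq> Pow \<Omega>" by auto
  show "Int_stable ?H"
  proof (rule Int_stableI_image)
    fix E F assume "E \<in> {F. finite F \<and> F \<subseteq> G}" "F \<in> {F. finite F \<and> F \<subseteq> G}"
    then show "\<exists>D\<in>{F. finite F \<and> F \<subseteq> G}. (\<Omega> \<inter> \<Inter>E) \<inter> (\<Omega> \<inter> \<Inter>F) = \<Omega> \<inter> \<Inter>D"
      by (intro bexI[of _ "E \<union> F"]) auto
  qed
  interpret sigma_algebra \<Omega> "sigma_sets \<Omega> G"
    by (rule sigma_algebra_sigma_sets[OF assms(2)])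
  have "\<Omega> \<inter> \<Inter>F \<in> sigma_sets \<Omega> G" if "finite F" "F \<subseteq> G" for F
    using that
  proof (induction F)
    case (insert A F)
    then have "A \<in> sigma_sets \<Omega> G" "\<Omega> \<inter> \<Inter>F \<in> sigma_sets \<Omega> G" by auto
    then have "A \<inter> (\<Omega> \<inter> \<Inter>F) \<in> sigma_sets \<Omega> G" by (rule Int)
    moreover have "\<Omega> \<inter> \<Inter>(insert A F) = A \<inter> (\<Omega> \<inter> \<Inter>F)" by auto
    ultimately show ?case by simp
  qed auto
  then have "sigma_sets \<Omega> ?H \<subseteq> sigma_sets \<Omega> G"
    by (intro sigma_sets_subset) auto
  moreover have "A \<in> ?H" if "A \<in> G" for A
    using that assms(2) by (intro image_eqI[of _ _ "{A}"]) auto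
  then have "sigma_sets \<Omega> G \<subseteq> sigma_sets \<Omega> ?H" by (intro sigma_sets_mono') auto
  ultimately show "sigma_sets \<Omega> ?H = sigma_sets \<Omega> G" by blast
qed

lemma sphere_measure_countable_generator:
  obtains G where "countable G" "G \<subseteq> Pow (space (sphere_measure :: 'a::euclidean_space measure))"
    "Int_stable G"
    "sets (sphere_measure :: 'a measure) = sigma_sets (space (sphere_measure :: 'a measure)) G"
proof -
  let ?S = "sphere (0::'a) 1"
  obtain B :: "'a set set" where B: "countable B" "topological_basis B"
    using ex_countable_basis by blast
  have borel: "sets (borel :: 'a measure) = sigma_sets UNIV B"
    unfolding borel_eq_countable_basis[OF B] by simp
  have "?S \<in> sigma_sets UNIV B" unfolding borel[symmetric] by simp
  then have "sets (restrict_space borel ?S) = sigma_sets ?S ((\<inter>) ?S ` B)"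
    unfolding sets_restrict_space borel by (rule sigma_sets_Int) auto
  then have sets: "sets (sphere_measure :: 'a measure) = sigma_sets ?S ((\<inter>) ?S ` B)" by simp
  have "countable ((\<inter>) ?S ` B)" "(\<inter>) ?S ` B \<subseteq> Pow ?S" using B(1) by auto
  then obtain H where H: "countable H" "H \<subseteq> Pow ?S" "Int_stable H"
      "sigma_sets ?S H = sigma_sets ?S ((\<inter>) ?S ` B)"
    by (rule countable_Int_stable_generator) (rule that)
  show thesis
    by (rule that[of H]) (use H sets in simp_all)
qed

text \<open>The field \<open>w \<xi> = \<surd>d \<xi>\<close> on the sphere, and for a given \<open>X\<close> with eigenvalues \<open>l\<close> the multiplier
\<open>f \<circ> Q\<close>, where \<open>Q\<close> passes to the eigenbasis of \<open>X\<close> and \<open>f\<close> has moments \<open>l/\<vartheta>\<close>.\<close>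

theorem universal_commuting_dilation:
  "\<exists>(C :: (ell2 \<Rightarrow>\<^sub>L ell2) set) (V :: (real^'n) \<Rightarrow>\<^sub>L ell2).
      (\<forall>T\<in>C. selfadjoint_contraction T) \<and>
      (\<forall>S\<in>C. \<forall>T\<in>C. S o\<^sub>L T = T o\<^sub>L S) \<and>
      isometry V \<and>
      (\<forall>X :: real^'n^'n. symmetric_contraction X \<longrightarrow>
         (\<exists>T\<in>C. (1 / vartheta TYPE('n)) *\<^sub>R X = compression V T))"
proof -
  let ?\<sigma> = "sphere_measure :: (real^'n) measure" and ?d = "real CARD('n)"
  let ?w = "\<lambda>x::real^'n. sqrt ?d *\<^sub>R x"
  interpret finite_measure ?\<sigma> by (rule finite_measure_sphere)
  obtain G where G: "countable G" "G \<subseteq> Pow (space ?\<sigma>)" "Int_stable G" "sets ?\<sigma> = sigma_sets (space ?\<sigma>) G"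
    by (rule sphere_measure_countable_generator)
  have w: "(\<lambda>x. ?w x $ i) \<in> bounded_measurable ?\<sigma>" for i
    unfolding vector_scaleR_component real_scaleR_def
    by (intro bounded_measurable_cmult sphere_coordinate_bounded_measurable)
  have ww: "?w x $ i * ?w x $ j = ?d * (x $ i * x $ j)" for x i j
    by simp
  have w1: "(LINT x|?\<sigma>. ?w x $ i * ?w x $ j) = (if i = j then 1 else 0)" for i j
    unfolding ww by (simp add: sphere_second_moments)
  obtain V :: "(real^'n) \<Rightarrow>\<^sub>L ell2" and T :: "(real^'n \<Rightarrow> real) \<Rightarrow> ell2 \<Rightarrow>\<^sub>L ell2"
    where VT: "isometry V" "\<And>f. f \<in> contractive_multipliers ?\<sigma> \<Longrightarrow> selfadjoint_contraction (T f)"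
    "\<And>f g. f \<in> contractive_multipliers ?\<sigma> \<Longrightarrow> g \<in> contractive_multipliers ?\<sigma> \<Longrightarrow> T f o\<^sub>L T g = T g o\<^sub>L T f"
    "\<And>f i j. f \<in> contractive_multipliers ?\<sigma> \<Longrightarrow>
      compression V (T f) $ i $ j = (LINT x|?\<sigma>. f x * (?w x $ i * ?w x $ j))"
    by (rule commuting_dilation_of_integrals[OF G w w1]) (rule that)
  have "\<exists>F\<in>contractive_multipliers ?\<sigma>. (1 / vartheta TYPE('n)) *\<^sub>R X = compression V (T F)"
    if X: "symmetric_contraction X" for X :: "real^'n^'n"
  proof -
    have Xt: "transpose X = X" "onorm ((*v) X) \<le> 1" using X by (simp_all add: symmetric_contraction_def)
    obtain u :: "'n \<Rightarrow> real^'n" and l where u: "\<And>i. norm (u i) = 1" "\<And>i. X *v u i = l i *\<^sub>R u i"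
      "\<And>x y. x \<bullet> y = (\<Sum>i\<in>UNIV. (u i \<bullet> x) * (u i \<bullet> y))"
      "\<And>x y. x \<bullet> (X *v y) = (\<Sum>i\<in>UNIV. l i * ((u i \<bullet> x) * (u i \<bullet> y)))"
      by (rule symmetric_matrix_eigenbasis[OF Xt(1)]) (rule that)
    have l: "\<bar>l i\<bar> \<le> 1" for i
      using onorm[OF matrix_vector_mul_bounded_linear, of X "u i"] Xt(2) by (simp add: u(1,2))
    have \<theta>: "0 \<le> 1 / vartheta TYPE('n)"
    proof -
      have "0 \<le> sphere_mean a" for a :: "real^'n" by (simp add: sphere_mean_def)
      then show ?thesis using vartheta_minimum[where 'n='n] by metis
    qed
    have "\<bar>(\<chi> i. (1 / vartheta TYPE('n)) * l i) $ i\<bar> \<le> 1 / vartheta TYPE('n)" for i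
      using mult_left_mono[OF l[of i] \<theta>] \<theta> by (simp add: abs_mult)
    then obtain f where f: "f \<in> even_multipliers" "diagonal_moments f = (\<chi> i. (1 / vartheta TYPE('n)) * l i)"
      using cube_subset_diagonal_moments by blast
    have fl: "?d * (LINT x|?\<sigma>. f x * (x $ k * x $ k)) = (1 / vartheta TYPE('n)) * l k" for k
      using f(2) by (simp add: vec_eq_iff diagonal_moments_def power2_eq_square)
    define Q where "Q x = (\<chi> i. u i \<bullet> x)" for x
    have Q: "orthogonal_transformation Q"
      unfolding orthogonal_transformation_def Q_def
      by (auto intro!: linearI simp: vec_eq_iff inner_add_right inner_vec_def[of "\<chi> i. _ i"] simp flip: u(3))
    have Qm: "Q \<in> ?\<sigma> \<rightarrow>\<^sub>M ?\<sigma>" by (rule orthogonal_transformation_measurable_sphere[OF Q])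
    let ?F = "\<lambda>x. f (Q x)"
    have F: "?F \<in> contractive_multipliers ?\<sigma>"
      using f(1) measurable_compose[OF Qm, of f borel] orthogonal_transformation_norm[OF Q]
      by (auto simp: even_multipliers_def contractive_multipliers_def)
    have "compression V (T ?F) $ i $ j = ((1 / vartheta TYPE('n)) *\<^sub>R X) $ i $ j" for i j
    proof -
      let ?L = "\<lambda>i x. \<Sum>k\<in>UNIV. u k $ i * x $ k" 
      have coord: "x $ i = ?L i (Q x)" for x i
        using u(3)[of "axis i 1" x] by (simp add: inner_axis' inner_axis Q_def)
      have L_bm: "?L i \<in> bounded_measurable ?\<sigma>" for i
        by (intro bounded_measurable_sum bounded_measurable_cmult sphere_coordinate_bounded_measurable)
      have f_bm: "f \<in> bounded_measurable ?\<sigma>" by (rule even_multiplier_bounded_measurable[OF f(1)])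
      have fxx_bm: "(\<lambda>x. f x * (x $ k * x $ m)) \<in> bounded_measurable ?\<sigma>" for k m
        by (intro bounded_measurable_mult f_bm sphere_coordinate_bounded_measurable)
      have "(LINT x|?\<sigma>. ?F x * (x $ i * x $ j)) = (LINT x|?\<sigma>. ?F x * (?L i (Q x) * ?L j (Q x)))"
        by (simp only: coord[symmetric])
      also have "\<dots> = (LINT x|?\<sigma>. f x * (?L i x * ?L j x))"
        by (rule sphere_integral_orthogonal[OF Q, of "\<lambda>x. f x * (?L i x * ?L j x)"])
          (intro bounded_measurableD bounded_measurable_mult f_bm L_bm)
      also have "\<dots> = (LINT x|?\<sigma>. (\<Sum>k\<in>UNIV. \<Sum>m\<in>UNIV. (u k $ i * u m $ j) * (f x * (x $ k * x $ m))))"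
        unfolding sum_product unfolding sum_distrib_left
        by (intro Bochner_Integration.integral_cong sum.cong refl) (simp only: mult_ac)
      also have "\<dots> = (\<Sum>k\<in>UNIV. \<Sum>m\<in>UNIV. (u k $ i * u m $ j) * (LINT x|?\<sigma>. f x * (x $ k * x $ m)))"
        by (simp add: Bochner_Integration.integral_sum integrable_bounded_measurable fxx_bm
            bounded_measurable_cmult bounded_measurable_sum)
      also have "\<dots> = (\<Sum>k\<in>UNIV. \<Sum>m\<in>UNIV.
          if m = k then (u k $ i * u k $ j) * (LINT x|?\<sigma>. f x * (x $ k * x $ k)) else 0)"
        by (intro sum.cong refl) (simp add: even_multiplier_off_diagonal[OF f(1)])
      finally have *: "(LINT x|?\<sigma>. ?F x * (x $ i * x $ j))
          = (\<Sum>k\<in>UNIV. (u k $ i * u k $ j) * (LINT x|?\<sigma>. f x * (x $ k * x $ k)))" by simp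
      have "compression V (T ?F) $ i $ j = ?d * (LINT x|?\<sigma>. ?F x * (x $ i * x $ j))"
        unfolding VT(4)[OF F] ww integral_mult_right_zero[symmetric] by (simp only: mult.left_commute)
      also have "\<dots> = (\<Sum>k\<in>UNIV. (u k $ i * u k $ j) * (?d * (LINT x|?\<sigma>. f x * (x $ k * x $ k))))"
        unfolding * by (simp add: sum_distrib_left mult.left_commute)
      also have "\<dots> = (1 / vartheta TYPE('n)) * (\<Sum>k\<in>UNIV. l k * (u k $ i * u k $ j))"
        unfolding fl sum_distrib_left by (intro sum.cong refl) (simp add: mult_ac)
      also have "\<dots> = (1 / vartheta TYPE('n)) * X $ i $ j"
        using u(4)[of "axis i 1" "axis j 1"] by (simp add: inner_matrix_axis inner_axis)
      finally show ?thesis by simp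
    qed
    then have "(1 / vartheta TYPE('n)) *\<^sub>R X = compression V (T ?F)" by (simp add: vec_eq_iff)
    with F show ?thesis by blast
  qed
  with VT(1-3) show ?thesis
    by (intro exI[of _ "T ` contractive_multipliers ?\<sigma>"] exI[of _ V]) (auto simp: Bex_def)
qed

section \<open>Dilations on an arbitrary Hilbert space and optimality of the constant\<close>

text \<open>Both directions of the description of dilations by finitely many vectors: \<open>dilation_atoms\<close> on the given space, and
multiplication operators for the counting measure on the atoms for the way back.\<close>

theorem dilation_on_ell2:
  fixes Y :: "nat \<Rightarrow> real^'n^'n"
  assumes "dilates_to_commuting_contractions TYPE('h::{real_inner, complete_space}) g Y"
  shows "dilates_to_commuting_contractions TYPE(ell2) g Y"
proof -
  obtain I w s where I: "finite (I :: (nat set \<times> 'n) set)" and s: "\<And>j m. \<bar>s j m\<bar> \<le> 1"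
    and w: "\<And>x y. (\<Sum>m\<in>I. (w m \<bullet> x) * (w m \<bullet> y)) = x \<bullet> y"
    and Y: "\<And>j x y. j < g \<Longrightarrow> (\<Sum>m\<in>I. s j m * ((w m \<bullet> x) * (w m \<bullet> y))) = x \<bullet> (Y j *v y)"
    by (rule dilation_atoms[OF assms]) (rule that)
  let ?M = "count_space I"
  interpret finite_measure ?M by (rule finite_measure_count_space[OF I])
  have w_bm: "(\<lambda>m. w m $ i) \<in> bounded_measurable ?M" for i
    by (rule bounded_measurableI[of _ _ "\<Sum>m\<in>I. \<bar>w m $ i\<bar>"]) (auto intro: member_le_sum[of _ I] simp: I)
  have w1: "(LINT m|?M. w m $ i * w m $ j) = (if i = j then 1 else 0)" for i j
    using w[of "axis i 1" "axis j 1"] I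
    by (simp add: lebesgue_integral_count_space_finite inner_axis) (simp add: axis_def)
  obtain V :: "(real^'n) \<Rightarrow>\<^sub>L ell2" and T :: "(nat set \<times> 'n \<Rightarrow> real) \<Rightarrow> ell2 \<Rightarrow>\<^sub>L ell2"
    where VT: "isometry V" "\<And>f. f \<in> contractive_multipliers ?M \<Longrightarrow> selfadjoint_contraction (T f)"
    "\<And>f g. f \<in> contractive_multipliers ?M \<Longrightarrow> g \<in> contractive_multipliers ?M \<Longrightarrow> T f o\<^sub>L T g = T g o\<^sub>L T f"
    "\<And>f i j. f \<in> contractive_multipliers ?M \<Longrightarrow>
      compression V (T f) $ i $ j = (LINT m|?M. f m * (w m $ i * w m $ j))"
  proof (rule commuting_dilation_of_integrals[OF _ _ _ _ w_bm w1])
    show "countable (Pow I)" using I by (simp add: countable_finite)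
    show "Int_stable (Pow I)" by (auto simp: Int_stable_def)
    show "sets ?M = sigma_sets (space ?M) (Pow I)"
      using sigma_algebra.sigma_sets_eq[OF sigma_algebra_Pow[of I]] by simp
  qed (auto intro: that)
  have sF: "s j \<in> contractive_multipliers ?M" for j
    using s by (auto simp: contractive_multipliers_def)
  have "Y j = compression V (T (s j))" if "j < g" for j
  proof (simp add: vec_eq_iff VT(4)[OF sF], intro allI)
    fix i k
    show "Y j $ i $ k = (LINT m|?M. s j m * (w m $ i * w m $ k))"
      using Y[OF that, of "axis i 1" "axis k 1"] I
      by (simp add: lebesgue_integral_count_space_finite inner_axis inner_matrix_axis)
  qed
  then show ?thesis
    unfolding dilates_to_commuting_contractions_def dilates_to_def
    using VT(1-3) sF by (intro exI[of _ "\<lambda>j. T (s j)"]) auto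
qed

text \<open>The matrix \<open>X = U\<^sup>T D U\<close>, where \<open>D\<close> is the diagonal matrix of \<open>t\<close>.\<close>

lemma rotated_sign_matrix:
  fixes U :: "real^'n \<Rightarrow> real^'n" and t :: "'n \<Rightarrow> real"
  assumes U: "orthogonal_transformation U" and t: "\<And>i. \<bar>t i\<bar> \<le> 1"
  obtains X :: "real^'n^'n" where "symmetric_contraction X"
    "\<And>x y. x \<bullet> (X *v y) = (\<Sum>i\<in>UNIV. t i * (U x $ i * U y $ i))"
proof -
  define D where "D x = (\<chi> i. t i * x $ i)" for x :: "real^'n"
  have D_lin: "linear D"
    by (rule linearI) (simp_all add: D_def vec_eq_iff algebra_simps)
  have U_lin: "linear U" by (rule orthogonal_transformation_linear[OF U])
  define A where "A = adjoint U \<circ> (D \<circ> U)"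
  have A_lin: "linear A"
    unfolding A_def by (intro linear_compose D_lin U_lin adjoint_linear)
  define X where "X = matrix A"
  have X: "X *v y = A y" for y by (simp add: X_def matrix_works A_lin)
  have form: "x \<bullet> (X *v y) = U x \<bullet> D (U y)" for x y
    by (simp add: X A_def adjoint_works U_lin)
  have form': "x \<bullet> (X *v y) = (\<Sum>i\<in>UNIV. t i * (U x $ i * U y $ i))" for x y
    unfolding form by (simp add: D_def inner_vec_def mult.left_commute)
  have "norm (X *v v) \<le> 1 * norm v" for v
  proof -
    have "norm (D z) \<le> norm z" for z
    proof (rule norm_le_componentwise_cart)
      show "norm (D z $ i) \<le> norm (z $ i)" for i
        using mult_right_mono[OF t[of i], of "\<bar>z $ i\<bar>"] by (simp add: D_def abs_mult)
    qed
    then have "norm (D (U v)) \<le> norm v"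
      using orthogonal_transformation_norm[OF U] by metis
    have "(norm (X *v v))\<^sup>2 = U (X *v v) \<bullet> D (U v)"
      by (simp add: power2_norm_eq_inner form)
    also have "\<dots> \<le> norm (U (X *v v)) * norm (D (U v))" by (rule norm_cauchy_schwarz)
    also have "\<dots> \<le> norm (X *v v) * norm v"
      using \<open>norm (D (U v)) \<le> norm v\<close> orthogonal_transformation_norm[OF U]
      by (simp add: mult_left_mono)
    finally show ?thesis
      by (cases "norm (X *v v) = 0") (auto simp: power2_eq_square)
  qed
  then have "onorm ((*v) X) \<le> 1" by (intro onorm_bound) auto
  moreover have "transpose X = X"
  proof -
    have "axis i 1 \<bullet> (X *v axis j 1) = axis j 1 \<bullet> (X *v axis i 1)" for i j
      unfolding form' by (simp add: mult.commute)
    then show ?thesis by (simp add: inner_matrix_axis vec_eq_iff transpose_def)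
  qed
  ultimately show thesis using form' by (intro that) (simp_all add: symmetric_contraction_def)
qed

theorem dilation_constant_optimal:
  assumes \<theta>: "1 \<le> \<theta>" "\<theta> < vartheta TYPE('n::finite)"
  shows "\<exists>g\<ge>1. \<exists>X :: nat \<Rightarrow> real^'n^'n.
     (\<forall>j<g. symmetric_contraction (X j)) \<and>
     \<not> dilates_to_commuting_contractions TYPE(ell2) g (\<lambda>j. (1 / \<theta>) *\<^sub>R X j)"
proof -
  let ?d = "real CARD('n)"
  obtain a :: "real^'n" where a: "a \<in> cross_sphere" "1 / vartheta TYPE('n) = sphere_mean a"
    using vartheta_minimum by blast
  let ?q = "diagonal_form a"
  have "sphere_mean a < 1 / \<theta>"
    unfolding a(2)[symmetric] using \<theta> by (intro divide_strict_left_mono mult_pos_pos) auto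
  then obtain c where c: "sphere_mean a < c" "c < 1 / \<theta>" using dense by blast
  have "continuous_on (sphere 0 1) (\<lambda>x. \<bar>?q x\<bar>)" by (intro continuous_intros)
  then obtain Us :: "(real^'n \<Rightarrow> real^'n) list" where Us: "Us \<noteq> []"
      "\<And>U. U \<in> set Us \<Longrightarrow> orthogonal_transformation U"
      "\<And>v. norm v = 1 \<Longrightarrow> (\<Sum>U\<leftarrow>Us. \<bar>?q (U v)\<bar>) \<le> length Us * c"
    using rotation_average_close_to_mean[of "\<lambda>x. \<bar>?q x\<bar>" c] c(1)
    unfolding sphere_mean_diagonal_form by metis
  define g where "g = length Us"
  define U where "U j = Us ! j" for j
  have U: "orthogonal_transformation (U j)" if "j < g" for j
    using Us(2) that by (simp add: U_def g_def)
  have avg: "(\<Sum>j<g. \<bar>?q (U j v)\<bar>) \<le> g * c * (v \<bullet> v)" for v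
  proof (cases "v = 0")
    case True
    have "?q (U j v) = 0" if "j < g" for j
      using linear_0[OF orthogonal_transformation_linear[OF U[OF that]]] True
      by (simp add: diagonal_form_def)
    then show ?thesis using True by simp
  next
    case False
    have "(\<Sum>j<g. \<bar>?q (U j (sgn v))\<bar>) \<le> g * c"
      using Us(3)[of "sgn v"] False
      by (simp add: norm_sgn sum_list_sum_nth atLeast0LessThan g_def U_def)
    then have "(\<Sum>j<g. \<bar>?q (U j (sgn v))\<bar>) * (v \<bullet> v) \<le> g * c * (v \<bullet> v)"
      by (rule mult_right_mono) simp
    moreover have "\<bar>?q (U j (sgn v))\<bar> * (v \<bullet> v) = \<bar>?q (U j v)\<bar>" if "j < g" for j
      using False linear_scale[OF orthogonal_transformation_linear[OF U[OF that]]]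
      by (simp add: sgn_div_norm diagonal_form_scaleR abs_mult power2_norm_eq_inner[symmetric] power_divide field_simps)
    ultimately show ?thesis by (simp add: sum_distrib_right)
  qed
  have "\<exists>X. symmetric_contraction X \<and>
      (\<forall>x y. x \<bullet> (X *v y) = (\<Sum>i\<in>UNIV. sgn (a $ i) * (U j x $ i * U j y $ i)))" if "j < g" for j
    using rotated_sign_matrix[OF U[OF that], of "\<lambda>i. sgn (a $ i)"] by (metis abs_sgn_eq_1 abs_0 order_refl sgn_zero zero_le_one)
  then obtain X :: "nat \<Rightarrow> real^'n^'n" where X: "\<And>j. j < g \<Longrightarrow> symmetric_contraction (X j)"
    "\<And>j x y. j < g \<Longrightarrow> x \<bullet> (X j *v y) = (\<Sum>i\<in>UNIV. sgn (a $ i) * (U j x $ i * U j y $ i))"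
    by metis
  have "\<not> dilates_to_commuting_contractions TYPE(ell2) g (\<lambda>j. (1 / \<theta>) *\<^sub>R X j)"
  proof
    assume "dilates_to_commuting_contractions TYPE(ell2) g (\<lambda>j. (1 / \<theta>) *\<^sub>R X j)"
    then obtain I w s where I: "finite (I :: (nat set \<times> 'n) set)" and s: "\<And>j m. \<bar>s j m\<bar> \<le> 1"
      and w: "\<And>x y. (\<Sum>m\<in>I. (w m \<bullet> x) * (w m \<bullet> y)) = x \<bullet> y"
      and Y: "\<And>j x y. j < g \<Longrightarrow> (\<Sum>m\<in>I. s j m * ((w m \<bullet> x) * (w m \<bullet> y))) = x \<bullet> (((1 / \<theta>) *\<^sub>R X j) *v y)"
      by (rule dilation_atoms) (rule that)
    have trace: "(\<Sum>m\<in>I. w m \<bullet> w m) = ?d"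
    proof -
      have "(\<Sum>m\<in>I. w m \<bullet> w m) = (\<Sum>m\<in>I. \<Sum>i\<in>UNIV. (w m \<bullet> axis i 1) * (w m \<bullet> axis i 1))"
        by (simp add: inner_vec_def[of "w _" "w _"] inner_axis)
      also have "\<dots> = (\<Sum>i\<in>(UNIV::'n set). axis i 1 \<bullet> axis i (1::real))"
        by (subst sum.swap) (simp add: w)
      finally show ?thesis by (simp add: inner_axis)
    qed
    have pairing: "(\<Sum>m\<in>I. s j m * ?q (U j (w m))) = ?d / \<theta>" if j: "j < g" for j
    proof -
      note Uj = U[OF j]
      have row: "(\<Sum>m\<in>I. s j m * (U j (w m) $ i)\<^sup>2) = sgn (a $ i) / \<theta>" for i
      proof -
        \<comment> \<open>\<open>r\<close> is the \<open>i\<close>-th row of \<open>U j\<close>\<close>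
        obtain r where r: "axis i 1 = U j r"
          using orthogonal_transformation_surj[OF Uj] by (metis surjD)
        have "U j x $ i = x \<bullet> r" for x
        proof -
          have "U j x $ i = U j x \<bullet> U j r" by (simp add: r[symmetric] inner_axis)
          then show ?thesis using Uj by (simp add: orthogonal_transformation_def)
        qed
        then have "(\<Sum>m\<in>I. s j m * (U j (w m) $ i)\<^sup>2) = r \<bullet> (((1 / \<theta>) *\<^sub>R X j) *v r)"
          by (simp add: Y[OF j, symmetric] power2_eq_square)
        also have "\<dots> = (r \<bullet> (X j *v r)) / \<theta>"
          by (simp add: scaleR_matrix_vector_assoc[symmetric])
        also have "r \<bullet> (X j *v r) = (\<Sum>k\<in>UNIV. if k = i then sgn (a $ i) else 0)"
          unfolding X(2)[OF j] r[symmetric] by (intro sum.cong refl) (simp add: axis_def)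
        finally show ?thesis by simp
      qed
      have "(\<Sum>m\<in>I. s j m * ?q (U j (w m))) = (\<Sum>i\<in>UNIV. a $ i * (\<Sum>m\<in>I. s j m * (U j (w m) $ i)\<^sup>2))"
        unfolding diagonal_form_def sum_distrib_left
        by (subst sum.swap) (simp add: mult.left_commute)
      also have "\<dots> = (\<Sum>i\<in>UNIV. \<bar>a $ i\<bar> / \<theta>)"
        by (simp add: row abs_sgn)
      finally show ?thesis
        using a(1) by (simp add: cross_sphere_def sum_divide_distrib[symmetric])
    qed
    have "g * (?d / \<theta>) = (\<Sum>j<g. \<Sum>m\<in>I. s j m * ?q (U j (w m)))"
      by (simp add: pairing)
    also have "\<dots> \<le> (\<Sum>j<g. \<Sum>m\<in>I. \<bar>?q (U j (w m))\<bar>)"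
    proof (intro sum_mono)
      fix j m
      have "s j m * ?q (U j (w m)) \<le> \<bar>s j m\<bar> * \<bar>?q (U j (w m))\<bar>" by (metis abs_ge_self abs_mult)
      also have "\<dots> \<le> 1 * \<bar>?q (U j (w m))\<bar>" by (intro mult_right_mono s) simp
      finally show "s j m * ?q (U j (w m)) \<le> \<bar>?q (U j (w m))\<bar>" by simp
    qed
    also have "\<dots> = (\<Sum>m\<in>I. \<Sum>j<g. \<bar>?q (U j (w m))\<bar>)" by (rule sum.swap)
    also have "\<dots> \<le> (\<Sum>m\<in>I. g * c * (w m \<bullet> w m))" by (intro sum_mono avg)
    also have "\<dots> = g * c * ?d" by (simp add: trace flip: sum_distrib_left)
    finally have "g * ?d * (1 / \<theta>) \<le> g * ?d * c" by (simp add: mult_ac)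
    moreover have "real g * ?d > 0" using Us(1) by (simp add: g_def)
    ultimately have "1 / \<theta> \<le> c" by (simp only: mult_le_cancel_left_pos)
    then show False using c(2) by simp
  qed
  moreover have "g \<ge> 1" using Us(1) by (cases Us) (auto simp: g_def)
  ultimately show ?thesis using X(1) by blast
qed

theorem theorem1p1:
  fixes dim :: "'n::finite itself"
    and hilbert :: "'h::{real_inner, complete_space} itself"
  shows
    "(\<exists>(C :: (ell2 \<Rightarrow>\<^sub>L ell2) set) (V :: (real^'n) \<Rightarrow>\<^sub>L ell2).
        (\<forall>T\<in>C. selfadjoint_contraction T) \<and>
        (\<forall>S\<in>C. \<forall>T\<in>C. S o\<^sub>L T = T o\<^sub>L S) \<and>
        isometry V \<and>
        (\<forall>X :: real^'n^'n. symmetric_contraction X \<longrightarrow>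
           (\<exists>T\<in>C. (1 / vartheta TYPE('n)) *\<^sub>R X = compression V T)))
     \<and> (\<forall>\<theta>'::real. 1 \<le> \<theta>' \<and> \<theta>' < vartheta TYPE('n) \<longrightarrow>
          (\<exists>g\<ge>1. \<exists>X :: nat \<Rightarrow> real^'n^'n.
             (\<forall>j<g. symmetric_contraction (X j)) \<and>
             \<not> dilates_to_commuting_contractions TYPE(ell2) g (\<lambda>j. (1 / \<theta>') *\<^sub>R X j)))
     \<and> (\<forall>g. \<forall>Y :: nat \<Rightarrow> real^'n^'n.
          dilates_to_commuting_contractions TYPE('h) g Y \<longrightarrow>
          dilates_to_commuting_contractions TYPE(ell2) g Y)"
  using universal_commuting_dilation[where 'n='n] dilation_constant_optimal[where 'n='n]
    dilation_on_ell2[where 'h='h and 'n='n]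
  by blast

end
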